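(* For $d=4$ and $d=5$, the cone $\Sigma_{2d}^\vee$ has extreme rays of rank $r$ for $r=1$ and for all integers $r$ such that $3d-2\leq r\leq\binom{d+2}{2}-4$. The cone $\Sigma_{12}^\vee$ has no extreme ray of rank $17$, but has extreme rays of rank $r$ for all integers $16\leq r\leq 24$ with $r\neq 17$.
   Context: $\mathbb{R}[x,y,z]_m$ is the vector space of real forms of degree $m$ in three variables. $\Sigma_{2d}\subset\mathbb{R}[x,y,z]_{2d}$ is the convex cone of sums of squares of forms of degree $d$. For $\ell\in\mathbb{R}[x,y,z]_{2d}^\ast$, $B_\ell$ is the symmetric bilinear form $(f,g)\mapsto\ell(fg)$ on $\mathbb{R}[x,y,z]_d$. The dual cone is $\Sigma_{2d}^\vee=\{\ell\in\mathbb{R}[x,y,z]_{2d}^\ast : B_\ell\text{ is positive semidefinite}\}$. An extreme ray of $\Sigma_{2d}^\vee$ is a one-dimensional face $\mathbb{R}_+\ell$; its rank is the rank of $B_\ell$. *)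

theory Defs
  imports "HOL-Analysis.Analysis" "HOL-Analysis.Finite_Function_Topology"
    "HOL-Library.Function_Algebras"
begin

text \<open>The library makes functions an additive group pointwise (Function_Algebras) but provides no
  scalar multiplication; with it, linear functionals live in a real vector space, so that
  \<open>convex\<close>, \<open>dim\<close> and \<open>face_of\<close> apply to them.\<close>

instantiation "fun" :: (type, real_vector) real_vector
begin

definition scaleR_fun :: "real \<Rightarrow> ('a \<Rightarrow> 'b) \<Rightarrow> 'a \<Rightarrow> 'b"
  where "scaleR_fun c f = (\<lambda>x. c *\<^sub>R f x)"

instance
  by standard (simp_all add: scaleR_fun_def fun_eq_iff scaleR_add_left scaleR_add_right)

end

text \<open>\<open>\<real>[x,y,z]\<close>: finitely supported coefficient functions on exponent vectors, with the
  convolution product; the type \<open>3\<close> indexes the variables.\<close>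

type_synonym ternary = "(3 \<Rightarrow>\<^sub>0 nat) \<Rightarrow>\<^sub>0 real"

definition forms :: "nat \<Rightarrow> ternary set"
  where "forms m = {f. \<forall>\<alpha>\<in>Poly_Mapping.keys f. (\<Sum>i\<in>UNIV. Poly_Mapping.lookup \<alpha> i) = m}"

definition sos :: "nat \<Rightarrow> ternary set"
  where "sos d = {p. \<exists>fs. set fs \<subseteq> forms d \<and> p = (\<Sum>f\<leftarrow>fs. f * f)}"

text \<open>The dual of a linear subspace \<open>V\<close>: a functional on \<open>V\<close> is represented by its extension by
  zero outside \<open>V\<close>, so that functionals on \<open>V\<close> and their representatives correspond bijectively.\<close>

definition dual_space :: "'a::real_vector set \<Rightarrow> ('a \<Rightarrow> real) set"
  where "dual_space V = {l. (\<forall>f\<in>V. \<forall>g\<in>V. l (f + g) = l f + l g)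
    \<and> (\<forall>c. \<forall>f\<in>V. l (c *\<^sub>R f) = c * l f) \<and> (\<forall>f. f \<notin> V \<longrightarrow> l f = 0)}"

text \<open>Rank of a bilinear form \<open>B\<close> on \<open>V\<close>: the dimension of the image of
  \<open>V \<rightarrow> dual_space V, f \<mapsto> B(f, _)\<close>.\<close>

definition bilinear_rank :: "'a::real_vector set \<Rightarrow> ('a \<Rightarrow> 'a \<Rightarrow> real) \<Rightarrow> nat"
  where "bilinear_rank V B = dim ((\<lambda>f g. if g \<in> V then B f g else 0) ` V)"

definition B_form :: "(ternary \<Rightarrow> real) \<Rightarrow> ternary \<Rightarrow> ternary \<Rightarrow> real"
  where "B_form l f g = l (f * g)"

definition sos_dual :: "nat \<Rightarrow> (ternary \<Rightarrow> real) set"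
  where "sos_dual d = {l \<in> dual_space (forms (2 * d)). \<forall>f\<in>forms d. 0 \<le> B_form l f f}"

definition ray :: "'a::real_vector \<Rightarrow> 'a set"
  where "ray l = {c *\<^sub>R l | c. 0 \<le> c}"

definition extreme_ray_of :: "'a::real_vector set \<Rightarrow> 'a set \<Rightarrow> bool"  (infixr \<open>extreme'_ray'_of\<close> 50)
  where "R extreme_ray_of C \<longleftrightarrow> R face_of C \<and> (\<exists>l. l \<noteq> 0 \<and> R = ray l)"

text \<open>The rank of \<open>B_form l\<close> does not depend on the generator \<open>l\<close> of the ray.\<close>

definition has_extreme_ray_of_rank :: "nat \<Rightarrow> nat \<Rightarrow> bool"
  where "has_extreme_ray_of_rank d r \<longleftrightarrow>
    (\<exists>l. l \<noteq> 0 \<and> ray l extreme_ray_of sos_dual d \<and> bilinear_rank (forms d) (B_form l) = r)"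

lemma forms_eq: "forms m = {f. \<forall>\<alpha>. Poly_Mapping.lookup f \<alpha> \<noteq> 0 \<longrightarrow>
    (\<Sum>i\<in>UNIV. Poly_Mapping.lookup \<alpha> i) = m}"
  by (auto simp: forms_def in_keys_iff)

lemma lookup_scaleR: "Poly_Mapping.lookup (c *\<^sub>R f) \<alpha> = c *\<^sub>R Poly_Mapping.lookup f \<alpha>"
  for f :: "'a \<Rightarrow>\<^sub>0 'b::real_vector"
proof -
  have "{i. c *\<^sub>R Poly_Mapping.lookup f i \<noteq> 0} \<subseteq> Poly_Mapping.keys f"
    by (auto simp: in_keys_iff)
  then have "finite {i. c *\<^sub>R Poly_Mapping.lookup f i \<noteq> 0}"
    using finite_keys finite_subset by blast
  then show ?thesis
    by (simp add: scaleR_poly_mapping_def)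
qed

lemma subspace_forms: "subspace (forms m)"
  unfolding subspace_def forms_eq
  by (auto simp: lookup_add lookup_scaleR) (metis add_0)

lemma forms_mult: "f \<in> forms m \<Longrightarrow> g \<in> forms n \<Longrightarrow> f * g \<in> forms (m + n)"
  using keys_mult[of f g] by (fastforce simp: forms_def lookup_add sum.distrib)

text \<open>\<open>sos_dual d\<close> is indeed the dual cone of the cone of sums of squares.\<close>

lemma sos_dual_iff:
  "l \<in> sos_dual d \<longleftrightarrow> l \<in> dual_space (forms (2 * d)) \<and> (\<forall>p\<in>sos d. 0 \<le> l p)"
proof -
  have sq: "f * f \<in> forms (2 * d)" if "f \<in> forms d" for f
    using forms_mult[OF that that] by (simp add: mult_2)
  have "0 \<le> l (\<Sum>f\<leftarrow>fs. f * f) \<and> (\<Sum>f\<leftarrow>fs. f * f) \<in> forms (2 * d)"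
    if l: "l \<in> sos_dual d" and "set fs \<subseteq> forms d" for fs
    using that(2)
  proof (induction fs)
    case Nil
    have "0 \<in> forms (2 * d)" by (simp add: subspace_forms subspace_0)
    moreover have "l 0 = 0"
      using l calculation unfolding sos_dual_def dual_space_def
      by (metis (mono_tags, lifting) mem_Collect_eq mult_zero_left scaleR_zero_left)
    ultimately show ?case by simp
  next
    case (Cons f fs)
    then have 1: "f * f \<in> forms (2 * d)" "(\<Sum>f\<leftarrow>fs. f * f) \<in> forms (2 * d)"
        "0 \<le> l (\<Sum>f\<leftarrow>fs. f * f)" "f \<in> forms d"
      using sq by auto
    then have "0 \<le> l (f * f)" "l (f * f + (\<Sum>f\<leftarrow>fs. f * f)) = l (f * f) + l (\<Sum>f\<leftarrow>fs. f * f)"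
      using l by (auto simp: sos_dual_def dual_space_def B_form_def)
    with 1 show ?case by (simp add: subspace_add[OF subspace_forms])
  qed
  moreover have "f * f \<in> sos d" if "f \<in> forms d" for f
    using that by (auto simp: sos_def intro!: exI[of _ "[f]"])
  ultimately show ?thesis
    by (auto simp: sos_def sos_dual_def B_form_def)
qed

end

theory Submission
  imports Defs
begin

text \<open>Existence. Let \<open>A \<times> B\<close> be a grid with \<open>|A|, |B| \<le> d\<close> and \<open>|A| + |B| = d + 3 + e\<close>, and remove from it the
  points \<open>\<Gamma>'\<close> on a curve \<open>h = 0\<close> of degree \<open>e\<close> that is determined by any \<open>|\<Gamma>'| - 1\<close> of them
  (\<open>\<Gamma>' = {}\<close> if \<open>e = 0\<close>). By Cayley--Bacharach the evaluations of forms of degree \<open>d\<close> at the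
  remaining points \<open>p\<^sub>i\<close> satisfy exactly one linear relation, and all its coefficients are nonzero.
  Subtracting from a positive combination of the squares \<open>f(p\<^sub>i)\<^sup>2\<close>, \<open>i \<noteq> 0\<close>, the largest admissible
  multiple of \<open>f(p\<^sub>0)\<^sup>2\<close> gives an extreme ray of rank \<open>|A| |B| - |\<Gamma>'| - 2\<close>.

  Nonexistence. Let \<open>\<ell>\<close> span an extreme ray of rank 17 for \<open>d = 6\<close>, let \<open>I\<close> be its apolar ideal, and
  \<open>W = I\<^sub>6\<close>. Extremality says that \<open>W \<cdot> \<real>[x,y,z]\<^sub>6\<close> has codimension 1, so \<open>W\<close> has no real base point.
  Positivity implies that a general linear form \<open>a\<close> acts injectively on \<open>\<real>[x,y,z]/I\<close> up to degree 6,
  and restricting to the line \<open>a = 0\<close> leaves few possible Hilbert functions. If multiplication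
  by \<open>a\<close> is bijective from degree 5 to degree 6, then commuting multiplication operators produce a
  17-dimensional space of functionals vanishing on \<open>W \<cdot> \<real>[x,y,z]\<^sub>6\<close>. In the other cases there is a
  real base point, or counting syzygies shows that \<open>W \<cdot> \<real>[x,y,z]\<^sub>6\<close> is too small.\<close>

section \<open>Finite-dimensional linear algebra\<close>

text \<open>The sum \<open>d + 3 + e\<close> of the grid sizes comes from divided differences: their
  product over the grid kills all polynomials of degree at most \<open>|A| + |B| - 3\<close>, and
  weighting it with h of degree e leaves a relation for forms of degree d. In the rank, one
  dimension is lost to this relation and one to the subtracted square. The bounds
  \<open>|A|, |B| \<le> d\<close> put multiples of the two products of lines cutting out the grid
  into the radical, so that competing functionals are combinations of evaluations at grid points.
  For rank 17 the space W has dimension 28 - 17 = 11, and extremality asks for 90 of the 91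
  dimensions in degree 12. The obstacle is that 11 forms are numerically plenty for this. The
  Hilbert function has to reveal common generators of degree 4 and 5 first; only their syzygies
  bring the count down, to 89 in the tightest cases. Positivity is used through a single fact:
  \<open>L (f * f) = 0\<close> puts f into the radical. It yields the general linear form and also
  makes the multiplication operators commute.\<close>

definition fin_dim :: "'a::real_vector set \<Rightarrow> bool"
  where "fin_dim V \<longleftrightarrow> (\<exists>B. finite B \<and> V \<subseteq> span B)"

lemma fin_dim_subset: "fin_dim W \<Longrightarrow> V \<subseteq> W \<Longrightarrow> fin_dim V"
  unfolding fin_dim_def by blast

lemma fin_dim_basis:
  assumes "fin_dim V"
  obtains B where "B \<subseteq> V" "finite B" "independent B" "V \<subseteq> span B" "card B = dim V"
proof -
  obtain B where B: "B \<subseteq> V" "independent B" "V \<subseteq> span B" "card B = dim V"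
    using basis_exists by blast
  have "finite B"
    using assms B independent_span_bound unfolding fin_dim_def by (metis subset_trans)
  then show ?thesis using B that by blast
qed

lemma independent_card_le:
  assumes "fin_dim V" "B \<subseteq> V" "independent B"
  shows "finite B" "card B \<le> dim V"
proof -
  obtain C where C: "C \<subseteq> V" "finite C" "independent C" "V \<subseteq> span C" "card C = dim V"
    by (rule fin_dim_basis[OF assms(1)])
  show "finite B" "card B \<le> dim V"
    using independent_span_bound[OF C(2) assms(3)] assms(2) C by auto
qed

text \<open>\<open>dim\<close> is the cardinality of a basis, hence 0 when that basis is infinite,
  and the polynomial ring is infinite-dimensional. Comparisons of dimensions are therefore tied to
  \<open>fin_dim\<close>.\<close>

lemma dim_mono_fin_dim: "fin_dim W \<Longrightarrow> V \<subseteq> W \<Longrightarrow> dim V \<le> dim W"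
  by (metis basis_exists independent_card_le(2) subset_trans)

lemma subspace_eq_of_dim_le:
  assumes "fin_dim W" "subspace V" "V \<subseteq> W" "dim W \<le> dim V"
  shows "V = W"
proof (rule ccontr)
  assume "V \<noteq> W"
  then obtain w where w: "w \<in> W" "w \<notin> V" using assms by blast
  obtain B where B: "B \<subseteq> V" "finite B" "independent B" "V \<subseteq> span B" "card B = dim V"
    using fin_dim_basis fin_dim_subset assms by metis
  have "span B = V" using B assms(2) by (metis span_minimal subset_antisym)
  then have "independent (insert w B)" "w \<notin> B"
    using w B independent_insertI by auto
  then show False
    using independent_card_le(2)[OF assms(1), of "insert w B"] B w assms by auto
qed

lemma fin_dim_image:
  assumes "linear f" "fin_dim V" shows "fin_dim (f ` V)"
  using assms linear_span_image unfolding fin_dim_def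
  by (metis finite_imageI image_mono)

text \<open>A basis of the kernel is extended to one of V; the added vectors C span a complement of
  the kernel, on which f is injective.\<close>

theorem rank_nullity:
  assumes f: "linear f" and V: "subspace V" "fin_dim V"
  shows "dim V = dim (f ` V) + dim {v \<in> V. f v = 0}"
proof -
  let ?K = "{v \<in> V. f v = 0}"
  have K: "subspace ?K"
    using f V(1) by (auto simp: subspace_def linear_add linear_cmul linear_0)
  obtain BK where BK: "BK \<subseteq> ?K" "finite BK" "independent BK" "?K \<subseteq> span BK" "card BK = dim ?K"
    by (rule fin_dim_basis[of ?K]) (use fin_dim_subset[OF V(2)] in auto)
  obtain B where B: "BK \<subseteq> B" "B \<subseteq> V" "independent B" "V \<subseteq> span B"
    using maximal_independent_subset_extend[of BK V] BK by blast
  have finB: "finite B" using independent_card_le(1)[OF V(2)] B by blast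
  define C where "C = B - BK"
  have spanBK: "span BK = ?K" using BK K by (metis span_minimal subset_antisym)
  have spanB: "span B = V" using B V by (metis span_minimal subset_antisym)
  have disj: "x = 0" if x: "x \<in> span C" "x \<in> span BK" for x
  proof -
    obtain a where a: "x = (\<Sum>v\<in>C. a v *\<^sub>R v)"
      using x(1) finB unfolding C_def by (auto simp: span_finite)
    obtain b where b: "x = (\<Sum>v\<in>BK. b v *\<^sub>R v)"
      using x(2) BK(2) by (auto simp: span_finite)
    define c where "c = (\<lambda>v. if v \<in> BK then - b v else a v)"
    have "(\<Sum>v\<in>B. c v *\<^sub>R v) = (\<Sum>v\<in>C. c v *\<^sub>R v) + (\<Sum>v\<in>BK. c v *\<^sub>R v)"
      unfolding C_def by (simp add: sum.subset_diff[OF B(1) finB])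
    also have "\<dots> = x - x"
      unfolding a[symmetric] by (subst (2) b) (auto simp: a c_def C_def sum_negf intro!: sum.cong)
    finally have "(\<Sum>v\<in>B. c v *\<^sub>R v) = 0" by simp
    then have "c v = 0" if "v \<in> B" for v
      using B(3) finB that unfolding independent_explicit_finite_subsets by blast
    then have "b v = 0" if "v \<in> BK" for v
      using that B(1) by (force simp: c_def)
    then show ?thesis by (simp add: b)
  qed
  have inj: "inj_on f (span C)"
  proof (rule inj_onI)
    fix x y assume xy: "x \<in> span C" "y \<in> span C" "f x = f y"
    have "x - y \<in> span C" using xy span_diff by blast
    moreover have "x - y \<in> V" using calculation spanB span_mono[of C B] by (auto simp: C_def)
    moreover have "f (x - y) = 0" using xy f by (simp add: linear_diff)
    ultimately have "x - y = 0" using disj spanBK by blast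
    then show "x = y" by simp
  qed
  have "independent C" using B(3) independent_mono unfolding C_def by blast
  then have iC: "independent (f ` C)"
    using linear_independent_injective_image[OF f _ inj] by blast
  have "f ` V \<subseteq> span (f ` C)"
  proof -
    have "f b \<in> span (f ` C)" if "b \<in> B" for b
    proof (cases "b \<in> BK")
      case True then have "f b = 0" using BK(1) by blast
      then show ?thesis by (simp add: span_zero)
    next
      case False then show ?thesis using that by (auto simp: C_def intro: span_base)
    qed
    then have "span (f ` B) \<subseteq> span (f ` C)" by (simp add: span_minimal subspace_span image_subsetI)
    then show ?thesis using spanB linear_span_image[OF f, of B] by simp
  qed
  moreover have "f ` C \<subseteq> f ` V" using B(2) by (auto simp: C_def)
  moreover have "card (f ` C) = card C"
    using inj by (metis card_image inj_on_subset span_superset)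
  ultimately have "dim (f ` V) = card C" using iC dim_unique by metis
  moreover have "dim V = card B" using B basis_card_eq_dim by metis
  moreover have "card B = card C + card BK"
    unfolding C_def using B(1) finB BK(2) by (metis add.commute card_Diff_subset card_mono le_add_diff_inverse)
  ultimately show ?thesis using BK(5) by simp
qed

lemma dim_zero_space: "dim {0 :: 'a::real_vector} = 0"
  using dim_unique[of "{}" "{0 :: 'a}" 0] by (simp add: independent_empty)

lemma dim_image_inj:
  assumes f: "linear f" and V: "subspace V" "fin_dim V" and inj: "\<And>v. v \<in> V \<Longrightarrow> f v = 0 \<Longrightarrow> v = 0"
  shows "dim (f ` V) = dim V"
proof -
  have "{v \<in> V. f v = 0} = {0}" using inj f V by (auto simp: linear_0 subspace_0)
  moreover have "dim {0::'a} = 0" using dim_unique[of "{}" "{0::'a}" 0] by (simp add: independent_empty)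
  ultimately show ?thesis using rank_nullity[OF f V] by simp
qed

text \<open>For counting syzygies: any explicitly known part of the kernel already bounds the image
  from above.\<close>

lemma dim_image_le_kernel:
  assumes f: "linear f" and V: "subspace V" "fin_dim V"
    and K: "K \<subseteq> V" "\<And>v. v \<in> K \<Longrightarrow> f v = 0"
  shows "dim (f ` V) + dim K \<le> dim V"
proof -
  have "dim K \<le> dim {v \<in> V. f v = 0}"
    by (rule dim_mono_fin_dim) (use K fin_dim_subset[OF V(2)] in auto)
  then show ?thesis using rank_nullity[OF f V] by simp
qed

lemma fin_dim_Times:
  assumes "fin_dim U" "fin_dim V" shows "fin_dim (U \<times> V)"
proof -
  obtain B C where BC: "finite B" "U \<subseteq> span B" "finite C" "V \<subseteq> span C"
    using assms unfolding fin_dim_def by blast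
  let ?S = "(\<lambda>b. (b, 0)) ` B \<union> (\<lambda>c. (0, c)) ` C"
  have l1: "linear (\<lambda>b::'a. (b, 0::'b))" and l2: "linear (\<lambda>c::'b. (0::'a, c))"
    by (auto intro!: linearI)
  have "(u, v) \<in> span ?S" if "u \<in> U" "v \<in> V" for u v
  proof -
    have "(u, 0) \<in> span ?S"
      using that BC linear_span_image[OF l1, of B] span_mono[of "(\<lambda>b. (b, 0)) ` B" ?S] by (simp add: subset_iff image_iff)
    moreover have "(0, v) \<in> span ?S"
      using that BC linear_span_image[OF l2, of C] span_mono[of "(\<lambda>c. (0, c)) ` C" ?S] by (simp add: subset_iff image_iff)
    ultimately show ?thesis using span_add[of "(u, 0)" ?S "(0, v)"] by simp
  qed
  then show ?thesis unfolding fin_dim_def using BC(1,3)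
    by (intro exI[of _ ?S]) auto
qed

lemma subspace_Times_real: "subspace U \<Longrightarrow> subspace V \<Longrightarrow> subspace (U \<times> V)"
  by (auto simp: subspace_def zero_prod_def)

lemma dim_Times_fin_dim:
  assumes U: "subspace U" "fin_dim U" and V: "subspace V" "fin_dim V"
  shows "dim (U \<times> V) = dim U + dim V"
proof -
  have f: "linear (fst :: 'a \<times> 'b \<Rightarrow> 'a)" by (auto intro: linearI)
  have g: "linear (\<lambda>c::'b. (0::'a, c))" by (auto intro!: linearI)
  have "fst ` (U \<times> V) = U" using V subspace_0 by force
  moreover have "{v \<in> U \<times> V. fst v = 0} = (\<lambda>c. (0, c)) ` V" using U subspace_0 by force
  moreover have "dim ((\<lambda>c. (0::'a, c)) ` V) = dim V"
    by (rule dim_image_inj[OF g V]) (simp add: zero_prod_def)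
  ultimately show ?thesis
    using rank_nullity[OF f subspace_Times_real[OF U(1) V(1)] fin_dim_Times[OF U(2) V(2)]] by simp
qed

lemma subspace_kernel_on:
  assumes "linear f" "subspace V" shows "subspace {v \<in> V. f v = 0}"
  using assms by (auto simp: subspace_def linear_add linear_cmul linear_0)

text \<open>Induction on the family: on the kernel of one functional the others suffice, and what is
  missing outside that kernel is one-dimensional, hence a multiple of the removed
  functional.\<close>

lemma functional_in_span:
  fixes \<phi> :: "'i \<Rightarrow> 'a::real_vector \<Rightarrow> real"
  assumes "finite S" "subspace V" "\<And>s. s \<in> S \<Longrightarrow> linear (\<phi> s)" "linear \<psi>"
    and "\<And>v. v \<in> V \<Longrightarrow> (\<And>s. s \<in> S \<Longrightarrow> \<phi> s v = 0) \<Longrightarrow> \<psi> v = 0"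
  shows "\<exists>c. \<forall>v\<in>V. \<psi> v = (\<Sum>s\<in>S. c s * \<phi> s v)"
  using assms
proof (induction S arbitrary: V rule: finite_induct)
  case empty
  then show ?case by simp
next
  case (insert s1 S)
  let ?V' = "{v \<in> V. \<phi> s1 v = 0}"
  have "subspace ?V'" using insert.prems by (intro subspace_kernel_on) auto
  then have "\<exists>c. \<forall>v\<in>?V'. \<psi> v = (\<Sum>s\<in>S. c s * \<phi> s v)"
    using insert.prems by (intro insert.IH) auto
  then obtain c where c: "\<And>v. v \<in> V \<Longrightarrow> \<phi> s1 v = 0 \<Longrightarrow> \<psi> v = (\<Sum>s\<in>S. c s * \<phi> s v)" by blast
  show ?case
  proof (cases "\<exists>v\<in>V. \<phi> s1 v \<noteq> 0")
    case False
    then show ?thesis using c insert.hyps by (intro exI[of _ c]) auto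
  next
    case True
    then obtain w where w: "w \<in> V" "\<phi> s1 w \<noteq> 0" by blast
    \<comment> \<open>Chosen so that the identity holds at w; every v is a multiple of w plus an
      element of the kernel of \<open>\<phi> s1\<close>.\<close>
    define k where "k = (\<psi> w - (\<Sum>s\<in>S. c s * \<phi> s w)) / \<phi> s1 w"
    have "\<psi> v = (\<Sum>s\<in>insert s1 S. (c(s1 := k)) s * \<phi> s v)" if v: "v \<in> V" for v
    proof -
      define t where "t = \<phi> s1 v / \<phi> s1 w"
      have l1: "\<phi> s (v - t *\<^sub>R w) = \<phi> s v - t * \<phi> s w" if "s \<in> insert s1 S" for s
        using insert.prems(2)[OF that] by (simp add: linear_diff linear_cmul)
      have l2: "\<psi> (v - t *\<^sub>R w) = \<psi> v - t * \<psi> w"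
        using insert.prems(3) by (simp add: linear_diff linear_cmul)
      have "v - t *\<^sub>R w \<in> V" using v w insert.prems(1) by (simp add: subspace_diff subspace_scale)
      moreover have "\<phi> s1 (v - t *\<^sub>R w) = 0" using w l1[of s1] by (simp add: t_def)
      ultimately have "\<psi> v - t * \<psi> w = (\<Sum>s\<in>S. c s * (\<phi> s v - t * \<phi> s w))"
        using c[of "v - t *\<^sub>R w"] l1 l2 by simp
      then have "\<psi> v = (\<Sum>s\<in>S. c s * \<phi> s v) + t * (\<psi> w - (\<Sum>s\<in>S. c s * \<phi> s w))"
        by (simp add: algebra_simps sum_subtractf sum_distrib_left)
      also have "t * (\<psi> w - (\<Sum>s\<in>S. c s * \<phi> s w)) = k * \<phi> s1 v"
        by (simp add: t_def k_def)
      also have "(\<Sum>s\<in>S. c s * \<phi> s v) = (\<Sum>s\<in>S. (c(s1 := k)) s * \<phi> s v)"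
        using insert.hyps by (intro sum.cong) auto
      finally show ?thesis using insert.hyps by simp
    qed
    then show ?thesis by blast
  qed
qed

text \<open>Independence says that no \<open>\<phi> s\<close> is a combination of the others on V,
  so by \<open>functional_in_span\<close> some vector of V is killed by all others but not by
  \<open>\<phi> s\<close>; it is then rescaled.\<close>

lemma functional_dual_family:
  fixes \<phi> :: "'i \<Rightarrow> 'a::real_vector \<Rightarrow> real"
  assumes S: "finite S" and V: "subspace V" and \<phi>: "\<And>s. s \<in> S \<Longrightarrow> linear (\<phi> s)"
    and indep: "\<forall>c. (\<forall>v\<in>V. (\<Sum>s\<in>S. c s * \<phi> s v) = 0) \<longrightarrow> (\<forall>s\<in>S. c s = 0)"
  shows "\<exists>e. \<forall>s\<in>S. e s \<in> V \<and> (\<forall>t\<in>S. \<phi> t (e s) = (if t = s then 1 else 0))"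
proof -
  have "\<exists>v\<in>V. \<forall>t\<in>S. \<phi> t v = (if t = s then 1 else 0)" if s: "s \<in> S" for s
  proof -
    have "\<exists>v\<in>V. (\<forall>t\<in>S - {s}. \<phi> t v = 0) \<and> \<phi> s v \<noteq> 0"
    proof (rule ccontr)
      assume "\<not> ?thesis"
      then obtain c where c: "\<forall>v\<in>V. \<phi> s v = (\<Sum>t\<in>S - {s}. c t * \<phi> t v)"
        using functional_in_span[of "S - {s}" V \<phi> "\<phi> s"] S V \<phi> s by blast
      have "(\<Sum>t\<in>S. (c(s := -1)) t * \<phi> t v) = 0" if "v \<in> V" for v
      proof -
        have "(\<Sum>t\<in>S - {s}. (c(s := -1)) t * \<phi> t v) = (\<Sum>t\<in>S - {s}. c t * \<phi> t v)"
          by (intro sum.cong) auto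
        then show ?thesis using c that by (simp add: sum.remove[OF S s])
      qed
      then have "(c(s := -1)) s = 0" using indep s by blast
      then show False by simp
    qed
    then obtain v where v: "v \<in> V" "\<And>t. t \<in> S \<Longrightarrow> t \<noteq> s \<Longrightarrow> \<phi> t v = 0" "\<phi> s v \<noteq> 0" by blast
    show ?thesis
      using v V s by (intro bexI[of _ "(1 / \<phi> s v) *\<^sub>R v"]) (auto simp: \<phi> linear_cmul subspace_scale)
  qed
  then show ?thesis by (intro bchoice) blast
qed

lemma functional_separating:
  assumes "subspace V" "g \<notin> V"
  obtains m :: "'a::real_vector \<Rightarrow> real" where "linear m" "m g = 1" "\<forall>v\<in>V. m v = 0"
proof -
  obtain B where B: "B \<subseteq> V" "independent B" "V \<subseteq> span B"
    using maximal_independent_subset by blast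
  have V: "span B = V" using B assms by (metis span_minimal subset_antisym)
  have "independent (insert g B)" using independent_insertI B assms V by metis
  from linear_independent_extend[OF this, of "\<lambda>x. if x = g then 1 else 0"]
  obtain m :: "'a \<Rightarrow> real" where m: "linear m" "\<forall>x\<in>insert g B. m x = (if x = g then 1 else 0)" by blast
  have "g \<notin> B" using B assms by blast
  then have "m b = 0" if "b \<in> B" for b using m that by auto
  then have "m v = 0" if "v \<in> span B" for v
    using linear_eq_0_on_span[OF m(1)] that by blast
  then show ?thesis using that[of m] m V by simp
qed

section \<open>Ternary forms\<close>

abbreviation deg :: "(3 \<Rightarrow>\<^sub>0 nat) \<Rightarrow> nat"
  where "deg \<alpha> \<equiv> (\<Sum>i\<in>UNIV. Poly_Mapping.lookup \<alpha> i)"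

abbreviation mon :: "(3 \<Rightarrow>\<^sub>0 nat) \<Rightarrow> ternary"
  where "mon \<alpha> \<equiv> Poly_Mapping.single \<alpha> 1"

definition Var :: "3 \<Rightarrow> ternary"
  where "Var i = mon (Poly_Mapping.single i 1)"

lemma scaleR_eq_single_times: "c *\<^sub>R f = Poly_Mapping.single 0 c * f" for f :: ternary
proof -
  have "c *\<^sub>R f = Poly_Mapping.map ((*) c) f"
    by (rule poly_mapping_eqI) (simp add: lookup_scaleR map.rep_eq when_def)
  then show ?thesis by (simp add: mult_map_scale_conv_mult)
qed

lemma scaleR_mult_left_ternary [simp]: "(c *\<^sub>R f) * g = c *\<^sub>R (f * g)" for f g :: ternary
  by (simp add: scaleR_eq_single_times mult.assoc)

lemma scaleR_mult_right_ternary [simp]: "f * (c *\<^sub>R g) = c *\<^sub>R (f * g)" for f g :: ternary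
  by (simp add: scaleR_eq_single_times mult.left_commute)

lemma linear_mult_left: "linear (\<lambda>g. f * g)" for f :: ternary
  by (rule linearI) (simp_all add: distrib_left)

lemma linear_mult_right: "linear (\<lambda>g. g * f)" for f :: ternary
  by (rule linearI) (simp_all add: distrib_right)

lemma mon_add: "mon (\<alpha> + \<beta>) = mon \<alpha> * mon \<beta>"
  by (simp add: mult_single)

lemma deg_add: "deg (\<alpha> + \<beta>) = deg \<alpha> + deg \<beta>"
  by (simp add: lookup_add sum.distrib)

lemma ternary_expand: "f = (\<Sum>\<alpha>\<in>Poly_Mapping.keys f. Poly_Mapping.lookup f \<alpha> *\<^sub>R mon \<alpha>)" for f :: ternary
proof (rule poly_mapping_eqI)
  fix \<beta>
  show "Poly_Mapping.lookup f \<beta> = Poly_Mapping.lookup (\<Sum>\<alpha>\<in>Poly_Mapping.keys f. Poly_Mapping.lookup f \<alpha> *\<^sub>R mon \<alpha>) \<beta>"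
    by (simp add: lookup_sum lookup_scaleR lookup_single when_def if_distrib in_keys_iff cong: if_cong)
qed

lemma mon_in_forms: "mon \<alpha> \<in> forms k \<longleftrightarrow> deg \<alpha> = k"
  by (auto simp: forms_def)

lemma forms_eq_span: "forms k = span (mon ` {\<alpha>. deg \<alpha> = k})"
proof
  show "span (mon ` {\<alpha>. deg \<alpha> = k}) \<subseteq> forms k"
    by (rule span_minimal[OF _ subspace_forms]) (auto simp: mon_in_forms)
  show "forms k \<subseteq> span (mon ` {\<alpha>. deg \<alpha> = k})"
  proof
    fix f assume f: "f \<in> forms k"
    have "(\<Sum>\<alpha>\<in>Poly_Mapping.keys f. Poly_Mapping.lookup f \<alpha> *\<^sub>R mon \<alpha>) \<in> span (mon ` {\<alpha>. deg \<alpha> = k})"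
      using f by (intro span_sum span_scale span_base) (auto simp: forms_def)
    then show "f \<in> span (mon ` {\<alpha>. deg \<alpha> = k})" using ternary_expand[of f] by simp
  qed
qed

lemma forms_linear_eqI:
  assumes "linear m" "linear m'" "\<And>\<alpha>. deg \<alpha> = k \<Longrightarrow> m (mon \<alpha>) = m' (mon \<alpha>)" "f \<in> forms k"
  shows "m f = m' f"
  using linear_eq_on_span[OF assms(1,2), of "mon ` {\<alpha>. deg \<alpha> = k}" f] assms(3,4)
  unfolding forms_eq_span by auto

text \<open>Linear extension from the monomial basis. Evaluations, extensions of functionals and
  later an operator calculus are all prescribed on monomials in this way.\<close>

definition lin :: "((3 \<Rightarrow>\<^sub>0 nat) \<Rightarrow> 'v::real_vector) \<Rightarrow> ternary \<Rightarrow> 'v"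
  where "lin \<phi> f = (\<Sum>\<alpha>\<in>Poly_Mapping.keys f. Poly_Mapping.lookup f \<alpha> *\<^sub>R \<phi> \<alpha>)"

lemma lin_superset:
  assumes "finite S" "Poly_Mapping.keys f \<subseteq> S"
  shows "lin \<phi> f = (\<Sum>\<alpha>\<in>S. Poly_Mapping.lookup f \<alpha> *\<^sub>R \<phi> \<alpha>)"
  unfolding lin_def using assms by (intro sum.mono_neutral_left) (auto simp: in_keys_iff)

lemma linear_lin: "linear (lin \<phi>)"
proof (rule linearI)
  fix f g :: ternary and c :: real
  let ?S = "Poly_Mapping.keys f \<union> Poly_Mapping.keys g"
  have "Poly_Mapping.keys (f + g) \<subseteq> ?S" by (rule keys_add)
  then show "lin \<phi> (f + g) = lin \<phi> f + lin \<phi> g"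
    by (simp add: lin_superset[of ?S] lookup_add scaleR_add_left sum.distrib)
  have "Poly_Mapping.keys (c *\<^sub>R f) \<subseteq> Poly_Mapping.keys f" by (auto simp: in_keys_iff lookup_scaleR)
  then show "lin \<phi> (c *\<^sub>R f) = c *\<^sub>R lin \<phi> f"
    by (simp add: lin_superset[of "Poly_Mapping.keys f"] lookup_scaleR scaleR_sum_right)
qed

lemma lin_mon [simp]: "lin \<phi> (mon \<alpha>) = \<phi> \<alpha>"
  by (simp add: lin_def)

lemma linear_ternary_eqI:
  assumes "linear m" "linear m'" "\<And>\<alpha>. m (mon \<alpha>) = m' (mon \<alpha>)"
  shows "m f = m' f"
  by (subst (1 2) ternary_expand) (simp add: linear_sum linear_cmul assms)

lemma exponent_Suc:
  assumes "deg \<alpha> = Suc k"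
  obtains i \<beta> where "deg \<beta> = k" "\<alpha> = Poly_Mapping.single i 1 + \<beta>"
proof -
  have "\<exists>i. Poly_Mapping.lookup \<alpha> i \<noteq> 0" using assms by (metis Zero_not_Suc sum.neutral)
  then obtain i where i: "Poly_Mapping.lookup \<alpha> i \<noteq> 0" by blast
  define \<beta> where "\<beta> = \<alpha> - Poly_Mapping.single i 1"
  have \<alpha>: "\<alpha> = Poly_Mapping.single i 1 + \<beta>"
    by (rule poly_mapping_eqI) (use i in \<open>auto simp: \<beta>_def lookup_add lookup_minus lookup_single when_def\<close>)
  have "deg (Poly_Mapping.single i 1) = 1" by (simp add: lookup_single when_def)
  then have "deg \<beta> = k" using assms deg_add[of "Poly_Mapping.single i 1" \<beta>] \<alpha> by simp
  then show ?thesis using that \<alpha> by blast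
qed

lemma Var_in_forms [simp]: "Var i \<in> forms 1"
  by (simp add: Var_def mon_in_forms lookup_single when_def)

lemma Var_in_forms_Suc [simp]: "Var i \<in> forms (Suc 0)"
  using Var_in_forms by simp

lemma mon_Var: "mon (Poly_Mapping.single i 1 + \<beta>) = Var i * mon \<beta>"
  by (simp add: Var_def mult_single)

lemma forms_0: "forms 0 = range (\<lambda>c. c *\<^sub>R 1)"
proof -
  have "deg \<alpha> = 0 \<longleftrightarrow> \<alpha> = 0" for \<alpha> by (auto simp: poly_mapping_eq_iff fun_eq_iff)
  then have "forms 0 = span {1}" by (simp add: forms_eq_span flip: single_one)
  then show ?thesis by (simp add: span_singleton)
qed

lemma one_in_forms [simp]: "1 \<in> forms 0"
  using forms_0 by (metis rangeI scaleR_one)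

text \<open>Every monomial of positive degree is divisible by a variable, and the sums of this shape
  form a subspace. Inductions on the degree run through this decomposition.\<close>

lemma forms_Suc:
  assumes "f \<in> forms (Suc k)"
  obtains g where "\<And>i. g i \<in> forms k" "f = (\<Sum>i\<in>UNIV. Var i * g i)"
proof -
  define T where "T = {f. \<exists>g. (\<forall>i. g i \<in> forms k) \<and> f = (\<Sum>i\<in>UNIV. Var i * g i)}"
  have "subspace T"
    unfolding subspace_def
  proof (intro conjI ballI allI)
    show "0 \<in> T" unfolding T_def using subspace_0[OF subspace_forms]
      by (intro CollectI exI[of _ "\<lambda>_. 0"]) auto
    fix x assume "x \<in> T"
    then obtain g where g: "\<forall>i. g i \<in> forms k" "x = (\<Sum>i\<in>UNIV. Var i * g i)" unfolding T_def by blast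
    {
      fix y assume "y \<in> T"
      then obtain h where h: "\<forall>i. h i \<in> forms k" "y = (\<Sum>i\<in>UNIV. Var i * h i)" unfolding T_def by blast
      show "x + y \<in> T" unfolding T_def using g h
        by (intro CollectI exI[of _ "\<lambda>i. g i + h i"]) (auto simp: subspace_add[OF subspace_forms] distrib_left sum.distrib)
    }
    fix c :: real
    show "c *\<^sub>R x \<in> T" unfolding T_def using g
      by (intro CollectI exI[of _ "\<lambda>i. c *\<^sub>R g i"]) (auto simp: subspace_scale[OF subspace_forms] scaleR_sum_right)
  qed
  moreover have "mon \<alpha> \<in> T" if \<alpha>: "deg \<alpha> = Suc k" for \<alpha>
  proof -
    obtain i \<beta> where i: "deg \<beta> = k" "\<alpha> = Poly_Mapping.single i 1 + \<beta>" using exponent_Suc[OF \<alpha>] by blast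
    have "mon \<alpha> = (\<Sum>j\<in>UNIV. Var j * (if j = i then mon \<beta> else 0))"
      by (simp only: i mon_Var) (simp add: if_distrib cong: if_cong)
    then show ?thesis unfolding T_def using i(1)
      by (intro CollectI exI[of _ "\<lambda>j. if j = i then mon \<beta> else 0"])
        (auto simp: mon_in_forms subspace_0[OF subspace_forms])
  qed
  ultimately have "forms (Suc k) \<subseteq> T"
    unfolding forms_eq_span by (intro span_minimal) auto
  then show ?thesis using assms that unfolding T_def by blast
qed

text \<open>Products span \<open>forms (k + n)\<close>; as an induction rule this reduces a linear
  property to products. The proof shifts one variable at a time between the two factors.\<close>

lemma forms_add_induct [consumes 1, case_names zero add scale mult]:
  assumes f: "f \<in> forms (k + n)"
    and zero: "P 0" and add: "\<And>f g. P f \<Longrightarrow> P g \<Longrightarrow> P (f + g)" and scale: "\<And>c f. P f \<Longrightarrow> P (c *\<^sub>R f)"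
    and mult: "\<And>f g. f \<in> forms k \<Longrightarrow> g \<in> forms n \<Longrightarrow> P (f * g)"
  shows "P f"
proof -
  have "P f" if "f \<in> forms (k + n)" "\<And>f g. f \<in> forms k \<Longrightarrow> g \<in> forms n \<Longrightarrow> P (f * g)" for f
    using that
  proof (induction k arbitrary: n f)
    case 0
    then show ?case using "0.prems"(2)[of 1 f] by simp
  next
    case (Suc k)
    have "P (h * g)" if h: "h \<in> forms k" and g: "g \<in> forms (Suc n)" for h g
    proof -
      obtain g' where g': "\<And>i. g' i \<in> forms n" "g = (\<Sum>i\<in>UNIV. Var i * g' i)"
        using forms_Suc[OF g] by blast
      have "P (h * Var i * g' i)" for i
        using Suc.prems(2)[OF _ g'(1), of "h * Var i"] forms_mult[OF h Var_in_forms] by simp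
      then have "P (\<Sum>i\<in>(UNIV::3 set). h * Var i * g' i)"
        by (simp only: sum_3 add)
      then show ?thesis by (simp add: g'(2) sum_distrib_left mult.assoc)
    qed
    then show ?case using Suc.IH[of f "Suc n"] Suc.prems(1) by simp
  qed
  then show ?thesis using f mult by blast
qed

section \<open>Evaluation of forms at points\<close>

definition ev :: "(3 \<Rightarrow> real) \<Rightarrow> ternary \<Rightarrow> real"
  where "ev v = lin (\<lambda>\<alpha>. \<Prod>i\<in>UNIV. v i ^ Poly_Mapping.lookup \<alpha> i)"

lemma linear_ev: "linear (ev v)"
  unfolding ev_def by (rule linear_lin)

lemma ev_mult [simp]: "ev v (f * g) = ev v f * ev v g"
proof -
  have *: "ev v (mon \<alpha> * g) = ev v (mon \<alpha>) * ev v g" for \<alpha> g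
  proof (rule linear_ternary_eqI)
    show "linear (\<lambda>g. ev v (mon \<alpha> * g))"
      using linear_compose[OF linear_mult_left linear_ev] by (simp add: o_def)
    show "linear (\<lambda>g. ev v (mon \<alpha>) * ev v g)"
      by (rule linearI) (simp_all add: linear_add[OF linear_ev] linear_cmul[OF linear_ev] distrib_left)
    fix \<beta>
    show "ev v (mon \<alpha> * mon \<beta>) = ev v (mon \<alpha>) * ev v (mon \<beta>)"
      unfolding mon_add[symmetric] ev_def lin_mon by (simp add: lookup_add power_add prod.distrib)
  qed
  show ?thesis
  proof (rule linear_ternary_eqI[where m = "\<lambda>f. ev v (f * g)" and m' = "\<lambda>f. ev v f * ev v g"])
    show "linear (\<lambda>f. ev v (f * g))"
      using linear_compose[OF linear_mult_right linear_ev] by (simp add: o_def)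
    show "linear (\<lambda>f. ev v f * ev v g)"
      by (rule linearI) (simp_all add: linear_add[OF linear_ev] linear_cmul[OF linear_ev] distrib_right)
  qed (rule *)
qed

lemma ev_add [simp]: "ev v (f + g) = ev v f + ev v g"
  and ev_diff [simp]: "ev v (f - g) = ev v f - ev v g"
  and ev_scaleR [simp]: "ev v (c *\<^sub>R f) = c * ev v f"
  and ev_0 [simp]: "ev v 0 = 0"
  and ev_sum [simp]: "ev v (\<Sum>i\<in>S. h i) = (\<Sum>i\<in>S. ev v (h i))"
  by (simp_all add: linear_add linear_diff linear_cmul linear_0 linear_sum linear_ev)

lemma ev_1 [simp]: "ev v 1 = 1"
  using lin_mon[of "\<lambda>\<alpha>. \<Prod>i\<in>UNIV. v i ^ Poly_Mapping.lookup \<alpha> i" 0] by (simp add: ev_def)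

lemma ev_Var [simp]: "ev v (Var i) = v i"
proof -
  have "(\<Prod>j\<in>UNIV. v j ^ Poly_Mapping.lookup (Poly_Mapping.single i 1) j) = (\<Prod>j\<in>UNIV. if j = i then v i else 1)"
    by (intro prod.cong) (auto simp: lookup_single when_def)
  then show ?thesis by (simp add: ev_def Var_def)
qed

lemma Var_power_in_forms: "Var i ^ n \<in> forms n"
proof (induction n)
  case (Suc n) then show ?case using forms_mult[OF Var_in_forms, of "Var i ^ n" n i] by simp
qed simp

lemma ev_power [simp]: "ev q (f ^ n) = ev q f ^ n"
  by (induction n) auto

section \<open>Number of monomials and dimension of the spaces of forms\<close>

lemma finite_deg: "finite {\<alpha>. deg \<alpha> = k}" and card_deg: "card {\<alpha>. deg \<alpha> = k} = (k + 1) * (k + 2) div 2"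
proof -
  \<comment> \<open>A pair i \<le> j of partial sums encodes the exponents i, j - i, k - j.\<close>
  define F :: "nat \<times> nat \<Rightarrow> 3 \<Rightarrow>\<^sub>0 nat"
    where "F = (\<lambda>(i, j). Poly_Mapping.single 1 i + Poly_Mapping.single 2 (j - i) + Poly_Mapping.single 3 (k - j))"
  have lk: "Poly_Mapping.lookup (F (i, j)) 1 = i" "Poly_Mapping.lookup (F (i, j)) 2 = j - i"
    "Poly_Mapping.lookup (F (i, j)) 3 = k - j" for i j
    by (auto simp: F_def lookup_add lookup_single when_def)
  let ?D = "{(i, j). i \<le> j \<and> j \<le> k}"
  have bij: "bij_betw F ?D {\<alpha>. deg \<alpha> = k}"
  proof (rule bij_betwI[where g = "\<lambda>\<alpha>. (Poly_Mapping.lookup \<alpha> 1, Poly_Mapping.lookup \<alpha> 1 + Poly_Mapping.lookup \<alpha> 2)"])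
    show "F \<in> ?D \<rightarrow> {\<alpha>. deg \<alpha> = k}" by (auto simp: sum_3 lk)
    show "(\<lambda>\<alpha>. (Poly_Mapping.lookup \<alpha> 1, Poly_Mapping.lookup \<alpha> 1 + Poly_Mapping.lookup \<alpha> 2)) \<in> {\<alpha>. deg \<alpha> = k} \<rightarrow> ?D"
      by (auto simp: sum_3)
    show "(Poly_Mapping.lookup (F x) 1, Poly_Mapping.lookup (F x) 1 + Poly_Mapping.lookup (F x) 2) = x" if "x \<in> ?D" for x
      using that by (cases x) (auto simp: lk)
    show "F (Poly_Mapping.lookup \<alpha> 1, Poly_Mapping.lookup \<alpha> 1 + Poly_Mapping.lookup \<alpha> 2) = \<alpha>" if "\<alpha> \<in> {\<alpha>. deg \<alpha> = k}" for \<alpha>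
    proof (rule poly_mapping_eqI)
      fix i :: 3
      show "Poly_Mapping.lookup (F (Poly_Mapping.lookup \<alpha> 1, Poly_Mapping.lookup \<alpha> 1 + Poly_Mapping.lookup \<alpha> 2)) i = Poly_Mapping.lookup \<alpha> i"
        using that exhaust_3[of i] by (auto simp: lk sum_3)
    qed
  qed
  have D: "?D = (\<lambda>(j, i). (i, j)) ` (SIGMA j:{..k}. {..j})" by (auto simp: image_iff)
  have "card ?D = card (SIGMA j:{..k}. {..j})"
    unfolding D by (intro card_image) (auto simp: inj_on_def)
  also have "\<dots> = (\<Sum>j\<le>k. Suc j)" by simp
  also have "\<dots> = (k + 1) * (k + 2) div 2" by (induction k) auto
  finally show "card {\<alpha>. deg \<alpha> = k} = (k + 1) * (k + 2) div 2"
    using bij_betw_same_card[OF bij] by simp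
  have "finite ?D" unfolding D by auto
  then show "finite {\<alpha>. deg \<alpha> = k}" using bij_betw_finite[OF bij] by simp
qed

lemma fin_dim_forms [simp]: "fin_dim (forms k)"
  unfolding fin_dim_def forms_eq_span using finite_deg by blast

lemma mon_eq_iff: "mon \<alpha> = mon \<beta> \<longleftrightarrow> \<alpha> = \<beta>"
  by (metis lookup_single_eq lookup_single_not_eq zero_neq_one)

lemma independent_mon: "independent (mon ` S)"
  unfolding independent_explicit_finite_subsets
proof (intro allI impI ballI)
  fix T u v assume T: "T \<subseteq> mon ` S" "finite T" "(\<Sum>w\<in>T. u w *\<^sub>R w) = 0" "v \<in> T"
  obtain \<alpha> where \<alpha>: "v = mon \<alpha>" using T by blast
  have "(\<Sum>w\<in>T. u w * Poly_Mapping.lookup w \<alpha>) = (\<Sum>w\<in>T. if w = v then u v else 0)"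
  proof (intro sum.cong refl)
    fix w assume "w \<in> T"
    then obtain \<beta> where "w = mon \<beta>" using T by blast
    then show "u w * Poly_Mapping.lookup w \<alpha> = (if w = v then u v else 0)"
      by (auto simp: \<alpha> mon_eq_iff lookup_single when_def)
  qed
  then have "u v = Poly_Mapping.lookup (\<Sum>w\<in>T. u w *\<^sub>R w) \<alpha>"
    using T(2,4) by (simp add: lookup_sum lookup_scaleR)
  then show "u v = 0" unfolding T(3) by simp
qed

lemma dim_forms: "dim (forms k) = (k + 1) * (k + 2) div 2"
proof -
  have "inj_on mon {\<alpha>. deg \<alpha> = k}"
    by (rule inj_onI) (simp add: mon_eq_iff)
  then show ?thesis
    unfolding forms_eq_span dim_span_eq_card_independent[OF independent_mon]
    by (simp add: card_image card_deg)
qed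

lemma dim_mult_image:
  fixes f :: ternary
  assumes "f \<noteq> 0" "subspace V" "fin_dim V" shows "dim ((\<lambda>g. f * g) ` V) = dim V"
  by (rule dim_image_inj[OF linear_mult_left assms(2,3)]) (use assms in auto)

section \<open>Extreme rays and uniqueness of the functional\<close>

definition restrict_to :: "ternary set \<Rightarrow> (ternary \<Rightarrow> real) \<Rightarrow> ternary \<Rightarrow> real"
  where "restrict_to V m = (\<lambda>f. if f \<in> V then m f else 0)"

lemma restrict_to_in_dual: "linear m \<Longrightarrow> subspace V \<Longrightarrow> restrict_to V m \<in> dual_space V"
  by (auto simp: restrict_to_def dual_space_def linear_add linear_cmul subspace_add subspace_scale)

text \<open>Replaces a functional on one degree by a linear map on the whole ring, so that linearity
  can be used afterwards without membership conditions.\<close>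

lemma dual_space_linear_extension:
  assumes "m \<in> dual_space (forms k)"
  obtains m' where "linear m'" "m = restrict_to (forms k) m'"
proof -
  define m' where "m' = lin (\<lambda>\<alpha>. m (mon \<alpha>))"
  have lin: "linear m'" unfolding m'_def by (rule linear_lin)
  have "f \<in> forms k \<and> m f = m' f" if "f \<in> span (mon ` {\<alpha>. deg \<alpha> = k})" for f
    using that
  proof (induction rule: span_induct_alt)
    case base
    have "m (0 *\<^sub>R 0) = 0 * m 0"
      using assms subspace_0[OF subspace_forms] unfolding dual_space_def by blast
    then show ?case using lin by (simp add: subspace_0 subspace_forms linear_0)
  next
    case (step c x y)
    then obtain \<alpha> where \<alpha>: "x = mon \<alpha>" "x \<in> forms k" by (auto simp: mon_in_forms)
    have c: "c *\<^sub>R x \<in> forms k" using \<alpha> by (simp add: subspace_scale subspace_forms)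
    have "m (c *\<^sub>R x + y) = m (c *\<^sub>R x) + m y" "m (c *\<^sub>R x) = c * m x"
      using assms step c \<alpha>(2) unfolding dual_space_def by blast+
    moreover have "m' x = m x" by (simp add: \<alpha>(1) m'_def)
    ultimately show ?case using step c lin by (simp add: linear_add linear_cmul subspace_add subspace_forms)
  qed
  moreover have "m f = 0" if "f \<notin> forms k" for f using assms that by (auto simp: dual_space_def)
  ultimately have "m = restrict_to (forms k) m'"
    by (auto simp: restrict_to_def fun_eq_iff simp flip: forms_eq_span)
  then show ?thesis using that lin by blast
qed

text \<open>Radical of the bilinear form of L; its codimension in \<open>forms d\<close> is the
  rank.\<close>

definition rad :: "nat \<Rightarrow> (ternary \<Rightarrow> real) \<Rightarrow> ternary set"
  where "rad d L = {f \<in> forms d. \<forall>g\<in>forms d. L (f * g) = 0}"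

lemma forms_mult_double: "f \<in> forms d \<Longrightarrow> g \<in> forms d \<Longrightarrow> f * g \<in> forms (2 * d)"
  using forms_mult[of f d g d] by (simp add: mult_2)

lemma subspace_rad: "linear L \<Longrightarrow> subspace (rad d L)"
  unfolding rad_def using subspace_forms[of d]
  by (auto simp: subspace_def distrib_right linear_add linear_cmul linear_0)

lemma rad_subset: "rad d L \<subseteq> forms d"
  by (auto simp: rad_def)

lemma bilinear_rank_restrict_to:
  assumes L: "linear L"
  shows "bilinear_rank (forms d) (B_form (restrict_to (forms (2 * d)) L)) + dim (rad d L) = dim (forms d)"
proof -
  define \<Phi> where "\<Phi> = (\<lambda>f g. if g \<in> forms d then L (f * g) else 0)"
  have \<Phi>: "linear \<Phi>"
    by (rule linearI)
      (auto simp: \<Phi>_def fun_eq_iff scaleR_fun_def distrib_right linear_add[OF L] linear_cmul[OF L])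
  have "(\<lambda>f g. if g \<in> forms d then B_form (restrict_to (forms (2 * d)) L) f g else 0) ` forms d = \<Phi> ` forms d"
    by (intro image_cong) (auto simp: \<Phi>_def fun_eq_iff B_form_def restrict_to_def forms_mult_double)
  moreover have "{f \<in> forms d. \<Phi> f = 0} = rad d L"
    by (auto simp: rad_def \<Phi>_def fun_eq_iff)
  ultimately show ?thesis
    using rank_nullity[OF \<Phi> subspace_forms fin_dim_forms, of d] by (simp add: bilinear_rank_def)
qed

lemma forms_double_linear_eqI:
  assumes "linear m" "linear m'" "\<And>f g. f \<in> forms d \<Longrightarrow> g \<in> forms d \<Longrightarrow> m (f * g) = m' (f * g)"
    "h \<in> forms (2 * d)"
  shows "m h = m' h"
proof -
  have "h \<in> forms (d + d)" using assms(4) by (simp add: mult_2)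
  then show ?thesis
    by (induction rule: forms_add_induct) (simp_all add: assms linear_0 linear_add linear_cmul)
qed

definition psd_on :: "nat \<Rightarrow> (ternary \<Rightarrow> real) \<Rightarrow> bool"
  where "psd_on d L \<longleftrightarrow> linear L \<and> (\<forall>f\<in>forms d. 0 \<le> L (f * f))"

lemma psd_on_zero_imp:
  assumes L: "psd_on d L" and f: "f \<in> forms d" "L (f * f) = 0" and g: "g \<in> forms d"
  shows "L (f * g) = 0"
proof (rule ccontr)
  assume nz: "L (f * g) \<noteq> 0"
  have lin: "linear L" using L by (simp add: psd_on_def)
  \<comment> \<open>With this t the square of \<open>g + t *\<^sub>R f\<close> is sent to
    -1.\<close>
  define t where "t = - (L (g * g) + 1) / (2 * L (f * g))"
  have "g + t *\<^sub>R f \<in> forms d" using f g by (simp add: subspace_add subspace_scale subspace_forms)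
  then have "0 \<le> L ((g + t *\<^sub>R f) * (g + t *\<^sub>R f))" using L by (simp add: psd_on_def)
  also have "L ((g + t *\<^sub>R f) * (g + t *\<^sub>R f)) = L (g * g) + 2 * t * L (f * g)"
    using f(2) by (simp add: distrib_left distrib_right mult.commute[of g f] linear_add[OF lin] linear_cmul[OF lin])
  also have "2 * t * L (f * g) = - (L (g * g) + 1)" using nz by (simp add: t_def)
  finally show False by simp
qed

lemma rad_eq_psd: "psd_on d L \<Longrightarrow> rad d L = {f \<in> forms d. L (f * f) = 0}"
  using psd_on_zero_imp by (auto simp: rad_def)

lemma psd_on_pos:
  assumes L: "psd_on d L" and h: "h \<in> forms (2 * d)" "L h \<noteq> 0"
  obtains f where "f \<in> forms d" "0 < L (f * f)"
proof (rule ccontr)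
  assume "\<not> thesis"
  then have "\<And>f. f \<in> forms d \<Longrightarrow> \<not> 0 < L (f * f)" using that by blast
  then have "L (f * f) = 0" if "f \<in> forms d" for f
    using L that unfolding psd_on_def by force
  then have "L (f * g) = 0" if "f \<in> forms d" "g \<in> forms d" for f g
    using psd_on_zero_imp[OF L] that by blast
  then have "L h = 0"
    using forms_double_linear_eqI[of L "\<lambda>_. 0" d h] L h by (simp add: psd_on_def linear_zero)
  then show False using h by simp
qed

lemma restrict_to_in_sos_dual_iff:
  assumes "linear L"
  shows "restrict_to (forms (2 * d)) L \<in> sos_dual d \<longleftrightarrow> psd_on d L"
  using assms restrict_to_in_dual[OF assms subspace_forms, of "2 * d"] forms_mult_double
  by (auto simp: sos_dual_def psd_on_def B_form_def restrict_to_def)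

text \<open>If a convex combination of two elements a, b of the cone lies on the ray, then both are
  nonnegative on squares and the combination vanishes on squares of radical elements; so both vanish
  there and kill the products of the radical with \<open>forms d\<close>. By \<open>uniq\<close>
  they are multiples of L.\<close>

lemma has_extreme_rayI:
  assumes L: "psd_on d L" and h0: "h0 \<in> forms (2 * d)" "L h0 \<noteq> 0"
    and uniq: "\<And>m. linear m \<Longrightarrow> (\<And>f g. f \<in> rad d L \<Longrightarrow> g \<in> forms d \<Longrightarrow> m (f * g) = 0)
      \<Longrightarrow> \<exists>c. \<forall>h\<in>forms (2 * d). m h = c * L h"
    and rank: "r + dim (rad d L) = dim (forms d)"
  shows "has_extreme_ray_of_rank d r"
proof -
  have lin: "linear L" using L by (simp add: psd_on_def)
  define l where "l = restrict_to (forms (2 * d)) L"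
  have l: "l \<in> sos_dual d" using L lin by (simp add: l_def restrict_to_in_sos_dual_iff)
  have "l h0 \<noteq> 0" using h0 by (simp add: l_def restrict_to_def)
  then have l0: "l \<noteq> 0" by auto
  have cone: "c *\<^sub>R l \<in> sos_dual d" if "0 \<le> c" for c
  proof -
    have "c *\<^sub>R l = restrict_to (forms (2 * d)) (\<lambda>f. c * L f)"
      by (auto simp: l_def restrict_to_def scaleR_fun_def fun_eq_iff)
    moreover have "linear (\<lambda>f. c * L f)"
      by (rule linearI) (simp_all add: linear_add[OF lin] linear_cmul[OF lin] distrib_left)
    ultimately show ?thesis using that L by (simp add: restrict_to_in_sos_dual_iff psd_on_def)
  qed
  \<comment> \<open>A form whose square has positive value fixes the sign of the factor k
    below.\<close>
  obtain f0 where f0: "f0 \<in> forms d" "0 < L (f0 * f0)" by (rule psd_on_pos[OF L h0])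
  have in_ray: "a \<in> ray l"
    if a: "a \<in> sos_dual d" and b: "b \<in> sos_dual d" and u: "0 < u" "u < 1"
      and x: "(1 - u) *\<^sub>R a + u *\<^sub>R b \<in> ray l" for a b u
  proof -
    obtain a' where a': "linear a'" "a = restrict_to (forms (2 * d)) a'"
      using dual_space_linear_extension a unfolding sos_dual_def by blast
    obtain b' where b': "linear b'" "b = restrict_to (forms (2 * d)) b'"
      using dual_space_linear_extension b unfolding sos_dual_def by blast
    have psd: "psd_on d a'" "psd_on d b'" using a a' b b' restrict_to_in_sos_dual_iff by auto
    obtain c where "(1 - u) *\<^sub>R a + u *\<^sub>R b = c *\<^sub>R l" using x by (auto simp: ray_def)
    then have comb: "(1 - u) * a' h + u * b' h = c * L h" if "h \<in> forms (2 * d)" for h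
      using that a' b' by (auto simp: l_def restrict_to_def scaleR_fun_def fun_eq_iff dest: spec[of _ h])
    have "a' (f * g) = 0" if f: "f \<in> rad d L" and g: "g \<in> forms d" for f g
    proof -
      have f': "f \<in> forms d" "L (f * f) = 0" using f by (auto simp: rad_def)
      have "(1 - u) * a' (f * f) + u * b' (f * f) = 0" using comb[of "f * f"] f' forms_mult_double by simp
      moreover have "0 \<le> a' (f * f)" "0 \<le> b' (f * f)" using psd f' by (auto simp: psd_on_def)
      ultimately have "(1 - u) * a' (f * f) = 0"
        using u add_nonneg_eq_0_iff[of "(1 - u) * a' (f * f)" "u * b' (f * f)"] by simp
      then have "a' (f * f) = 0" using u by simp
      then show ?thesis using psd_on_zero_imp[OF psd(1) f'(1) _ g] by simp
    qed
    then obtain k where k: "\<And>h. h \<in> forms (2 * d) \<Longrightarrow> a' h = k * L h" using uniq[OF a'(1)] by blast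
    have "0 \<le> a' (f0 * f0)" using psd f0 by (auto simp: psd_on_def)
    then have "0 \<le> k" using k[of "f0 * f0"] f0 forms_mult_double by (simp add: zero_le_mult_iff)
    moreover have "a = k *\<^sub>R l" using k by (auto simp: a' l_def restrict_to_def scaleR_fun_def fun_eq_iff)
    ultimately show ?thesis by (auto simp: ray_def)
  qed
  have "ray l face_of sos_dual d"
    unfolding face_of_def
  proof (intro conjI ballI impI)
    show "ray l \<subseteq> sos_dual d" using cone by (auto simp: ray_def)
    show "convex (ray l)"
    proof (rule convexI)
      fix x y :: "ternary \<Rightarrow> real" and u v :: real
      assume "x \<in> ray l" "y \<in> ray l" and uv: "0 \<le> u" "0 \<le> v"
      then obtain c c' where "x = c *\<^sub>R l" "y = c' *\<^sub>R l" "0 \<le> c" "0 \<le> c'" by (auto simp: ray_def)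
      then show "u *\<^sub>R x + v *\<^sub>R y \<in> ray l"
        using uv by (auto simp: ray_def intro!: exI[of _ "u * c + v * c'"] simp: scaleR_add_left)
    qed
    fix a b x assume ab: "a \<in> sos_dual d" "b \<in> sos_dual d" "x \<in> ray l" "x \<in> open_segment a b"
    then obtain u where u: "0 < u" "u < 1" "x = (1 - u) *\<^sub>R a + u *\<^sub>R b" by (auto simp: in_segment)
    then show "a \<in> ray l" using in_ray ab by blast
    have "x = (1 - (1 - u)) *\<^sub>R b + (1 - u) *\<^sub>R a" using u by (simp add: add.commute)
    then show "b \<in> ray l" using in_ray[of b a "1 - u"] ab u(1,2) by (metis diff_gt_0_iff_gt diff_less_eq less_add_same_cancel1)
  qed
  moreover have "bilinear_rank (forms d) (B_form l) = r"
    using bilinear_rank_restrict_to[OF lin, of d] rank by (simp add: l_def)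
  ultimately show ?thesis
    using l0 by (auto simp: has_extreme_ray_of_rank_def extreme_ray_of_def)
qed

text \<open>Two independent linear forms meet in one projective point q, and modulo them every
  linear form is a multiple of a third one, g. Replacing factors by multiples of g turns m into
  evaluation at q times the value \<open>m (g ^ Suc k)\<close>. The point is chosen before m and k,
  so it serves all degrees.\<close>

lemma functional_killed_by_two_linear_forms:
  assumes a: "a \<in> forms 1" and b: "b \<in> forms 1"
    and indep: "\<And>s t. s *\<^sub>R a + t *\<^sub>R b = 0 \<Longrightarrow> s = 0 \<and> t = 0"
  obtains q where "q \<noteq> (\<lambda>_. 0)" "ev q a = 0" "ev q b = 0"
    "\<forall>m k. linear m \<longrightarrow> (\<forall>f\<in>forms k. m (a * f) = 0 \<and> m (b * f) = 0)
      \<longrightarrow> (\<exists>c. \<forall>f\<in>forms (Suc k). m f = c * ev q f)"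
proof -
  have ab: "a \<noteq> b" using indep[of 1 "-1"] by auto
  have "independent {a, b}"
    unfolding independent_explicit_finite_subsets
  proof (intro allI impI)
    fix S u assume "S \<subseteq> {a, b}" "finite S" and s: "(\<Sum>v\<in>S. u v *\<^sub>R v) = 0"
    then have "(\<Sum>v\<in>{a, b}. (if v \<in> S then u v else 0) *\<^sub>R v) = 0"
      by (subst s[symmetric], intro sum.mono_neutral_cong_right) auto
    then show "\<forall>v\<in>S. u v = 0" using ab indep \<open>S \<subseteq> {a, b}\<close> by (fastforce split: if_splits)
  qed
  then have dim2: "dim (span {a, b}) = 2" using ab by (simp add: dim_eq_card_independent)
  have sub: "span {a, b} \<subseteq> forms 1" by (rule span_minimal[OF _ subspace_forms]) (use a b in auto)
  have dim3: "dim (forms 1) = 3" by (simp add: dim_forms)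
  have "span {a, b} \<noteq> forms 1"
  proof
    assume eq: "span {a, b} = forms 1"
    show False using dim2 unfolding eq using dim3 by linarith
  qed
  then obtain g where g: "g \<in> forms 1" "g \<notin> span {a, b}" using sub by blast
  obtain \<mu> :: "ternary \<Rightarrow> real" where \<mu>: "linear \<mu>" "\<mu> g = 1" "\<forall>v\<in>span {a, b}. \<mu> v = 0"
    by (rule functional_separating[OF subspace_span g(2)])
  \<comment> \<open>A functional on linear forms is evaluation at the point with these
    coordinates.\<close>
  define q where "q = (\<lambda>i. \<mu> (Var i))"
  have ev: "ev q \<theta> = \<mu> \<theta>" if "\<theta> \<in> forms 1" for \<theta>
  proof (rule forms_linear_eqI[OF linear_ev \<mu>(1) _ that])
    fix \<alpha> assume "deg \<alpha> = 1"
    then have "deg \<alpha> = Suc 0" by simp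
    from exponent_Suc[OF this]
    obtain i \<beta> where i: "deg \<beta> = 0" "\<alpha> = Poly_Mapping.single i 1 + \<beta>" by blast
    then have "\<beta> = 0" by (auto simp: poly_mapping_eq_iff fun_eq_iff)
    then have "mon \<alpha> = Var i" using i by (simp add: Var_def)
    then show "ev q (mon \<alpha>) = \<mu> (mon \<alpha>)" by (simp add: q_def)
  qed
  let ?K = "{\<theta> \<in> forms 1. \<mu> \<theta> = 0}"
  have "\<mu> ` forms 1 = UNIV"
  proof -
    have "y = \<mu> (y *\<^sub>R g)" "y *\<^sub>R g \<in> forms 1" for y
      using \<mu> g by (simp_all add: linear_cmul subspace_scale subspace_forms)
    then show ?thesis by blast
  qed
  then have "dim ?K = 2" using rank_nullity[OF \<mu>(1) subspace_forms fin_dim_forms, of 1] dim3 by simp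
  then have K: "span {a, b} = ?K"
    using sub \<mu>(3) dim2
    by (intro subspace_eq_of_dim_le) (auto intro: fin_dim_subset[OF fin_dim_forms[of 1]])
  have "ev q g = 1" using ev g \<mu> by simp
  have q0: "q \<noteq> (\<lambda>_. 0)"
  proof
    assume q: "q = (\<lambda>_. 0)"
    have "g \<in> forms (Suc 0)" using g(1) by simp
    from forms_Suc[OF this]
    obtain h where "g = (\<Sum>i\<in>UNIV. Var i * h i)" by blast
    then have "ev q g = 0" by (simp add: q)
    then show False using \<open>ev q g = 1\<close> by simp
  qed
  show ?thesis
  proof (rule that[of q])
    show "q \<noteq> (\<lambda>_. 0)" by (rule q0)
    show "ev q a = 0" "ev q b = 0" using ev a b \<mu>(3) by (auto simp: span_base)
    show "\<forall>m k. linear m \<longrightarrow> (\<forall>f\<in>forms k. m (a * f) = 0 \<and> m (b * f) = 0)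
      \<longrightarrow> (\<exists>c. \<forall>f\<in>forms (Suc k). m f = c * ev q f)"
    proof (intro allI impI)
    fix m :: "ternary \<Rightarrow> real" and k
    assume m: "linear m" and kill: "\<forall>f\<in>forms k. m (a * f) = 0 \<and> m (b * f) = 0"
    have step: "m (\<theta> * f) = ev q \<theta> * m (g * f)" if \<theta>: "\<theta> \<in> forms 1" and f: "f \<in> forms k" for \<theta> f
    proof -
      have "\<theta> - ev q \<theta> *\<^sub>R g \<in> ?K"
        using \<theta> g ev \<mu> by (simp add: subspace_diff subspace_scale subspace_forms linear_diff linear_cmul)
      then have "\<theta> - ev q \<theta> *\<^sub>R g \<in> span {a, b}" using K by simp
      then obtain s where "\<theta> - ev q \<theta> *\<^sub>R g - s *\<^sub>R a \<in> span {b}"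
        by (auto simp: span_breakdown_eq)
      then obtain t where "\<theta> - ev q \<theta> *\<^sub>R g - s *\<^sub>R a = t *\<^sub>R b"
        by (auto simp: span_singleton)
      then have "\<theta> = ev q \<theta> *\<^sub>R g + s *\<^sub>R a + t *\<^sub>R b" by (simp add: algebra_simps)
      then have "\<theta> * f = (ev q \<theta> *\<^sub>R g + s *\<^sub>R a + t *\<^sub>R b) * f" by simp
      also have "\<dots> = ev q \<theta> *\<^sub>R (g * f) + s *\<^sub>R (a * f) + t *\<^sub>R (b * f)"
        by (simp add: distrib_right)
      finally have "m (\<theta> * f) = m (ev q \<theta> *\<^sub>R (g * f) + s *\<^sub>R (a * f) + t *\<^sub>R (b * f))" by simp
      then show ?thesis using kill f by (simp add: linear_add[OF m] linear_cmul[OF m])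
    qed
    \<comment> \<open>Strengthened by a cofactor p, which collects the powers of g while the factors
      of f are traded for numbers.\<close>
    have "m (f * p) = ev q f * m (g ^ j * p)" if "f \<in> forms j" "p \<in> forms n" "j + n = Suc k" for f p j n
      using that
    proof (induction j arbitrary: f p n)
      case 0
      then obtain c where "f = c *\<^sub>R 1" using forms_0 by blast
      then show ?case by (simp add: linear_cmul[OF m])
    next
      case (Suc j)
      obtain h where h: "\<And>i. h i \<in> forms j" "f = (\<Sum>i\<in>UNIV. Var i * h i)"
        using forms_Suc[OF Suc.prems(1)] by blast
      have 1: "m (Var i * h i * p) = ev q (Var i) * (ev q (h i) * m (g ^ Suc j * p))" for i
      proof -
        have "h i * p \<in> forms k" using forms_mult[OF h(1) Suc.prems(2)] Suc.prems(3) by simp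
        then have "m (Var i * h i * p) = ev q (Var i) * m (g * (h i * p))"
          using step[of "Var i" "h i * p"] by (simp add: mult.assoc)
        also have "g * (h i * p) = h i * (g * p)" by (simp add: mult.left_commute)
        also have "m (h i * (g * p)) = ev q (h i) * m (g ^ j * (g * p))"
          using Suc.IH[OF h(1), of "g * p" "Suc n"] forms_mult[OF g(1) Suc.prems(2)] Suc.prems(3) by simp
        also have "g ^ j * (g * p) = g ^ Suc j * p" by (simp add: mult.assoc mult.left_commute)
        finally show ?thesis .
      qed
      have "m (f * p) = (\<Sum>i\<in>UNIV. m (Var i * h i * p))"
        by (simp add: h(2) sum_distrib_right linear_sum[OF m])
      also have "\<dots> = ev q f * m (g ^ Suc j * p)"
        by (simp only: 1) (simp add: h(2) sum_distrib_right mult.assoc)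
      finally show ?case .
    qed
    from this[of _ "Suc k" 1 0]
    have "m f = m (g ^ Suc k) * ev q f" if "f \<in> forms (Suc k)" for f
      using that by simp
    then show "\<exists>c. \<forall>f\<in>forms (Suc k). m f = c * ev q f" by blast
    qed
  qed
qed

text \<open>Evaluation at the common zero of the first two variables. Its radical consists of the
  forms vanishing there, so a competing functional kills both variables times everything and is a
  multiple of the evaluation.\<close>

lemma has_extreme_ray_of_rank_1:
  assumes "1 \<le> d" shows "has_extreme_ray_of_rank d 1"
proof -
  have indep: "s = 0 \<and> t = 0" if "s *\<^sub>R Var 1 + t *\<^sub>R Var 2 = 0" for s t
  proof -
    have "ev (\<lambda>i. if i = 1 then 1 else 0) (s *\<^sub>R Var 1 + t *\<^sub>R Var 2) = 0"
      "ev (\<lambda>i. if i = 2 then 1 else 0) (s *\<^sub>R Var 1 + t *\<^sub>R Var 2) = 0"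
      unfolding that by simp_all
    then show ?thesis by simp
  qed
  obtain q where q: "q \<noteq> (\<lambda>_. 0)" "ev q (Var 1) = 0" "ev q (Var 2) = 0"
    "\<forall>m k. linear m \<longrightarrow> (\<forall>f\<in>forms k. m (Var 1 * f) = 0 \<and> m (Var 2 * f) = 0)
      \<longrightarrow> (\<exists>c. \<forall>f\<in>forms (Suc k). m f = c * ev q f)"
    by (rule functional_killed_by_two_linear_forms[OF Var_in_forms Var_in_forms indep]) assumption+
  have q3: "q 3 \<noteq> 0"
  proof
    assume "q 3 = 0"
    then have "q i = 0" for i using q(2,3) exhaust_3[of i] by auto
    then show False using q(1) by auto
  qed
  show ?thesis
  proof (rule has_extreme_rayI[of d "ev q" "Var 3 ^ (2 * d)"])
    show "psd_on d (ev q)" by (simp add: psd_on_def linear_ev)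
    show "Var 3 ^ (2 * d) \<in> forms (2 * d)" by (rule Var_power_in_forms)
    show "ev q (Var 3 ^ (2 * d)) \<noteq> 0" using q3 by (simp add: ev_power)
    have rad: "rad d (ev q) = {f \<in> forms d. ev q f = 0}"
    proof
      show "rad d (ev q) \<subseteq> {f \<in> forms d. ev q f = 0}"
      proof
        fix f assume f: "f \<in> rad d (ev q)"
        then have "ev q (f * Var 3 ^ d) = 0" using Var_power_in_forms[of 3 d] by (auto simp: rad_def)
        then show "f \<in> {f \<in> forms d. ev q f = 0}" using f q3 by (auto simp: ev_power rad_def)
      qed
    qed (auto simp: rad_def)
    have "ev q ` forms d = UNIV"
    proof -
      have "y = ev q ((y / q 3 ^ d) *\<^sub>R Var 3 ^ d)" "(y / q 3 ^ d) *\<^sub>R Var 3 ^ d \<in> forms d" for y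
        using q3 Var_power_in_forms by (simp_all add: ev_power subspace_scale subspace_forms)
      then show ?thesis by blast
    qed
    then show "1 + dim (rad d (ev q)) = dim (forms d)"
      using rank_nullity[OF linear_ev[of q] subspace_forms fin_dim_forms, of d] rad by simp
    fix m :: "ternary \<Rightarrow> real"
    assume m: "linear m" "\<And>f g. f \<in> rad d (ev q) \<Longrightarrow> g \<in> forms d \<Longrightarrow> m (f * g) = 0"
    have kill: "m (Var i * f) = 0" if i: "ev q (Var i) = 0" and f: "f \<in> forms (2 * d - 1)" for i f
    proof -
      have "f \<in> forms ((d - 1) + d)" using f assms by (simp add: mult_2)
      then show ?thesis
      proof (induction rule: forms_add_induct)
        case (mult f g)
        have "Var i * f \<in> rad d (ev q)"
          using forms_mult[OF Var_in_forms mult(1), of i] assms i by (simp add: rad)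
        then show ?case using m(2)[of "Var i * f" g] mult by (simp add: mult.assoc)
      qed (simp_all add: linear_0[OF m(1)] linear_add[OF m(1)] linear_cmul[OF m(1)] distrib_left)
    qed
    have "\<exists>c. \<forall>f\<in>forms (Suc (2 * d - 1)). m f = c * ev q f"
      using q(4) m(1) kill[OF q(2)] kill[OF q(3)] by blast
    moreover have "Suc (2 * d - 1) = 2 * d" using assms by simp
    ultimately show "\<exists>c. \<forall>h\<in>forms (2 * d). m h = c * ev q h" by simp
  qed
qed

section \<open>Extreme rays from point configurations\<close>

text \<open>Counts the value vectors that forms can attain at finitely many points.\<close>

lemma functions_supported_on:
  fixes S :: "'i set"
  assumes "finite S"
  shows "subspace {\<phi>::'i \<Rightarrow> real. \<forall>x. x \<notin> S \<longrightarrow> \<phi> x = 0}" "fin_dim {\<phi>::'i \<Rightarrow> real. \<forall>x. x \<notin> S \<longrightarrow> \<phi> x = 0}"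
    "dim {\<phi>::'i \<Rightarrow> real. \<forall>x. x \<notin> S \<longrightarrow> \<phi> x = 0} = card S"
proof -
  let ?V = "\<lambda>S. {\<phi>::'i \<Rightarrow> real. \<forall>x. x \<notin> S \<longrightarrow> \<phi> x = 0}"
  have sub: "subspace (?V T)" for T
    by (auto simp: subspace_def scaleR_fun_def)
  show "subspace (?V S)" by (rule sub)
  have "fin_dim (?V S) \<and> dim (?V S) = card S"
    using assms
  proof (induction rule: finite_induct)
    case empty
    have "?V {} = {0}" by (auto simp: fun_eq_iff)
    then show ?case using dim_unique[of "{}" "{0::'i \<Rightarrow> real}" 0]
      by (auto simp: fin_dim_def independent_empty intro!: exI[of _ "{}"])
  next
    case (insert s S)
    obtain B where B: "finite B" "?V S \<subseteq> span B" using insert unfolding fin_dim_def by blast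
    define e where "e = (\<lambda>x. if x = s then 1 else (0::real))"
    have "\<phi> \<in> span (insert e B)" if "\<phi> \<in> ?V (insert s S)" for \<phi>
    proof -
      have "\<phi> - \<phi> s *\<^sub>R e \<in> ?V S" using that by (auto simp: e_def scaleR_fun_def)
      then have "\<phi> - \<phi> s *\<^sub>R e \<in> span B" using B by blast
      then show ?thesis by (auto simp: span_breakdown_eq)
    qed
    then have fd: "fin_dim (?V (insert s S))" unfolding fin_dim_def using B
      by (intro exI[of _ "insert e B"]) auto
    have lin: "linear (\<lambda>\<phi>::'i \<Rightarrow> real. \<phi> s)" by (rule linearI) (auto simp: scaleR_fun_def)
    have "(\<lambda>\<phi>. \<phi> s) ` ?V (insert s S) = UNIV"
    proof -
      have "y = (y *\<^sub>R e) s" "y *\<^sub>R e \<in> ?V (insert s S)" for y by (auto simp: e_def scaleR_fun_def)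
      then show ?thesis by blast
    qed
    moreover have "{\<phi> \<in> ?V (insert s S). \<phi> s = 0} = ?V S" using insert.hyps by auto
    ultimately have "dim (?V (insert s S)) = 1 + dim (?V S)"
      using rank_nullity[OF lin sub fd] by simp
    then show ?case using insert fd by simp
  qed
  then show "fin_dim (?V S)" "dim (?V S) = card S" by auto
qed

text \<open>With \<open>w\<^sub>i = u\<^sub>i f(p\<^sub>i)\<close> the linear relation says \<open>w\<^sub>0 = - \<Sum> w\<^sub>i\<close>, and the functional below is
  \<open>N \<Sum> w\<^sub>i\<^sup>2 - (\<Sum> w\<^sub>i)\<^sup>2\<close>, the sums running over the \<open>N\<close> points other than \<open>p\<^sub>0\<close>: by Cauchy--Schwarz
  it is positive semidefinite, and it vanishes exactly where all \<open>w\<^sub>i\<close> agree.\<close>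

lemma extreme_ray_of_point_configuration:
  fixes \<Gamma> :: "'i set" and P :: "'i \<Rightarrow> 3 \<Rightarrow> real" and u :: "'i \<Rightarrow> real"
  assumes \<Gamma>: "finite \<Gamma>" "3 \<le> card \<Gamma>" and u: "\<And>i. i \<in> \<Gamma> \<Longrightarrow> u i \<noteq> 0"
    and rel: "\<And>f. f \<in> forms d \<Longrightarrow> (\<Sum>i\<in>\<Gamma>. u i * ev (P i) f) = 0"
    and unique: "\<And>v. (\<And>f. f \<in> forms d \<Longrightarrow> (\<Sum>i\<in>\<Gamma>. v i * ev (P i) f) = 0) \<Longrightarrow> \<exists>c. \<forall>i\<in>\<Gamma>. v i = c * u i"
    and span: "\<And>m. linear m \<Longrightarrow>
      (\<And>f g. f \<in> forms d \<Longrightarrow> (\<And>i. i \<in> \<Gamma> \<Longrightarrow> ev (P i) f = 0) \<Longrightarrow> g \<in> forms d \<Longrightarrow> m (f * g) = 0) \<Longrightarrow>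
      \<exists>\<mu>. \<forall>h\<in>forms (2 * d). m h = (\<Sum>i\<in>\<Gamma>. \<mu> i * ev (P i) h)"
  shows "has_extreme_ray_of_rank d (card \<Gamma> - 2)"
proof -
  obtain o' where o: "o' \<in> \<Gamma>" using \<Gamma> by fastforce
  define S where "S = \<Gamma> - {o'}"
  have S: "finite S" using \<Gamma> by (simp add: S_def)
  define N where "N = real (card S)"
  have N: "card S = card \<Gamma> - 1" "2 \<le> N" using \<Gamma> o by (simp_all add: S_def N_def)
  have split: "(\<Sum>i\<in>\<Gamma>. F i) = F o' + (\<Sum>i\<in>S. F i)" for F :: "'i \<Rightarrow> real"
    unfolding S_def by (rule sum.remove[OF \<Gamma>(1) o])
  define w where "w = (\<lambda>i f. u i * ev (P i) f)"
  have lw: "linear (w i)" for i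
    unfolding w_def by (rule linearI) (simp_all add: distrib_left)
  have wo: "w o' f = - (\<Sum>i\<in>S. w i f)" if "f \<in> forms d" for f
    using rel[OF that] unfolding w_def split by linarith
  \<comment> \<open>A relation on S is a relation on \<Gamma> with coefficient 0 at
    \<open>o'\<close>; being a multiple of u, which is nonzero there, it is trivial.\<close>
  have indep: "c s = 0" if c: "\<And>f. f \<in> forms d \<Longrightarrow> (\<Sum>i\<in>S. c i * w i f) = 0" and s: "s \<in> S" for c s
  proof -
    define v where "v = (\<lambda>i. if i = o' then 0 else c i * u i)"
    have "(\<Sum>i\<in>\<Gamma>. v i * ev (P i) f) = (\<Sum>i\<in>S. c i * w i f)" for f
      unfolding split by (simp add: v_def) (auto simp: S_def w_def intro!: sum.cong)
    then obtain k where k: "\<forall>i\<in>\<Gamma>. v i = k * u i" using unique[of v] c by auto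
    have "k = 0" using bspec[OF k o] u[OF o] by (simp add: v_def)
    then show ?thesis using bspec[OF k, of s] s u[of s] by (auto simp: v_def S_def)
  qed
  have "\<exists>e. \<forall>s\<in>S. e s \<in> forms d \<and> (\<forall>t\<in>S. w t (e s) = (if t = s then 1 else 0))"
    by (rule functional_dual_family[OF S subspace_forms lw]) (use indep in blast)
  then obtain e where e: "\<And>s. s \<in> S \<Longrightarrow> e s \<in> forms d"
    "\<And>s t. s \<in> S \<Longrightarrow> t \<in> S \<Longrightarrow> w t (e s) = (if t = s then 1 else 0)" by blast
  have kron: "(\<Sum>i\<in>S. F i * w i (e s)) = F s" if s: "s \<in> S" for F s
  proof -
    have "(\<Sum>i\<in>S. F i * w i (e s)) = (\<Sum>i\<in>S. if i = s then F i else 0)"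
      using s by (intro sum.cong) (auto simp: e(2))
    then show ?thesis using s S by simp
  qed
  define L where "L = (\<lambda>h. N * (\<Sum>i\<in>S. (u i)\<^sup>2 * ev (P i) h) - (u o')\<^sup>2 * ev (P o') h)"
  have linL: "linear L"
    unfolding L_def
    by (rule linearI) (simp_all add: algebra_simps sum.distrib sum_distrib_left)
  have L: "L (f * g) = N * (\<Sum>i\<in>S. w i f * w i g) - (\<Sum>i\<in>S. w i f) * (\<Sum>i\<in>S. w i g)"
    if "f \<in> forms d" "g \<in> forms d" for f g
  proof -
    have "(u o')\<^sup>2 * ev (P o') (f * g) = w o' f * w o' g" by (simp add: w_def power2_eq_square)
    moreover have "(\<Sum>i\<in>S. (u i)\<^sup>2 * ev (P i) (f * g)) = (\<Sum>i\<in>S. w i f * w i g)"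
      by (simp add: w_def power2_eq_square mult.assoc mult.left_commute)
    ultimately show ?thesis using wo[OF that(1)] wo[OF that(2)] unfolding L_def by simp
  qed
  have psd: "psd_on d L"
    unfolding psd_on_def
  proof (intro conjI ballI linL)
    fix f assume f: "f \<in> forms d"
    have "(\<Sum>i\<in>S. w i f)\<^sup>2 \<le> (\<Sum>i\<in>S. (w i f)\<^sup>2) * N"
      unfolding N_def using sum_squared_le_sum_of_squares[of "\<lambda>i. w i f" S] S
      by (cases "S = {}") (auto simp: mult.commute)
    then show "0 \<le> L (f * f)" using L[OF f f] by (simp add: power2_eq_square mult.commute)
  qed
  have rad: "rad d L = {f \<in> forms d. \<exists>c. \<forall>i\<in>S. w i f = c}"
  proof (intro set_eqI iffI)
    fix f assume f: "f \<in> rad d L"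
    then have fd: "f \<in> forms d" by (simp add: rad_def)
    have "w s f = (\<Sum>i\<in>S. w i f) / N" if s: "s \<in> S" for s
    proof -
      have "(\<Sum>i\<in>S. w i (e s)) = 1" "(\<Sum>i\<in>S. w i f * w i (e s)) = w s f"
        using kron[OF s, of "\<lambda>_. 1"] kron[OF s, of "\<lambda>i. w i f"] by simp_all
      moreover have "L (f * e s) = 0" using f e(1)[OF s] by (simp add: rad_def)
      ultimately have "N * w s f = (\<Sum>i\<in>S. w i f)" using L[OF fd e(1)[OF s]] by simp
      then show ?thesis using N by (simp add: field_simps)
    qed
    then show "f \<in> {f \<in> forms d. \<exists>c. \<forall>i\<in>S. w i f = c}" using fd by blast
  next
    fix f assume "f \<in> {f \<in> forms d. \<exists>c. \<forall>i\<in>S. w i f = c}"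
    then obtain c where f: "f \<in> forms d" "\<forall>i\<in>S. w i f = c" by blast
    have "L (f * g) = 0" if "g \<in> forms d" for g
    proof -
      have "(\<Sum>i\<in>S. w i f * w i g) = c * (\<Sum>i\<in>S. w i g)" "(\<Sum>i\<in>S. w i f) = N * c"
        using f(2) by (simp_all add: N_def sum_distrib_left)
      then show ?thesis using L[OF f(1) that] by simp
    qed
    then show "f \<in> rad d L" using f by (simp add: rad_def)
  qed
  have kron': "(\<Sum>s\<in>S. F s * w i (e s)) = F i" if i: "i \<in> S" for F i
  proof -
    have "(\<Sum>s\<in>S. F s * w i (e s)) = (\<Sum>s\<in>S. if s = i then F s else 0)"
      using i by (intro sum.cong) (auto simp: e(2))
    then show ?thesis using i S by simp
  qed
  \<comment> \<open>All \<open>w i f0\<close> with i in S equal 1, so \<open>f0\<close> spans the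
    radical modulo the forms vanishing on S; the rank is therefore
    \<open>card S - 1\<close>.\<close>
  define f0 where "f0 = (\<Sum>s\<in>S. e s)"
  have f0: "f0 \<in> forms d" unfolding f0_def using e(1) by (intro subspace_sum[OF subspace_forms]) auto
  have wf0: "w i f0 = 1" if "i \<in> S" for i
    using kron'[OF that, of "\<lambda>_. 1"] by (simp add: f0_def linear_sum[OF lw])
  obtain s1 where s1: "s1 \<in> S" using N by (metis N_def card.empty ex_in_conv of_nat_0 not_numeral_le_zero)
  show ?thesis
  proof (rule has_extreme_rayI[OF psd])
    show "e s1 * e s1 \<in> forms (2 * d)" using e(1)[OF s1] by (rule forms_mult_double[OF _ e(1)[OF s1]])
    have "(\<Sum>i\<in>S. w i (e s1)) = 1" "(\<Sum>i\<in>S. w i (e s1) * w i (e s1)) = 1"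
      using kron[OF s1, of "\<lambda>_. 1"] kron[OF s1, of "\<lambda>i. w i (e s1)"] e(2)[OF s1 s1] by simp_all
    then have "L (e s1 * e s1) = N - 1" using L[OF e(1)[OF s1] e(1)[OF s1]] by simp
    then show "L (e s1 * e s1) \<noteq> 0" using N by simp
  next
    let ?K = "{f \<in> forms d. \<forall>i\<in>S. w i f = 0}"
    have fdr: "fin_dim (rad d L)" by (rule fin_dim_subset[OF fin_dim_forms rad_subset])
    have "w s1 ` rad d L = UNIV"
    proof -
      have "y *\<^sub>R f0 \<in> rad d L" "y = w s1 (y *\<^sub>R f0)" for y
        using f0 wf0 s1 by (auto simp: rad linear_cmul[OF lw] subspace_scale[OF subspace_forms])
      then show ?thesis by blast
    qed
    moreover have "{f \<in> rad d L. w s1 f = 0} = ?K" using s1 by (auto simp: rad)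
    ultimately have dim1: "dim (rad d L) = 1 + dim ?K"
      using rank_nullity[OF lw subspace_rad[OF linL] fdr, of s1] by simp
    define E where "E = (\<lambda>f i. if i \<in> S then w i f else 0)"
    have linE: "linear E"
      by (rule linearI) (auto simp: E_def fun_eq_iff scaleR_fun_def linear_add[OF lw] linear_cmul[OF lw])
    have "E ` forms d = {\<phi>. \<forall>i. i \<notin> S \<longrightarrow> \<phi> i = 0}"
    proof (intro set_eqI iffI)
      fix \<phi> :: "'i \<Rightarrow> real" assume \<phi>: "\<phi> \<in> {\<phi>. \<forall>i. i \<notin> S \<longrightarrow> \<phi> i = 0}"
      let ?f = "\<Sum>s\<in>S. \<phi> s *\<^sub>R e s"
      have "w i ?f = \<phi> i" if "i \<in> S" for i
        using kron'[OF that, of \<phi>] by (simp add: linear_sum[OF lw] linear_cmul[OF lw])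
      then have "\<phi> = E ?f" using \<phi> by (auto simp: E_def fun_eq_iff)
      moreover have "?f \<in> forms d"
        using e(1) by (intro subspace_sum[OF subspace_forms] subspace_scale[OF subspace_forms]) auto
      ultimately show "\<phi> \<in> E ` forms d" by blast
    qed (auto simp: E_def)
    moreover have "{f \<in> forms d. E f = 0} = ?K" by (auto simp: E_def fun_eq_iff)
    ultimately have "dim (forms d) = card S + dim ?K"
      using rank_nullity[OF linE subspace_forms fin_dim_forms, of d] functions_supported_on(3)[OF S] by simp
    then show "card \<Gamma> - 2 + dim (rad d L) = dim (forms d)" using dim1 N \<Gamma> by simp
  next
    fix m :: "ternary \<Rightarrow> real"
    assume m: "linear m" "\<And>f g. f \<in> rad d L \<Longrightarrow> g \<in> forms d \<Longrightarrow> m (f * g) = 0"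
    have "m (f * g) = 0" if f: "f \<in> forms d" "\<And>i. i \<in> \<Gamma> \<Longrightarrow> ev (P i) f = 0" and g: "g \<in> forms d" for f g
      using f g by (intro m(2)) (auto simp: rad w_def S_def)
    then obtain \<mu> where \<mu>: "\<forall>h\<in>forms (2 * d). m h = (\<Sum>i\<in>\<Gamma>. \<mu> i * ev (P i) h)"
      using span[OF m(1)] by blast
    \<comment> \<open>Testing m on the products \<open>f0 * g\<close> gives a relation with these
      coefficients. It is a multiple of u, and since \<open>f0\<close> vanishes at none of the
      points this determines every \<open>\<mu> i\<close>.\<close>
    define v where "v = (\<lambda>i. \<mu> i * ev (P i) f0)"
    have f0rad: "f0 \<in> rad d L" using f0 wf0 by (auto simp: rad)
    have "(\<Sum>i\<in>\<Gamma>. v i * ev (P i) g) = 0" if g: "g \<in> forms d" for g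
      using m(2)[OF f0rad g] bspec[OF \<mu> forms_mult_double[OF f0 g]] by (simp add: v_def mult.assoc)
    then obtain k where k: "\<And>i. i \<in> \<Gamma> \<Longrightarrow> \<mu> i * ev (P i) f0 = k * u i"
      using unique[of v] by (auto simp: v_def)
    have "\<mu> i = k * (u i)\<^sup>2" if i: "i \<in> S" for i
    proof -
      have "u i * ev (P i) f0 = 1" using wf0[OF i] by (simp add: w_def)
      then have "\<mu> i = u i * (\<mu> i * ev (P i) f0)" by (metis mult.left_commute mult.right_neutral)
      also have "\<dots> = u i * (k * u i)" using k[of i] i by (simp add: S_def)
      finally show ?thesis by (simp add: power2_eq_square)
    qed
    \<comment> \<open>At \<open>o'\<close> the value of w on \<open>f0\<close> is - N instead of 1,
      whence the factor -1/N.\<close>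
    moreover have "\<mu> o' = - (k / N) * (u o')\<^sup>2"
    proof -
      have "u o' * ev (P o') f0 = - N" using wo[OF f0] wf0 by (simp add: w_def N_def)
      then have "- N * \<mu> o' = u o' * (\<mu> o' * ev (P o') f0)" by (metis mult.commute mult.left_commute)
      also have "\<dots> = k * (u o')\<^sup>2" unfolding k[OF o] by (simp add: power2_eq_square)
      finally have "- N * \<mu> o' = k * (u o')\<^sup>2" .
      then show ?thesis using N by (simp add: field_simps)
    qed
    ultimately have "m h = k / N * L h" if "h \<in> forms (2 * d)" for h
      using bspec[OF \<mu> that] N unfolding split
      by (simp add: L_def algebra_simps sum_distrib_left diff_divide_distrib)
    then show "\<exists>c. \<forall>h\<in>forms (2 * d). m h = c * L h" by blast
  qed
qed

section \<open>Grids\<close>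

definition pt :: "real \<times> real \<Rightarrow> 3 \<Rightarrow> real"
  where "pt p = (\<lambda>i. if i = 1 then fst p else if i = 2 then snd p else 1)"

lemma pt_simps [simp]: "pt (x, y) 1 = x" "pt (x, y) 2 = y" "pt p 3 = 1"
  by (simp_all add: pt_def)

text \<open>Polynomial functions of degree at most n on the chart where the third coordinate is 1.
  Being functions, they can be evaluated at concrete grid points by simplification.\<close>

definition bipoly :: "nat \<Rightarrow> (real \<Rightarrow> real \<Rightarrow> real) set"
  where "bipoly n = {k. \<exists>f\<in>forms n. \<forall>x y. k x y = ev (pt (x, y)) f}"

lemma bipolyI: "f \<in> forms n \<Longrightarrow> (\<And>x y. k x y = ev (pt (x, y)) f) \<Longrightarrow> k \<in> bipoly n"
  unfolding bipoly_def by blast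

lemma bipoly_add: "k \<in> bipoly n \<Longrightarrow> l \<in> bipoly n \<Longrightarrow> (\<lambda>x y. k x y + l x y) \<in> bipoly n"
  unfolding bipoly_def by (auto intro!: bexI[of _ "f + g" for f g] subspace_add[OF subspace_forms])

lemma bipoly_scale: "k \<in> bipoly n \<Longrightarrow> (\<lambda>x y. c * k x y) \<in> bipoly n"
  unfolding bipoly_def by (auto intro!: bexI[of _ "c *\<^sub>R f" for f] subspace_scale[OF subspace_forms])

lemma bipoly_0: "(\<lambda>x y. 0) \<in> bipoly n"
  by (rule bipolyI[of 0]) (simp_all add: subspace_0[OF subspace_forms])

lemma bipoly_sum: "(\<And>i. i \<in> S \<Longrightarrow> k i \<in> bipoly n) \<Longrightarrow> (\<lambda>x y. \<Sum>i\<in>S. k i x y) \<in> bipoly n"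
  by (induction S rule: infinite_finite_induct) (auto simp: bipoly_0 intro!: bipoly_add)

lemma bipoly_mult: "k \<in> bipoly m \<Longrightarrow> l \<in> bipoly n \<Longrightarrow> (\<lambda>x y. k x y * l x y) \<in> bipoly (m + n)"
  unfolding bipoly_def by (auto intro!: bexI[of _ "f * g" for f g] forms_mult)

lemma bipoly_mono:
  assumes "k \<in> bipoly m" "m \<le> n" shows "k \<in> bipoly n"
proof -
  obtain f where f: "f \<in> forms m" "\<And>x y. k x y = ev (pt (x, y)) f" using assms unfolding bipoly_def by blast
  show ?thesis
    by (rule bipolyI[of "f * Var 3 ^ (n - m)"])
      (use forms_mult[OF f(1) Var_power_in_forms[of 3 "n - m"]] assms f in auto)
qed

lemma bipoly_const: "(\<lambda>x y. c) \<in> bipoly n"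
  by (rule bipolyI[of "c *\<^sub>R Var 3 ^ n"]) (simp_all add: Var_power_in_forms subspace_scale subspace_forms)

lemma bipoly_x: "(\<lambda>x y. x) \<in> bipoly 1" and bipoly_y: "(\<lambda>x y. y) \<in> bipoly 1"
  by (rule bipolyI[OF Var_in_forms[of 1]], simp, rule bipolyI[OF Var_in_forms[of 2]], simp)

lemma bipoly_power: "k \<in> bipoly m \<Longrightarrow> (\<lambda>x y. k x y ^ n) \<in> bipoly (m * n)"
  by (induction n) (auto simp: bipoly_const dest: bipoly_mult)

lemma bipoly_poly:
  assumes "k \<in> bipoly 1" "degree p \<le> n"
  shows "(\<lambda>x y. poly p (k x y)) \<in> bipoly n"
proof -
  have "(\<lambda>x y. \<Sum>i\<le>degree p. coeff p i * k x y ^ i) \<in> bipoly n"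
    using assms(2) by (intro bipoly_sum bipoly_scale bipoly_mono[OF bipoly_power[OF assms(1)]]) auto
  then show ?thesis by (simp add: poly_altdef)
qed

text \<open>Splits off the terms divisible by x; iterating yields the explicit coefficients used for
  the concrete curves.\<close>

lemma bipoly_Suc_cases:
  assumes "k \<in> bipoly (Suc n)"
  obtains l p where "l \<in> bipoly n" "degree p \<le> Suc n" "\<And>x y. k x y = x * l x y + poly p y"
proof -
  define T where "T n = {f. \<exists>l\<in>bipoly n. \<exists>p. degree p \<le> Suc n \<and> (\<forall>x y. ev (pt (x, y)) f = x * l x y + poly p y)}" for n
  have sub: "subspace (T n)" for n
    unfolding subspace_def
  proof (intro conjI ballI allI)
    show "0 \<in> T n" unfolding T_def
      by (auto intro!: bexI[OF _ bipoly_0] exI[of _ 0])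
    fix f assume "f \<in> T n"
    then obtain l p where f: "l \<in> bipoly n" "degree p \<le> Suc n" "\<And>x y. ev (pt (x, y)) f = x * l x y + poly p y"
      unfolding T_def by blast
    {
      fix g assume "g \<in> T n"
      then obtain l' p' where g: "l' \<in> bipoly n" "degree p' \<le> Suc n" "\<And>x y. ev (pt (x, y)) g = x * l' x y + poly p' y"
        unfolding T_def by blast
      show "f + g \<in> T n" unfolding T_def using f g
        by (auto intro!: bexI[OF _ bipoly_add[OF f(1) g(1)]] exI[of _ "p + p'"] degree_add_le simp: algebra_simps)
    }
    fix c
    show "c *\<^sub>R f \<in> T n" unfolding T_def using f
      by (auto intro!: bexI[OF _ bipoly_scale[OF f(1), of c]] exI[of _ "smult c p"] simp: algebra_simps
          intro: order_trans[OF degree_smult_le])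
  qed
  have "f \<in> T n" if "f \<in> forms (Suc n)" for f
    using that
  proof (induction n arbitrary: f)
    case 0
    obtain g where g: "\<And>i. g i \<in> forms 0" "f = (\<Sum>i\<in>UNIV. Var i * g i)" using forms_Suc[OF 0] by blast
    have "\<forall>i. \<exists>c. g i = c *\<^sub>R 1" using g(1) forms_0 by blast
    then obtain c where c: "\<And>i. g i = c i *\<^sub>R 1" by metis
    show ?case unfolding T_def
      by (auto simp: g(2) c sum_3 intro!: bexI[OF _ bipoly_const[of "c 1"]] exI[of _ "[:c 3, c 2:]"])
  next
    case (Suc n)
    obtain g where g: "\<And>i. g i \<in> forms (Suc n)" "f = (\<Sum>i\<in>UNIV. Var i * g i)" using forms_Suc[OF Suc.prems] by blast
    have 1: "Var 1 * g 1 \<in> T (Suc n)"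
    proof -
      have "(\<lambda>x y. ev (pt (x, y)) (g 1)) \<in> bipoly (Suc n)" by (rule bipolyI[OF g(1)]) simp
      then show ?thesis unfolding T_def by (auto intro!: bexI exI[of _ 0])
    qed
    have 2: "Var i * g i \<in> T (Suc n)" if "i \<noteq> 1" for i
    proof -
      obtain l p where l: "l \<in> bipoly n" "degree p \<le> Suc n" "\<And>x y. ev (pt (x, y)) (g i) = x * l x y + poly p y"
        using Suc.IH[OF g(1)[of i]] unfolding T_def by blast
      have "(\<lambda>x y. ev (pt (x, y)) (Var i)) \<in> bipoly 1" by (rule bipolyI[OF Var_in_forms]) simp
      then have "(\<lambda>x y. ev (pt (x, y)) (Var i) * l x y) \<in> bipoly (Suc n)" using bipoly_mult[OF _ l(1)] by force
      \<comment> \<open>The second variable contributes a factor y, while the third is 1 on the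
        chart.\<close>
      moreover define r where "r = (if i = 2 then [:0, 1:] else 1) * p"
      have "degree (if i = 2 then [:0, 1:] else (1::real poly)) \<le> 1" by auto
      then have "degree r \<le> Suc (Suc n)" unfolding r_def using l(2)
        by (intro order_trans[OF degree_mult_le]) linarith
      moreover have "ev (pt (x, y)) (Var i * g i) = x * (ev (pt (x, y)) (Var i) * l x y) + poly r y" for x y
        using that exhaust_3[of i] by (auto simp: l(3) r_def algebra_simps)
      ultimately show ?thesis unfolding T_def by (intro CollectI bexI exI conjI allI)
    qed
    show ?case unfolding g(2) by (rule subspace_sum[OF sub]) (metis 1 2)
  qed
  moreover obtain f where f: "f \<in> forms (Suc n)" "\<And>x y. k x y = ev (pt (x, y)) f"
    using assms unfolding bipoly_def by blast
  ultimately obtain l p where "l \<in> bipoly n" "degree p \<le> Suc n" "\<forall>x y. ev (pt (x, y)) f = x * l x y + poly p y"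
    unfolding T_def by blast
  then show ?thesis using that f(2) by simp
qed

section \<open>Interpolation in one variable\<close>

definition nodal :: "real set \<Rightarrow> real poly"
  where "nodal A = (\<Prod>a\<in>A. [:-a, 1:])"

lemma nodal_props:
  assumes "finite A"
  shows "degree (nodal A) = card A" "coeff (nodal A) (card A) = 1" "poly (nodal A) x = (\<Prod>a\<in>A. x - a)"
proof -
  have "degree (nodal A) = (\<Sum>a\<in>A. degree [:-a, 1:])"
    unfolding nodal_def by (rule degree_prod_eq_sum_degree) simp
  then show "degree (nodal A) = card A" by simp
  moreover have "lead_coeff (nodal A) = 1" unfolding nodal_def lead_coeff_prod by simp
  ultimately show "coeff (nodal A) (card A) = 1" by simp
  show "poly (nodal A) x = (\<Prod>a\<in>A. x - a)" by (simp add: nodal_def poly_prod)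
qed

text \<open>Barycentric weight of Lagrange interpolation: at x in A, the reciprocal of the
  derivative of \<open>nodal A\<close>.\<close>

definition weight :: "real set \<Rightarrow> real \<Rightarrow> real"
  where "weight A x = 1 / (\<Prod>a\<in>A - {x}. x - a)"

lemma weight_ne_0: "finite A \<Longrightarrow> weight A x \<noteq> 0"
  by (auto simp: weight_def)

lemma poly_nodal_delta:
  assumes "finite A" "x \<in> A" "y \<in> A"
  shows "weight A x * poly (nodal (A - {x})) y = (if y = x then 1 else 0)"
  using assms by (auto simp: weight_def nodal_props)

lemma Lagrange_monom:
  assumes A: "finite A" and i: "i < card A"
  shows "monom 1 i = (\<Sum>x\<in>A. smult (x ^ i * weight A x) (nodal (A - {x})))"
proof (rule poly_eqI_degree[of A])
  fix y assume y: "y \<in> A"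
  have "poly (\<Sum>x\<in>A. smult (x ^ i * weight A x) (nodal (A - {x}))) y
      = (\<Sum>x\<in>A. x ^ i * (weight A x * poly (nodal (A - {x})) y))"
    by (simp add: poly_sum mult.assoc)
  also have "\<dots> = (\<Sum>x\<in>A. if x = y then y ^ i else 0)"
    using A y by (intro sum.cong refl) (subst poly_nodal_delta, auto)
  also have "\<dots> = y ^ i" using A y by simp
  finally show "poly (monom 1 i) y = poly (\<Sum>x\<in>A. smult (x ^ i * weight A x) (nodal (A - {x}))) y"
    by (simp add: poly_monom)
next
  show "degree (monom (1::real) i) < card A" using i by (simp add: degree_monom_eq)
  have "degree (\<Sum>x\<in>A. smult (x ^ i * weight A x) (nodal (A - {x}))) \<le> card A - 1"
    using A by (intro degree_sum_le) (auto intro!: order_trans[OF degree_smult_le] simp: nodal_props)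
  then show "degree (\<Sum>x\<in>A. smult (x ^ i * weight A x) (nodal (A - {x}))) < card A" using i by linarith
qed

text \<open>The sum is the coefficient of degree \<open>card A - 1\<close> in the Lagrange
  interpolant of the monomial, which is the monomial itself and has smaller degree.\<close>

lemma divided_difference_power:
  assumes A: "finite A" and i: "Suc i < card A"
  shows "(\<Sum>x\<in>A. weight A x * x ^ i) = 0"
proof -
  have "coeff (nodal (A - {x})) (card A - 1) = 1" if "x \<in> A" for x
    using nodal_props(1,2)[of "A - {x}"] A that by simp
  then have "coeff (\<Sum>x\<in>A. smult (x ^ i * weight A x) (nodal (A - {x}))) (card A - 1) = (\<Sum>x\<in>A. weight A x * x ^ i)"
    by (simp add: coeff_sum mult.commute)
  moreover have "coeff (monom (1::real) i) (card A - 1) = 0" using i by simp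
  ultimately show ?thesis using Lagrange_monom[OF A, of i] i by simp
qed

lemma coeff_synthetic_div: "coeff (synthetic_div p c) k = poly (poly_shift (Suc k) p) c"
proof (induction p arbitrary: k)
  case 0 then show ?case by (simp add: poly_shift_0)
next
  case (pCons a p)
  have shift: "poly_shift (Suc j) (pCons a p) = poly_shift j p" for j
    by (rule poly_eqI) (simp add: coeff_poly_shift)
  have "poly_shift 0 p = p" by (rule poly_eqI) (simp add: coeff_poly_shift)
  then show ?case by (cases k) (simp_all add: pCons.IH shift)
qed

text \<open>\<open>nodal (A - {t})\<close> is \<open>nodal A\<close> divided by the linear factor at
  t, and its coefficient at \<open>x ^ k\<close> is a polynomial in t of degree at most
  \<open>card A - Suc k\<close>. This makes the multiplier in \<open>grid_relation_converse\<close>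
  a polynomial of controlled degree.\<close>

lemma nodal_remove_expand:
  assumes A: "finite A" "t \<in> A"
  shows "poly (nodal (A - {t})) x = (\<Sum>k<card A. poly (poly_shift (Suc k) (nodal A)) t * x ^ k)"
proof -
  have "nodal A = [:-t, 1:] * nodal (A - {t})" unfolding nodal_def by (rule prod.remove[OF A])
  moreover have "poly (nodal A) t = 0" using A by (auto simp: nodal_props)
  then have "nodal A = [:-t, 1:] * synthetic_div (nodal A) t"
    using synthetic_div_correct'[of t "nodal A"] by simp
  ultimately have eq: "nodal (A - {t}) = synthetic_div (nodal A) t"
    by (metis mult_cancel_left pCons_eq_0_iff zero_neq_one)
  have "degree (nodal (A - {t})) \<le> card A - 1" using A by (simp add: nodal_props)
  then have "poly (nodal (A - {t})) x = (\<Sum>k\<le>card A - 1. coeff (nodal (A - {t})) k * x ^ k)"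
    by (subst poly_altdef, intro sum.mono_neutral_left) (auto simp: coeff_eq_0)
  also have "{..card A - 1} = {..<card A}" using A by (metis card_gt_0_iff empty_iff lessThan_Suc_atMost Suc_pred')
  finally show ?thesis by (simp add: eq coeff_synthetic_div)
qed

lemma degree_poly_shift_le: "degree (poly_shift k p) \<le> degree p - k"
  by (rule degree_le) (simp add: coeff_poly_shift coeff_eq_0)

lemma mon_eq_Var_powers:
  "mon \<alpha> = Var 1 ^ Poly_Mapping.lookup \<alpha> 1 * Var 2 ^ Poly_Mapping.lookup \<alpha> 2 * Var 3 ^ Poly_Mapping.lookup \<alpha> 3"
proof -
  have pow: "Var i ^ k = mon (Poly_Mapping.single i k)" for i k
    by (induction k) (simp_all add: Var_def mult_single flip: single_add)
  have "\<alpha> = Poly_Mapping.single 1 (Poly_Mapping.lookup \<alpha> 1) + Poly_Mapping.single 2 (Poly_Mapping.lookup \<alpha> 2)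
      + Poly_Mapping.single 3 (Poly_Mapping.lookup \<alpha> 3)"
  proof (rule poly_mapping_eqI)
    fix i :: 3
    show "Poly_Mapping.lookup \<alpha> i = Poly_Mapping.lookup (Poly_Mapping.single 1 (Poly_Mapping.lookup \<alpha> 1) + Poly_Mapping.single 2 (Poly_Mapping.lookup \<alpha> 2)
      + Poly_Mapping.single 3 (Poly_Mapping.lookup \<alpha> 3)) i"
      using exhaust_3[of i] by (auto simp: lookup_add lookup_single when_def)
  qed
  then show ?thesis by (metis pow mon_add)
qed

text \<open>A product of two divided differences kills a monomial unless both exponents reach
  \<open>card A - 1\<close> and \<open>card B - 1\<close>, which takes degree
  \<open>card A + card B - 2 > n\<close>.\<close>

lemma grid_relation:
  assumes A: "finite A" and B: "finite B" and n: "n + 3 \<le> card A + card B" and k: "k \<in> bipoly n"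
  shows "(\<Sum>(x, y)\<in>A \<times> B. weight A x * weight B y * k x y) = 0"
proof -
  obtain f where f: "f \<in> forms n" "\<And>x y. k x y = ev (pt (x, y)) f" using k unfolding bipoly_def by blast
  have "(\<Sum>(x, y)\<in>A \<times> B. weight A x * weight B y * ev (pt (x, y)) f) = 0"
  proof (rule forms_linear_eqI[OF _ linear_zero _ f(1)])
    show "linear (\<lambda>f. \<Sum>(x, y)\<in>A \<times> B. weight A x * weight B y * ev (pt (x, y)) f)"
      by (rule linearI) (simp_all add: case_prod_beta algebra_simps sum.distrib sum_distrib_left)
    fix \<alpha> assume \<alpha>: "deg \<alpha> = n"
    let ?i = "Poly_Mapping.lookup \<alpha> 1" and ?j = "Poly_Mapping.lookup \<alpha> 2"
    have "ev (pt (x, y)) (mon \<alpha>) = x ^ ?i * y ^ ?j" for x y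
      by (subst mon_eq_Var_powers) simp
    then have "(\<Sum>(x, y)\<in>A \<times> B. weight A x * weight B y * ev (pt (x, y)) (mon \<alpha>))
        = (\<Sum>(x, y)\<in>A \<times> B. (weight A x * x ^ ?i) * (weight B y * y ^ ?j))"
      by (simp add: mult_ac)
    also have "\<dots> = (\<Sum>x\<in>A. weight A x * x ^ ?i) * (\<Sum>y\<in>B. weight B y * y ^ ?j)"
      by (simp add: sum_product sum.cartesian_product)
    also have "Suc ?i < card A \<or> Suc ?j < card B" using \<alpha> n by (auto simp: sum_3)
    then have "(\<Sum>x\<in>A. weight A x * x ^ ?i) * (\<Sum>y\<in>B. weight B y * y ^ ?j) = 0"
      using divided_difference_power[OF A] divided_difference_power[OF B] by auto
    finally show "(\<Sum>(x, y)\<in>A \<times> B. weight A x * weight B y * ev (pt (x, y)) (mon \<alpha>)) = 0" .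
  qed
  then show ?thesis by (simp add: f(2))
qed

text \<open>The converse half of Cayley--Bacharach. The coefficients v are recovered from their
  moments \<open>\<sigma> k l\<close>, which vanish for \<open>k + l \<le> d\<close>. A surviving
  moment contributes degree at most \<open>(card A - Suc k) + (card B - Suc l) \<le> e\<close> to
  the multiplier h.\<close>

lemma grid_relation_converse:
  assumes A: "finite A" and B: "finite B" and n: "card A + card B \<le> d + 3 + e"
    and v: "\<And>f. f \<in> forms d \<Longrightarrow> (\<Sum>p\<in>A \<times> B. v p * ev (pt p) f) = 0"
  obtains h where "h \<in> bipoly e" "\<And>x y. x \<in> A \<Longrightarrow> y \<in> B \<Longrightarrow> v (x, y) = weight A x * weight B y * h x y"
proof -
  define \<sigma> where "\<sigma> = (\<lambda>k l. \<Sum>p\<in>A \<times> B. v p * (fst p ^ k * snd p ^ l))"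
  have \<sigma>: "\<sigma> k l = 0" if "k + l \<le> d" for k l
  proof -
    have "Var 1 ^ k * Var 2 ^ l * Var 3 ^ (d - k - l) \<in> forms d"
      using forms_mult[OF forms_mult[OF Var_power_in_forms[of 1 k] Var_power_in_forms[of 2 l]] Var_power_in_forms[of 3 "d - k - l"]]
        that by simp
    from v[OF this] show ?thesis by (simp add: \<sigma>_def pt_def)
  qed
  define s where "s = (\<lambda>k. poly_shift (Suc k) (nodal A))"
  define t where "t = (\<lambda>l. poly_shift (Suc l) (nodal B))"
  define h where "h = (\<lambda>x y. \<Sum>k<card A. \<Sum>l<card B. \<sigma> k l * (poly (s k) x * poly (t l) y))"
  show ?thesis
  proof (rule that[of h])
    show "h \<in> bipoly e"
      unfolding h_def
    proof (intro bipoly_sum)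
      fix k l assume k: "k \<in> {..<card A}" and l: "l \<in> {..<card B}"
      show "(\<lambda>x y. \<sigma> k l * (poly (s k) x * poly (t l) y)) \<in> bipoly e"
      proof (cases "k + l \<le> d")
        case True
        then show ?thesis by (simp add: \<sigma> bipoly_0)
      next
        case False
        have "degree (s k) \<le> card A - Suc k" "degree (t l) \<le> card B - Suc l"
          using degree_poly_shift_le[of "Suc k" "nodal A"] degree_poly_shift_le[of "Suc l" "nodal B"] A B
          by (simp_all add: s_def t_def nodal_props)
        then have "(\<lambda>x y. poly (s k) x * poly (t l) y) \<in> bipoly ((card A - Suc k) + (card B - Suc l))"
          by (intro bipoly_mult bipoly_poly bipoly_x bipoly_y)
        then show ?thesis using False k l n by (intro bipoly_scale) (erule bipoly_mono, simp)
      qed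
    qed
    fix x0 y0 assume x0: "x0 \<in> A" and y0: "y0 \<in> B"
    have "h x0 y0 = (\<Sum>k<card A. \<Sum>l<card B. \<Sum>p\<in>A \<times> B. v p * (poly (s k) x0 * fst p ^ k * (poly (t l) y0 * snd p ^ l)))"
      by (simp add: h_def \<sigma>_def sum_distrib_left sum_distrib_right mult_ac)
    also have "\<dots> = (\<Sum>k<card A. \<Sum>p\<in>A \<times> B. \<Sum>l<card B. v p * (poly (s k) x0 * fst p ^ k * (poly (t l) y0 * snd p ^ l)))"
      by (intro sum.cong refl sum.swap)
    also have "\<dots> = (\<Sum>p\<in>A \<times> B. \<Sum>k<card A. \<Sum>l<card B. v p * (poly (s k) x0 * fst p ^ k * (poly (t l) y0 * snd p ^ l)))"
      by (rule sum.swap)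
    also have "\<dots> = (\<Sum>p\<in>A \<times> B. v p * ((\<Sum>k<card A. poly (s k) x0 * fst p ^ k) * (\<Sum>l<card B. poly (t l) y0 * snd p ^ l)))"
      unfolding sum_product by (simp add: sum_distrib_left)
    also have "\<dots> = (\<Sum>p\<in>A \<times> B. v p * (poly (nodal (A - {x0})) (fst p) * poly (nodal (B - {y0})) (snd p)))"
      using nodal_remove_expand[OF A x0] nodal_remove_expand[OF B y0] by (simp add: s_def t_def)
    finally have h: "h x0 y0 = (\<Sum>p\<in>A \<times> B. v p * (poly (nodal (A - {x0})) (fst p) * poly (nodal (B - {y0})) (snd p)))" .
    \<comment> \<open>The weighted nodal products form the Kronecker delta of the grid, so the sum
      returns the coefficient at \<open>(x0, y0)\<close>.\<close>
    have "weight A x0 * weight B y0 * h x0 y0 = (\<Sum>p\<in>A \<times> B. v p * ((weight A x0 * poly (nodal (A - {x0})) (fst p)) * (weight B y0 * poly (nodal (B - {y0})) (snd p))))"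
      unfolding h by (simp add: sum_distrib_left mult_ac)
    also have "\<dots> = (\<Sum>p\<in>A \<times> B. if p = (x0, y0) then v p else 0)"
    proof (intro sum.cong refl)
      fix p assume "p \<in> A \<times> B"
      then show "v p * ((weight A x0 * poly (nodal (A - {x0})) (fst p)) * (weight B y0 * poly (nodal (B - {y0})) (snd p)))
          = (if p = (x0, y0) then v p else 0)"
        using poly_nodal_delta[OF A x0, of "fst p"] poly_nodal_delta[OF B y0, of "snd p"] by (cases p) auto
    qed
    also have "\<dots> = v (x0, y0)" using A B x0 y0 by simp
    finally show "v (x0, y0) = weight A x0 * weight B y0 * h x0 y0" by simp
  qed
qed

section \<open>Functionals vanishing on the ideal of a grid\<close>

definition homogenize :: "3 \<Rightarrow> nat \<Rightarrow> real poly \<Rightarrow> ternary"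
  where "homogenize i n p = (\<Sum>k\<le>n. coeff p k *\<^sub>R (Var i ^ k * Var 3 ^ (n - k)))"

lemma homogenize_in_forms: "homogenize i n p \<in> forms n"
  unfolding homogenize_def
proof (intro subspace_sum[OF subspace_forms] subspace_scale[OF subspace_forms])
  fix k assume "k \<in> {..n}"
  then show "Var i ^ k * Var 3 ^ (n - k) \<in> forms n"
    using forms_mult[OF Var_power_in_forms[of i k] Var_power_in_forms[of 3 "n - k"]] by simp
qed

lemma ev_homogenize:
  assumes "degree p \<le> n" "q 3 = 1" shows "ev q (homogenize i n p) = poly p (q i)"
proof -
  have "ev q (homogenize i n p) = (\<Sum>k\<le>n. coeff p k * q i ^ k)" using assms by (simp add: homogenize_def)
  also have "\<dots> = (\<Sum>k\<le>degree p. coeff p k * q i ^ k)"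
    using assms by (intro sum.mono_neutral_right) (auto simp: coeff_eq_0)
  finally show ?thesis by (simp add: poly_altdef)
qed

lemma homogenize_sum: "homogenize i n (\<Sum>x\<in>S. smult (c x) (p x)) = (\<Sum>x\<in>S. c x *\<^sub>R homogenize i n (p x))"
proof -
  have "homogenize i n (\<Sum>x\<in>S. smult (c x) (p x)) = (\<Sum>k\<le>n. \<Sum>x\<in>S. c x *\<^sub>R (coeff (p x) k *\<^sub>R (Var i ^ k * Var 3 ^ (n - k))))"
    by (simp add: homogenize_def coeff_sum scaleR_sum_left)
  also have "\<dots> = (\<Sum>x\<in>S. \<Sum>k\<le>n. c x *\<^sub>R (coeff (p x) k *\<^sub>R (Var i ^ k * Var 3 ^ (n - k))))"
    by (rule sum.swap)
  finally show ?thesis by (simp add: homogenize_def scaleR_sum_right)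
qed

lemma homogenize_monom: "k \<le> n \<Longrightarrow> homogenize i n (monom 1 k) = Var i ^ k * Var 3 ^ (n - k)"
  by (simp add: homogenize_def if_distrib[of "\<lambda>c. c *\<^sub>R _"] cong: if_cong)

lemma homogenize_lead:
  assumes "coeff p n = 1"
  shows "homogenize i n p = Var i ^ n + (\<Sum>k<n. coeff p k *\<^sub>R (Var i ^ k * Var 3 ^ (n - k)))"
  using assms by (simp add: homogenize_def lessThan_Suc_atMost[symmetric])

text \<open>The grid is the complete intersection of the two nodal forms. From degree
  \<open>card A + card B - 2\<close> on, the quotient by their ideal is the space of functions on
  the grid, so a functional killing the ideal is a combination of evaluations.\<close>

lemma functional_on_grid:
  assumes A: "finite A" and B: "finite B" and n: "card A + card B \<le> n + 2" "card A \<le> n" "card B \<le> n"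
    and m: "linear m"
    and mA: "\<And>f. f \<in> forms (n - card A) \<Longrightarrow> m (homogenize 1 (card A) (nodal A) * f) = 0"
    and mB: "\<And>f. f \<in> forms (n - card B) \<Longrightarrow> m (homogenize 2 (card B) (nodal B) * f) = 0"
  shows "\<exists>\<mu>. \<forall>h\<in>forms n. m h = (\<Sum>p\<in>A \<times> B. \<mu> p * ev (pt p) h)"
proof (cases "A = {} \<or> B = {}")
  case True
  have "m h = 0" if "h \<in> forms n" for h
    using True mA[of h] mB[of h] that by (auto simp: nodal_def homogenize_def)
  then show ?thesis using True by auto
next
  case False
  define a b where "a = card A" and "b = card B"
  have ab: "0 < a" "0 < b" using False A B by (auto simp: a_def b_def card_gt_0_iff)
  define Z where "Z = n + 2 - a - b"
  \<comment> \<open>A form of degree n with value 1 at the grid point (x, y) and 0 at all other grid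
    points; the power \<open>Z\<close> of the third variable fills up the degree.\<close>
  define \<Lambda> where "\<Lambda> = (\<lambda>(x, y). (weight A x * weight B y) *\<^sub>R
    (homogenize 1 (a - 1) (nodal (A - {x})) * homogenize 2 (b - 1) (nodal (B - {y})) * Var 3 ^ Z))"
  define M where "M = (\<lambda>h. \<Sum>p\<in>A \<times> B. m (\<Lambda> p) * ev (pt p) h)"
  have linM: "linear M"
    unfolding M_def by (rule linearI) (simp_all add: algebra_simps sum.distrib sum_distrib_left)
  have MA: "M (homogenize 1 a (nodal A) * f) = 0" for f
    unfolding M_def using A by (intro sum.neutral ballI) (auto simp: ev_homogenize nodal_props a_def)
  have MB: "M (homogenize 2 b (nodal B) * f) = 0" for f
    unfolding M_def using B by (intro sum.neutral ballI) (auto simp: ev_homogenize nodal_props b_def)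
  have main: "m (Var 1 ^ i * Var 2 ^ j * Var 3 ^ k) = M (Var 1 ^ i * Var 2 ^ j * Var 3 ^ k)" if "i + j + k = n" for i j k
    using that
  \<comment> \<open>The measure is the degree in the first two variables: modulo a nodal form its
    leading power is traded for terms with more of the third variable.\<close>
  proof (induction "i + j" arbitrary: i j k rule: less_induct)
    case less
    have reduce: "m (homogenize v c p * f) = M (homogenize v c p * f) \<Longrightarrow>
      (\<And>l. l < c \<Longrightarrow> m (Var v ^ l * Var 3 ^ (c - l) * f) = M (Var v ^ l * Var 3 ^ (c - l) * f)) \<Longrightarrow>
      coeff p c = 1 \<Longrightarrow> m (Var v ^ c * f) = M (Var v ^ c * f)" for v c p f
      by (simp add: homogenize_lead distrib_right sum_distrib_right linear_add[OF m] linear_add[OF linM]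
          linear_sum[OF m] linear_sum[OF linM] linear_cmul[OF m] linear_cmul[OF linM])
    consider "a \<le> i" | "b \<le> j" | "i < a" "j < b" by linarith
    then show ?case
    proof cases
      case 1
      let ?f = "Var 1 ^ (i - a) * Var 2 ^ j * Var 3 ^ k"
      have f: "?f \<in> forms (n - a)"
        using forms_mult[OF forms_mult[OF Var_power_in_forms[of 1 "i - a"] Var_power_in_forms[of 2 j]] Var_power_in_forms[of 3 k]]
          1 less.prems by simp
      have "m (Var 1 ^ a * ?f) = M (Var 1 ^ a * ?f)"
      proof (rule reduce[where p = "nodal A"])
        show "m (homogenize 1 a (nodal A) * ?f) = M (homogenize 1 a (nodal A) * ?f)"
          using mA f MA by (simp add: a_def)
        show "coeff (nodal A) a = 1" using A by (simp_all add: nodal_props a_def)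
        fix l assume l: "l < a"
        have eq: "Var 1 ^ l * Var 3 ^ (a - l) * ?f = Var 1 ^ (i - a + l) * Var 2 ^ j * Var 3 ^ (k + (a - l))"
          by (simp add: power_add mult_ac)
        show "m (Var 1 ^ l * Var 3 ^ (a - l) * ?f) = M (Var 1 ^ l * Var 3 ^ (a - l) * ?f)"
          unfolding eq by (rule less.hyps) (use l 1 less.prems in auto)
      qed
      moreover have "Var 1 ^ a * ?f = Var 1 ^ i * Var 2 ^ j * Var 3 ^ k"
        using 1 by (simp flip: power_add mult.assoc)
      ultimately show ?thesis by simp
    next
      case 2
      let ?f = "Var 1 ^ i * Var 2 ^ (j - b) * Var 3 ^ k"
      have f: "?f \<in> forms (n - b)"
        using forms_mult[OF forms_mult[OF Var_power_in_forms[of 1 i] Var_power_in_forms[of 2 "j - b"]] Var_power_in_forms[of 3 k]]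
          2 less.prems by simp
      have "m (Var 2 ^ b * ?f) = M (Var 2 ^ b * ?f)"
      proof (rule reduce[where p = "nodal B"])
        show "m (homogenize 2 b (nodal B) * ?f) = M (homogenize 2 b (nodal B) * ?f)"
          using mB f MB by (simp add: b_def)
        show "coeff (nodal B) b = 1" using B by (simp_all add: nodal_props b_def)
        fix l assume l: "l < b"
        have eq: "Var 2 ^ l * Var 3 ^ (b - l) * ?f = Var 1 ^ i * Var 2 ^ (j - b + l) * Var 3 ^ (k + (b - l))"
          by (simp add: power_add mult_ac)
        show "m (Var 2 ^ l * Var 3 ^ (b - l) * ?f) = M (Var 2 ^ l * Var 3 ^ (b - l) * ?f)"
          unfolding eq by (rule less.hyps) (use l 2 less.prems in auto)
      qed
      moreover have "Var 2 ^ b * ?f = Var 1 ^ i * (Var 2 ^ b * Var 2 ^ (j - b)) * Var 3 ^ k"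
        by (simp add: mult_ac)
      then have "Var 2 ^ b * ?f = Var 1 ^ i * Var 2 ^ j * Var 3 ^ k"
        using 2 by (simp flip: power_add)
      ultimately show ?thesis by simp
    next
      case 3
      \<comment> \<open>Both exponents lie below the grid sizes, so Lagrange interpolation
        reproduces the monomial as a combination of the \<Lambda>.\<close>
      have X: "Var 1 ^ i * Var 3 ^ (a - 1 - i) = (\<Sum>x\<in>A. (x ^ i * weight A x) *\<^sub>R homogenize 1 (a - 1) (nodal (A - {x})))"
        using Lagrange_monom[OF A, of i] homogenize_monom[of i "a - 1" 1] 3 by (simp add: homogenize_sum a_def)
      have Y: "Var 2 ^ j * Var 3 ^ (b - 1 - j) = (\<Sum>y\<in>B. (y ^ j * weight B y) *\<^sub>R homogenize 2 (b - 1) (nodal (B - {y})))"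
        using Lagrange_monom[OF B, of j] homogenize_monom[of j "b - 1" 2] 3 by (simp add: homogenize_sum b_def)
      have "k = (a - 1 - i) + (b - 1 - j) + Z" using 3 less.prems n ab by (simp add: Z_def a_def b_def)
      then have "Var 1 ^ i * Var 2 ^ j * Var 3 ^ k = (Var 1 ^ i * Var 3 ^ (a - 1 - i)) * (Var 2 ^ j * Var 3 ^ (b - 1 - j)) * Var 3 ^ Z"
        by (simp only: power_add mult_ac)
      also have "\<dots> = (\<Sum>(x, y)\<in>A \<times> B. (x ^ i * y ^ j) *\<^sub>R \<Lambda> (x, y))"
        unfolding X Y unfolding sum_product unfolding sum.cartesian_product unfolding sum_distrib_right
        by (intro sum.cong) (auto simp: \<Lambda>_def mult_ac)
      finally have "m (Var 1 ^ i * Var 2 ^ j * Var 3 ^ k) = (\<Sum>(x, y)\<in>A \<times> B. (x ^ i * y ^ j) * m (\<Lambda> (x, y)))"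
        by (simp add: linear_sum[OF m] linear_cmul[OF m] case_prod_beta)
      also have "\<dots> = M (Var 1 ^ i * Var 2 ^ j * Var 3 ^ k)"
        unfolding M_def by (intro sum.cong) (auto simp: mult.commute)
      finally show ?thesis .
    qed
  qed
  have "m h = M h" if "h \<in> forms n" for h
  proof (rule forms_linear_eqI[OF m linM _ that])
    fix \<alpha> assume "deg \<alpha> = n"
    then show "m (mon \<alpha>) = M (mon \<alpha>)" unfolding mon_eq_Var_powers[of \<alpha>] by (intro main) (simp add: sum_3)
  qed
  then show ?thesis by (auto simp: M_def intro!: exI[of _ "\<lambda>p. m (\<Lambda> p)"])
qed

text \<open>Relations on the grid are the polynomial multipliers of degree e. Those supported off
  the curve vanish at the removed points, and \<open>unique\<close> leaves only multiples of h. The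
  conditions \<open>base\<close> and \<open>column\<close> serve the other requirement, that
  competing functionals involve no removed point: \<open>base\<close> separates a removed point from
  \<Gamma> by a form of degree d, and \<open>column\<close> leaves enough degree to cut away the
  other removed points.\<close>

theorem extreme_ray_of_grid_minus_curve:
  assumes A: "finite A" "card A \<le> d" and B: "finite B" "card B \<le> d"
    and e: "card A + card B = d + 3 + e" and h: "h \<in> bipoly e"
    and unique: "\<And>k. k \<in> bipoly e \<Longrightarrow> (\<And>x y. x \<in> A \<Longrightarrow> y \<in> B \<Longrightarrow> h x y = 0 \<Longrightarrow> k x y = 0)
      \<Longrightarrow> \<exists>c. \<forall>x\<in>A. \<forall>y\<in>B. k x y = c * h x y"
    and base: "\<And>k x0 y0. k \<in> bipoly e \<Longrightarrow> x0 \<in> A \<Longrightarrow> y0 \<in> B \<Longrightarrow> h x0 y0 = 0 \<Longrightarrow>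
      (\<And>x y. x \<in> A \<Longrightarrow> y \<in> B \<Longrightarrow> h x y = 0 \<Longrightarrow> (x, y) \<noteq> (x0, y0) \<Longrightarrow> k x y = 0) \<Longrightarrow> k x0 y0 = 0"
    and column: "\<And>x. x \<in> A \<Longrightarrow> card {y \<in> B. h x y = 0} + e + 1 \<le> card B"
    and r: "card {(x, y) \<in> A \<times> B. h x y \<noteq> 0} = r + 2" "1 \<le> r"
  shows "has_extreme_ray_of_rank d r"
proof -
  define \<Gamma> where "\<Gamma> = {(x, y) \<in> A \<times> B. h x y \<noteq> 0}"
  define \<Gamma>' where "\<Gamma>' = {(x, y) \<in> A \<times> B. h x y = 0}"
  define \<omega> where "\<omega> = (\<lambda>(x, y). weight A x * weight B y)"
  have fin: "finite (A \<times> B)" and union: "A \<times> B = \<Gamma> \<union> \<Gamma>'" "\<Gamma> \<inter> \<Gamma>' = {}"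
    using A B by (auto simp: \<Gamma>_def \<Gamma>'_def)
  then have "finite \<Gamma>" "finite \<Gamma>'" by auto
  note G = fin union this
  have \<omega>: "\<omega> p \<noteq> 0" for p using A B by (simp add: \<omega>_def case_prod_beta weight_ne_0)
  have converse: "\<exists>k\<in>bipoly e. \<forall>x\<in>A. \<forall>y\<in>B. v (x, y) = \<omega> (x, y) * k x y"
    if v: "\<And>f. f \<in> forms d \<Longrightarrow> (\<Sum>p\<in>A \<times> B. v p * ev (pt p) f) = 0" for v
  proof -
    have le: "card A + card B \<le> d + 3 + e" using e by simp
    from grid_relation_converse[OF A(1) B(1) le v]
    obtain k where "k \<in> bipoly e" "\<And>x y. x \<in> A \<Longrightarrow> y \<in> B \<Longrightarrow> v (x, y) = weight A x * weight B y * k x y"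
      by blast
    then show ?thesis by (auto simp: \<omega>_def)
  qed
  have zero_ext: "(\<Sum>p\<in>A \<times> B. (if p \<in> \<Gamma> then v p else 0) * F p) = (\<Sum>p\<in>\<Gamma>. v p * F p)" for v F :: "real \<times> real \<Rightarrow> real"
    using G by (intro sum.mono_neutral_cong_right) auto
  define u where "u = (\<lambda>p. \<omega> p * h (fst p) (snd p))"
  have "has_extreme_ray_of_rank d (card \<Gamma> - 2)"
  proof (rule extreme_ray_of_point_configuration[where \<Gamma> = \<Gamma> and P = pt and u = u])
    show "finite \<Gamma>" by (rule G)
    show "3 \<le> card \<Gamma>" using r by (simp add: \<Gamma>_def)
    show "u p \<noteq> 0" if "p \<in> \<Gamma>" for p using that \<omega> by (auto simp: u_def \<Gamma>_def)
    fix f assume f: "f \<in> forms d"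
    have "(\<lambda>x y. h x y * ev (pt (x, y)) f) \<in> bipoly (e + d)"
      using h f by (intro bipoly_mult) (auto intro: bipolyI)
    then have "(\<Sum>(x, y)\<in>A \<times> B. weight A x * weight B y * (h x y * ev (pt (x, y)) f)) = 0"
      by (intro grid_relation[OF A(1) B(1)]) (use e in auto)
    moreover have "(\<Sum>(x, y)\<in>A \<times> B. weight A x * weight B y * (h x y * ev (pt (x, y)) f)) = (\<Sum>p\<in>\<Gamma>. u p * ev (pt p) f)"
      using fin by (intro sum.mono_neutral_cong_right) (auto simp: \<Gamma>_def u_def \<omega>_def)
    ultimately show "(\<Sum>p\<in>\<Gamma>. u p * ev (pt p) f) = 0" by simp
  next
    fix v assume v: "\<And>f. f \<in> forms d \<Longrightarrow> (\<Sum>p\<in>\<Gamma>. v p * ev (pt p) f) = 0"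
    obtain k where k: "k \<in> bipoly e" "\<And>x y. x \<in> A \<Longrightarrow> y \<in> B \<Longrightarrow> (if (x, y) \<in> \<Gamma> then v (x, y) else 0) = \<omega> (x, y) * k x y"
      using converse[of "\<lambda>p. if p \<in> \<Gamma> then v p else 0"] v unfolding zero_ext by blast
    have "k x y = 0" if "x \<in> A" "y \<in> B" "h x y = 0" for x y
      using k(2)[OF that(1,2)] that \<omega>[of "(x, y)"] by (auto simp: \<Gamma>_def)
    then obtain c where "\<forall>x\<in>A. \<forall>y\<in>B. k x y = c * h x y" using unique[OF k(1)] by blast
    then have "\<forall>p\<in>\<Gamma>. v p = c * u p"
      using k(2) by (force simp: \<Gamma>_def u_def)
    then show "\<exists>c. \<forall>p\<in>\<Gamma>. v p = c * u p" by blast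
  next
    fix m :: "ternary \<Rightarrow> real"
    assume m: "linear m" and kill: "\<And>f g. f \<in> forms d \<Longrightarrow> (\<And>p. p \<in> \<Gamma> \<Longrightarrow> ev (pt p) f = 0) \<Longrightarrow> g \<in> forms d \<Longrightarrow> m (f * g) = 0"
    \<comment> \<open>A form vanishing on the grid is first multiplied up to degree d, where
      \<open>kill\<close> applies.\<close>
    have ideal: "m (F * f) = 0" if F: "F \<in> forms c" "c \<le> d" "\<And>p. p \<in> A \<times> B \<Longrightarrow> ev (pt p) F = 0" and f: "f \<in> forms (2 * d - c)" for F f c
    proof -
      have "f \<in> forms ((d - c) + d)" using f F(2) by (simp add: mult_2)
      then show ?thesis
      proof (induction rule: forms_add_induct)
        case (mult f g)
        have "F * f \<in> forms d" using forms_mult[OF F(1) mult(1)] F(2) by simp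
        then show ?case using kill[of "F * f" g] mult F(3) G by (simp add: mult.assoc)
      qed (simp_all add: linear_0[OF m] linear_add[OF m] linear_cmul[OF m] distrib_left)
    qed
    have "\<exists>\<mu>. \<forall>h\<in>forms (2 * d). m h = (\<Sum>p\<in>A \<times> B. \<mu> p * ev (pt p) h)"
    proof (rule functional_on_grid[OF A(1) B(1) _ _ _ m])
      show "card A + card B \<le> 2 * d + 2" "card A \<le> 2 * d" "card B \<le> 2 * d" using A B by auto
      show "m (homogenize 1 (card A) (nodal A) * f) = 0" if "f \<in> forms (2 * d - card A)" for f
        by (rule ideal[OF homogenize_in_forms A(2) _ that]) (use A in \<open>auto simp: ev_homogenize nodal_props\<close>)
      show "m (homogenize 2 (card B) (nodal B) * f) = 0" if "f \<in> forms (2 * d - card B)" for f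
        by (rule ideal[OF homogenize_in_forms B(2) _ that]) (use B in \<open>auto simp: ev_homogenize nodal_props\<close>)
    qed
    then obtain \<mu> where \<mu>: "\<And>h. h \<in> forms (2 * d) \<Longrightarrow> m h = (\<Sum>p\<in>A \<times> B. \<mu> p * ev (pt p) h)" by blast
    have \<mu>0: "\<mu> (x0, y0) = 0" if xy: "x0 \<in> A" "y0 \<in> B" "h x0 y0 = 0" for x0 y0
    proof -
      \<comment> \<open>Otherwise some relation has coefficient 1 at \<open>(x0, y0)\<close> and all
        its other support in \<Gamma>. Its multiplier vanishes at the other removed points, hence by
        \<open>base\<close> at \<open>(x0, y0)\<close> too.\<close>
      have "\<exists>q\<in>forms d. (\<forall>p\<in>\<Gamma>. ev (pt p) q = 0) \<and> ev (pt (x0, y0)) q \<noteq> 0"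
      proof (rule ccontr)
        assume "\<not> ?thesis"
        then have "\<exists>c. \<forall>f\<in>forms d. ev (pt (x0, y0)) f = (\<Sum>p\<in>\<Gamma>. c p * ev (pt p) f)"
          by (intro functional_in_span[OF G(4) subspace_forms linear_ev linear_ev]) blast
        then obtain c where c: "\<And>f. f \<in> forms d \<Longrightarrow> ev (pt (x0, y0)) f = (\<Sum>p\<in>\<Gamma>. c p * ev (pt p) f)" by blast
        define v where "v = (\<lambda>p. if p = (x0, y0) then 1 else if p \<in> \<Gamma> then - c p else 0)"
        have nin: "(x0, y0) \<notin> \<Gamma>" using xy by (simp add: \<Gamma>_def)
        have "(\<Sum>p\<in>A \<times> B. v p * ev (pt p) f) = 0" if "f \<in> forms d" for f
        proof -
          have "(\<Sum>p\<in>A \<times> B. v p * ev (pt p) f) = (\<Sum>p\<in>A \<times> B. (if p = (x0, y0) then ev (pt p) f else 0) - (if p \<in> \<Gamma> then c p else 0) * ev (pt p) f)"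
            using nin by (intro sum.cong) (auto simp: v_def)
          also have "\<dots> = 0"
            using xy G(1) c[OF that] unfolding sum_subtractf zero_ext by simp
          finally show ?thesis .
        qed
        from converse[OF this] obtain k where k: "k \<in> bipoly e" "\<And>x y. x \<in> A \<Longrightarrow> y \<in> B \<Longrightarrow> v (x, y) = \<omega> (x, y) * k x y"
          by blast
        have "k x0 y0 = 0"
        proof (rule base[OF k(1) xy])
          fix x y assume "x \<in> A" "y \<in> B" "h x y = 0" "(x, y) \<noteq> (x0, y0)"
          then show "k x y = 0" using k(2)[of x y] \<omega>[of "(x, y)"] by (auto simp: v_def \<Gamma>_def)
        qed
        then show False using k(2)[OF xy(1,2)] by (simp add: v_def)
      qed
      then obtain q where q: "q \<in> forms d" "\<And>p. p \<in> \<Gamma> \<Longrightarrow> ev (pt p) q = 0" "ev (pt (x0, y0)) q \<noteq> 0" by blast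
      \<comment> \<open>The other removed points in the column of \<open>x0\<close>. The lines
        through them and through the other columns number \<open>(card A - 1) + card Y\<close>,
        which \<open>column\<close> keeps at most d.\<close>
      define Y where "Y = {y \<in> B. h x0 y = 0} - {y0}"
      have Y: "finite Y" "card Y = card {y \<in> B. h x0 y = 0} - 1" using B xy by (auto simp: Y_def)
      have "0 < card {y \<in> B. h x0 y = 0}" using xy B by (auto simp: card_gt_0_iff)
      moreover have "0 < card A" using xy A by (auto simp: card_gt_0_iff)
      ultimately have deg: "(card A - 1) + card Y \<le> d" using column[OF xy(1)] e Y(2) by linarith
      define g where "g = homogenize 1 (card A - 1) (nodal (A - {x0})) * homogenize 2 (card Y) (nodal Y) * Var 3 ^ (d - (card A - 1) - card Y)"
      have g: "g \<in> forms d"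
        using forms_mult[OF forms_mult[OF homogenize_in_forms homogenize_in_forms] Var_power_in_forms] deg
        unfolding g_def by (metis diff_diff_left le_add_diff_inverse)
      have evg: "ev (pt (x, y)) g = (\<Prod>a\<in>A - {x0}. x - a) * (\<Prod>b\<in>Y. y - b)" for x y
        using A B xy Y by (simp add: g_def ev_homogenize nodal_props)
      \<comment> \<open>On the grid q vanishes on \<Gamma> and g at the other removed points, so
        this product tests the coefficient at \<open>(x0, y0)\<close> alone.\<close>
      have "m (q * g) = 0" by (rule kill[OF q(1,2) g])
      moreover have "m (q * g) = (\<Sum>p\<in>A \<times> B. \<mu> p * ev (pt p) (q * g))" by (rule \<mu>[OF forms_mult_double[OF q(1) g]])
      moreover have "\<dots> = (\<Sum>p\<in>A \<times> B. if p = (x0, y0) then \<mu> p * ev (pt p) (q * g) else 0)"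
      proof (intro sum.cong refl)
        fix p assume p: "p \<in> A \<times> B"
        show "\<mu> p * ev (pt p) (q * g) = (if p = (x0, y0) then \<mu> p * ev (pt p) (q * g) else 0)"
        proof (cases "p \<in> \<Gamma> \<or> p = (x0, y0)")
          case True
          then have "ev (pt p) q = 0 \<or> p = (x0, y0)" using q(2) by blast
          then show ?thesis by (cases "p = (x0, y0)") auto
        next
          case False
          then obtain x y where p': "p = (x, y)" "x \<in> A" "y \<in> B" "h x y = 0" "(x, y) \<noteq> (x0, y0)"
            using p by (auto simp: \<Gamma>_def)
          then have "x \<in> A - {x0} \<or> y \<in> Y" by (auto simp: Y_def)
          then have "ev (pt (x, y)) g = 0" using A Y by (auto simp: evg)
          then have "ev (pt p) g = 0" "p \<noteq> (x0, y0)" using p' by simp_all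
          then show ?thesis by simp
        qed
      qed
      ultimately have "\<mu> (x0, y0) * ev (pt (x0, y0)) (q * g) = 0" using xy G(1) by simp
      moreover have "ev (pt (x0, y0)) g \<noteq> 0" using A Y by (auto simp: evg Y_def)
      ultimately show ?thesis using q(3) by simp
    qed
    have "m h = (\<Sum>p\<in>\<Gamma>. \<mu> p * ev (pt p) h)" if "h \<in> forms (2 * d)" for h
      unfolding \<mu>[OF that] using fin \<mu>0 by (intro sum.mono_neutral_right) (auto simp: \<Gamma>_def)
    then show "\<exists>\<mu>. \<forall>h\<in>forms (2 * d). m h = (\<Sum>p\<in>\<Gamma>. \<mu> p * ev (pt p) h)" by blast
  qed
  then show ?thesis using r by (simp add: \<Gamma>_def)
qed

text \<open>Z is an explicit list so that the incidences of a concrete grid reduce to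
  simplification. The two conjuncts supply \<open>unique\<close> and \<open>base\<close>; the second
  says that any all-but-one of the points determine the last.\<close>

definition determined_by :: "nat \<Rightarrow> (real \<Rightarrow> real \<Rightarrow> real) \<Rightarrow> (real \<times> real) list \<Rightarrow> bool"
  where "determined_by e h Z \<longleftrightarrow> (\<forall>k\<in>bipoly e.
    ((\<forall>(x, y)\<in>set Z. k x y = 0) \<longrightarrow> (\<exists>c. \<forall>x y. k x y = c * h x y)) \<and>
    (\<forall>p\<in>set Z. (\<forall>q\<in>set Z. q \<noteq> p \<longrightarrow> k (fst q) (snd q) = 0) \<longrightarrow> k (fst p) (snd p) = 0))"

lemma extreme_ray_of_lists:
  assumes Z: "determined_by e h Z" "filter (\<lambda>(x, y). h x y = 0) (List.product as bs) = Z"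
    and h: "h \<in> bipoly e" and dist: "distinct as" "distinct bs"
    and le: "length as \<le> d" "length bs \<le> d" "length as + length bs = d + 3 + e"
    and column: "\<forall>x\<in>set as. length (filter (\<lambda>y. h x y = 0) bs) + e + 1 \<le> length bs"
    and r: "length as * length bs = length Z + (r + 2)" "1 \<le> r"
  shows "has_extreme_ray_of_rank d r"
proof (rule extreme_ray_of_grid_minus_curve[where A = "set as" and B = "set bs" and h = h and e = e])
  have setZ: "set Z = {(x, y) \<in> set as \<times> set bs. h x y = 0}" by (auto simp: Z(2)[symmetric])
  have "distinct Z" unfolding Z(2)[symmetric] using dist by (intro distinct_filter distinct_product)
  then have "card (set Z) = length Z" by (rule distinct_card)
  moreover have "{(x, y) \<in> set as \<times> set bs. h x y \<noteq> 0} = set as \<times> set bs - set Z" by (auto simp: setZ)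
  moreover have "set Z \<subseteq> set as \<times> set bs" by (auto simp: setZ)
  ultimately show "card {(x, y) \<in> set as \<times> set bs. h x y \<noteq> 0} = r + 2"
    using r(1) dist by (simp add: card_Diff_subset card_cartesian_product distinct_card)
  show "card {y \<in> set bs. h x y = 0} + e + 1 \<le> card (set bs)" if "x \<in> set as" for x
    using column that dist(2) distinct_card[of "filter (\<lambda>y. h x y = 0) bs"] by (simp add: distinct_card)
  fix k assume k: "k \<in> bipoly e"
  show "\<exists>c. \<forall>x\<in>set as. \<forall>y\<in>set bs. k x y = c * h x y"
    if "\<And>x y. x \<in> set as \<Longrightarrow> y \<in> set bs \<Longrightarrow> h x y = 0 \<Longrightarrow> k x y = 0"
  proof -
    have "\<forall>(x, y)\<in>set Z. k x y = 0" using that by (simp add: setZ case_prod_beta)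
    then show ?thesis using Z(1) k unfolding determined_by_def by blast
  qed
  fix x0 y0 assume 0: "x0 \<in> set as" "y0 \<in> set bs" "h x0 y0 = 0"
    "\<And>x y. x \<in> set as \<Longrightarrow> y \<in> set bs \<Longrightarrow> h x y = 0 \<Longrightarrow> (x, y) \<noteq> (x0, y0) \<Longrightarrow> k x y = 0"
  have base: "\<forall>p\<in>set Z. (\<forall>q\<in>set Z. q \<noteq> p \<longrightarrow> k (fst q) (snd q) = 0) \<longrightarrow> k (fst p) (snd p) = 0"
    using Z(1) k unfolding determined_by_def by blast
  have "(x0, y0) \<in> set Z" using 0(1-3) by (simp add: setZ)
  moreover have "k (fst q) (snd q) = 0" if "q \<in> set Z" "q \<noteq> (x0, y0)" for q
    using that 0(4)[of "fst q" "snd q"] by (simp add: setZ case_prod_beta)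
  ultimately show "k x0 y0 = 0" using bspec[OF base, of "(x0, y0)"] by simp
qed (use h le r(2) dist in \<open>simp_all add: distinct_card\<close>)

section \<open>The individual ranks\<close>

lemma poly_eq_sum_le:
  fixes p :: "real poly"
  assumes "degree p \<le> n" shows "poly p x = (\<Sum>i\<le>n. coeff p i * x ^ i)"
  unfolding poly_altdef using assms by (intro sum.mono_neutral_left) (auto simp: coeff_eq_0)

lemma bipoly_0_cases:
  assumes "k \<in> bipoly 0" obtains c where "\<And>x y. k x y = c"
proof -
  obtain f where f: "f \<in> forms 0" "\<And>x y. k x y = ev (pt (x, y)) f" using assms unfolding bipoly_def by blast
  then obtain c where "f = c *\<^sub>R 1" using forms_0 by blast
  then show ?thesis using that f by simp
qed

lemma bipoly_1_cases:
  assumes "k \<in> bipoly 1" obtains a b c where "\<forall>x y. k x y = a + b * x + c * y"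
proof -
  obtain l p where l: "l \<in> bipoly 0" "degree p \<le> Suc 0" "\<And>x y. k x y = x * l x y + poly p y"
    using bipoly_Suc_cases[of k 0] assms by auto
  obtain b where "\<And>x y. l x y = b" using bipoly_0_cases l(1) by blast
  then show ?thesis using that[of "coeff p 0" b "coeff p 1"] l(3) poly_eq_sum_le[OF l(2)] by (simp add: algebra_simps)
qed

lemma bipoly_2_cases:
  assumes "k \<in> bipoly 2" obtains a b c d e f where "\<forall>x y. k x y = a + b * x + c * y + d * x\<^sup>2 + e * (x * y) + f * y\<^sup>2"
proof -
  obtain l p where l: "l \<in> bipoly 1" "degree p \<le> 2" "\<And>x y. k x y = x * l x y + poly p y"
    using bipoly_Suc_cases[of k 1] assms by (auto simp: numeral_2_eq_2)
  obtain a b c where "\<forall>x y. l x y = a + b * x + c * y" using bipoly_1_cases l(1) by blast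
  then show ?thesis using that[of "coeff p 0" a "coeff p 1" b c "coeff p 2"] l(3) poly_eq_sum_le[OF l(2)]
    by (simp add: algebra_simps power2_eq_square numeral_2_eq_2)
qed

lemma bipoly_3_cases:
  assumes "k \<in> bipoly 3" obtains a b c d e f g h i j where
    "\<forall>x y. k x y = a + b * x + c * y + d * x\<^sup>2 + e * (x * y) + f * y\<^sup>2 + g * x ^ 3 + h * (x\<^sup>2 * y) + i * (x * y\<^sup>2) + j * y ^ 3"
proof -
  obtain l p where l: "l \<in> bipoly 2" "degree p \<le> 3" "\<And>x y. k x y = x * l x y + poly p y"
    using bipoly_Suc_cases[of k 2] assms by (auto simp: numeral_3_eq_3 numeral_2_eq_2)
  obtain a b c d e f where "\<forall>x y. l x y = a + b * x + c * y + d * x\<^sup>2 + e * (x * y) + f * y\<^sup>2"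
    using bipoly_2_cases l(1) by blast
  then show ?thesis using that[of "coeff p 0" a "coeff p 1" b c "coeff p 2" d e f "coeff p 3"] l(3) poly_eq_sum_le[OF l(2)]
    by (simp add: algebra_simps power2_eq_square numeral_2_eq_2 numeral_3_eq_3)
qed

lemma bipoly_line: "(\<lambda>x y. y - x - c) \<in> bipoly 1"
proof -
  have "(\<lambda>x y. y + ((-1) * x + (- c))) \<in> bipoly 1"
    by (intro bipoly_add bipoly_scale bipoly_x bipoly_y bipoly_const)
  then show ?thesis by (simp add: algebra_simps)
qed

lemma bipoly_one_line: "(\<lambda>x y. y - x) \<in> bipoly 1"
  using bipoly_line[of 0] by simp

lemma bipoly_two_lines: "(\<lambda>x y. (y - x) * (y - x - 1)) \<in> bipoly 2"
  using bipoly_mult[OF bipoly_one_line bipoly_line[of 1]] by (simp add: numeral_2_eq_2)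

lemma bipoly_three_lines: "(\<lambda>x y. (y - x) * (y - x - 1) * (y - x - 2)) \<in> bipoly 3"
  using bipoly_mult[OF bipoly_two_lines bipoly_line[of 2]] by simp

text \<open>Full grid: e = 0 and h = 1, nothing is removed, and the only multipliers are
  constants.\<close>

lemma extreme_ray_of_grid:
  assumes "1 \<le> a" "1 \<le> b" "a \<le> d" "b \<le> d" "a + b = d + 3" "a * b = r + 2" "1 \<le> r"
  shows "has_extreme_ray_of_rank d r"
proof (rule extreme_ray_of_lists[where as = "map real [0..<a]" and bs = "map real [0..<b]" and e = 0 and h = "\<lambda>_ _. 1" and Z = "[]"])
  show "determined_by 0 (\<lambda>_ _. 1) []"
    unfolding determined_by_def by (auto elim!: bipoly_0_cases)
qed (use assms in \<open>auto simp: bipoly_const distinct_map\<close>)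

text \<open>No coefficient of the relations \<open>rel\<close> below is zero, so a point of the list at which \<open>k\<close> does not
  vanish is never the only one.\<close>

lemma determined_by_one_line:
  "determined_by 1 (\<lambda>x y. y - x) [(0, 0), (1, 1), (2, 2)]"
  unfolding determined_by_def
proof (rule ballI, rule conjI)
  fix k assume "k \<in> bipoly 1"
  then obtain a b c where k: "\<forall>x y. k x y = a + b * x + c * y"
    by (rule bipoly_1_cases)
  have rel: "k 0 0 - 2 * k 1 1 + k 2 2 = 0"
    by (simp add: k)
  \<comment> \<open>The left-hand sides are the coefficients of k minus the multiple of h that
    cancels the pure power of y of top degree; they are interpolated from values at the listed
    points. The same pattern serves the other curves.\<close>
  have eqs: "a = k 0 0"
    "b + c = - k 0 0 + k 1 1"
    by (simp_all add: k field_simps)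
  show "(\<forall>(x, y)\<in>set [(0, 0), (1, 1), (2, 2)]. k x y = 0) \<longrightarrow> (\<exists>c. \<forall>x y. k x y = c * (y - x))"
  proof
    assume "\<forall>(x, y)\<in>set [(0, 0), (1, 1), (2, 2)]. k x y = 0"
    then have "a = 0" "b = - c"
      using eqs by simp_all
    then show "\<exists>c. \<forall>x y. k x y = c * (y - x)" by (intro exI[of _ c]) (simp add: k algebra_simps power2_eq_square power3_eq_cube)
  qed
  show "\<forall>p\<in>set [(0, 0), (1, 1), (2, 2)]. (\<forall>q\<in>set [(0, 0), (1, 1), (2, 2)]. q \<noteq> p \<longrightarrow> k (fst q) (snd q) = 0) \<longrightarrow> k (fst p) (snd p) = 0"
    using rel by simp
qed

text \<open>Three points on each line. The first five determine k up to a multiple of h, and the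
  sixth is tied to them by \<open>rel\<close>.\<close>

lemma determined_by_two_lines_6:
  "determined_by 2 (\<lambda>x y. (y - x) * (y - x - 1)) [(0, 0), (0, 1), (1, 1), (1, 2), (2, 2), (4, 5)]"
  unfolding determined_by_def
proof (rule ballI, rule conjI)
  fix k assume "k \<in> bipoly 2"
  then obtain a b c d e f where k: "\<forall>x y. k x y = a + b * x + c * y + d * x\<^sup>2 + e * (x * y) + f * y\<^sup>2"
    by (rule bipoly_2_cases)
  have rel: "- 6 * k 0 0 + 3 * k 0 1 + 12 * k 1 1 - 4 * k 1 2 - 6 * k 2 2 + k 4 5 = 0"
    by (simp add: k)
  have eqs: "a = k 0 0"
    "b - f = - 1 / 2 * k 0 0 - k 0 1 + 2 * k 1 1 - 1 / 2 * k 2 2"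
    "c + f = - k 0 0 + k 0 1"
    "d - f = - 1 / 2 * k 0 0 + k 0 1 - k 1 2 + 1 / 2 * k 2 2"
    "e + 2 * f = k 0 0 - k 0 1 - k 1 1 + k 1 2"
    by (simp_all add: k field_simps)
  show "(\<forall>(x, y)\<in>set [(0, 0), (0, 1), (1, 1), (1, 2), (2, 2), (4, 5)]. k x y = 0) \<longrightarrow> (\<exists>c. \<forall>x y. k x y = c * ((y - x) * (y - x - 1)))"
  proof
    assume "\<forall>(x, y)\<in>set [(0, 0), (0, 1), (1, 1), (1, 2), (2, 2), (4, 5)]. k x y = 0"
    then have "a = 0" "b = f" "c = - f" "d = f" "e = - 2 * f"
      using eqs by simp_all
    then show "\<exists>c. \<forall>x y. k x y = c * ((y - x) * (y - x - 1))" by (intro exI[of _ f]) (simp add: k algebra_simps power2_eq_square power3_eq_cube)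
  qed
  show "\<forall>p\<in>set [(0, 0), (0, 1), (1, 1), (1, 2), (2, 2), (4, 5)]. (\<forall>q\<in>set [(0, 0), (0, 1), (1, 1), (1, 2), (2, 2), (4, 5)]. q \<noteq> p \<longrightarrow> k (fst q) (snd q) = 0) \<longrightarrow> k (fst p) (snd p) = 0"
    using rel by simp
qed

text \<open>Four points on one line, three on the other. The points impose five conditions on
  conics, so there are two independent relations; \<open>rel\<close> is one without a zero
  coefficient.\<close>

lemma determined_by_two_lines_7:
  "determined_by 2 (\<lambda>x y. (y - x) * (y - x - 1)) [(0, 0), (0, 1), (1, 1), (1, 2), (2, 2), (2, 3), (3, 3)]"
  unfolding determined_by_def
proof (rule ballI, rule conjI)
  fix k assume "k \<in> bipoly 2"
  then obtain a b c d e f where k: "\<forall>x y. k x y = a + b * x + c * y + d * x\<^sup>2 + e * (x * y) + f * y\<^sup>2"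
    by (rule bipoly_2_cases)
  have rel: "3 * k 0 0 - k 0 1 - 8 * k 1 1 + 2 * k 1 2 + 7 * k 2 2 - k 2 3 - 2 * k 3 3 = 0"
    by (simp add: k)
  have eqs: "a = k 0 0"
    "b - f = - 1 / 2 * k 0 0 - k 0 1 + 2 * k 1 1 - 1 / 2 * k 2 2"
    "c + f = - k 0 0 + k 0 1"
    "d - f = - 1 / 2 * k 0 0 + k 0 1 - k 1 2 + 1 / 2 * k 2 2"
    "e + 2 * f = k 0 0 - k 0 1 - k 1 1 + k 1 2"
    by (simp_all add: k field_simps)
  show "(\<forall>(x, y)\<in>set [(0, 0), (0, 1), (1, 1), (1, 2), (2, 2), (2, 3), (3, 3)]. k x y = 0) \<longrightarrow> (\<exists>c. \<forall>x y. k x y = c * ((y - x) * (y - x - 1)))"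
  proof
    assume "\<forall>(x, y)\<in>set [(0, 0), (0, 1), (1, 1), (1, 2), (2, 2), (2, 3), (3, 3)]. k x y = 0"
    then have "a = 0" "b = f" "c = - f" "d = f" "e = - 2 * f"
      using eqs by simp_all
    then show "\<exists>c. \<forall>x y. k x y = c * ((y - x) * (y - x - 1))" by (intro exI[of _ f]) (simp add: k algebra_simps power2_eq_square power3_eq_cube)
  qed
  show "\<forall>p\<in>set [(0, 0), (0, 1), (1, 1), (1, 2), (2, 2), (2, 3), (3, 3)]. (\<forall>q\<in>set [(0, 0), (0, 1), (1, 1), (1, 2), (2, 2), (2, 3), (3, 3)]. q \<noteq> p \<longrightarrow> k (fst q) (snd q) = 0) \<longrightarrow> k (fst p) (snd p) = 0"
    using rel by simp
qed

text \<open>The points split as 4, 3, 3 over the lines. Modulo h a cubic has nine coefficients,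
  interpolated from the first nine points; \<open>rel\<close> ties the tenth to them.\<close>

lemma determined_by_three_lines_10:
  "determined_by 3 (\<lambda>x y. (y - x) * (y - x - 1) * (y - x - 2)) [(0, 0), (0, 1), (1, 1), (1, 3), (2, 3), (2, 4), (3, 3), (3, 4), (4, 4), (5, 7)]"
  unfolding determined_by_def
proof (rule ballI, rule conjI)
  fix k assume "k \<in> bipoly 3"
  then obtain a b c d e f g h i j where k: "\<forall>x y. k x y = a + b * x + c * y + d * x\<^sup>2 + e * (x * y) + f * y\<^sup>2 + g * x ^ 3 + h * (x\<^sup>2 * y) + i * (x * y\<^sup>2) + j * y ^ 3"
    by (rule bipoly_3_cases)
  have rel: "6 * k 0 0 - 4 * k 0 1 - 10 * k 1 1 + 3 * k 1 3 + 12 * k 2 3 - 4 * k 2 4 + 6 * k 3 3 - 8 * k 3 4 - 2 * k 4 4 + k 5 7 = 0"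
    by (simp add: k)
  have eqs: "a = k 0 0"
    "b + 2 * j = - 1 / 6 * k 0 0 - 5 / 3 * k 0 1 + 2 * k 1 1 + k 1 3 - k 2 3 - 1 / 2 * k 2 4 - 1 / 3 * k 3 3 + 2 / 3 * k 3 4"
    "c - 2 * j = - 17 / 12 * k 0 0 + 5 / 3 * k 0 1 - k 1 3 + k 2 3 + 1 / 2 * k 2 4 - 1 / 3 * k 3 3 - 2 / 3 * k 3 4 + 1 / 4 * k 4 4"
    "d + 3 * j = - 1 / 4 * k 0 0 + 1 / 2 * k 0 1 + 1 / 2 * k 1 3 - 5 / 2 * k 2 3 + 3 / 2 * k 3 3 + k 3 4 - 3 / 4 * k 4 4"
    "e - 6 * j = 1 / 2 * k 0 0 + 1 / 6 * k 0 1 - 7 / 6 * k 1 1 - 3 / 2 * k 1 3 + 7 / 2 * k 2 3 + 1 / 2 * k 2 4 - k 3 3 - 5 / 3 * k 3 4 + 2 / 3 * k 4 4"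
    "f + 3 * j = 5 / 12 * k 0 0 - 2 / 3 * k 0 1 + k 1 3 - k 2 3 - 1 / 2 * k 2 4 + 1 / 3 * k 3 3 + 2 / 3 * k 3 4 - 1 / 4 * k 4 4"
    "g + j = - 1 / 12 * k 0 0 + 1 / 6 * k 0 1 - 1 / 2 * k 1 3 + 1 / 2 * k 2 3 + 1 / 2 * k 2 4 - 1 / 6 * k 3 3 - 2 / 3 * k 3 4 + 1 / 4 * k 4 4"
    "h - 3 * j = 1 / 4 * k 0 0 - 1 / 2 * k 0 1 + k 1 3 - 1 / 2 * k 2 3 - k 2 4 + k 3 4 - 1 / 4 * k 4 4"
    "i + 3 * j = - 1 / 4 * k 0 0 + 1 / 3 * k 0 1 + 1 / 6 * k 1 1 - 1 / 2 * k 1 3 + 1 / 2 * k 2 4 - 1 / 3 * k 3 4 + 1 / 12 * k 4 4"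
    by (simp_all add: k field_simps)
  show "(\<forall>(x, y)\<in>set [(0, 0), (0, 1), (1, 1), (1, 3), (2, 3), (2, 4), (3, 3), (3, 4), (4, 4), (5, 7)]. k x y = 0) \<longrightarrow> (\<exists>c. \<forall>x y. k x y = c * ((y - x) * (y - x - 1) * (y - x - 2)))"
  proof
    assume "\<forall>(x, y)\<in>set [(0, 0), (0, 1), (1, 1), (1, 3), (2, 3), (2, 4), (3, 3), (3, 4), (4, 4), (5, 7)]. k x y = 0"
    then have "a = 0" "b = - 2 * j" "c = 2 * j" "d = - 3 * j" "e = 6 * j" "f = - 3 * j" "g = - j" "h = 3 * j" "i = - 3 * j"
      using eqs by simp_all
    then show "\<exists>c. \<forall>x y. k x y = c * ((y - x) * (y - x - 1) * (y - x - 2))" by (intro exI[of _ j]) (simp add: k algebra_simps power2_eq_square power3_eq_cube)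
  qed
  show "\<forall>p\<in>set [(0, 0), (0, 1), (1, 1), (1, 3), (2, 3), (2, 4), (3, 3), (3, 4), (4, 4), (5, 7)]. (\<forall>q\<in>set [(0, 0), (0, 1), (1, 1), (1, 3), (2, 3), (2, 4), (3, 3), (3, 4), (4, 4), (5, 7)]. q \<noteq> p \<longrightarrow> k (fst q) (snd q) = 0) \<longrightarrow> k (fst p) (snd p) = 0"
    using rel by simp
qed

text \<open>The points split as 4, 4, 3 over the lines, and again nine of them determine a cubic
  modulo h. Two independent relations remain, and \<open>rel\<close> combines them so that no
  coefficient is zero.\<close>

lemma determined_by_three_lines_11:
  "determined_by 3 (\<lambda>x y. (y - x) * (y - x - 1) * (y - x - 2)) [(0, 0), (0, 1), (1, 1), (1, 3), (2, 3), (2, 4), (3, 3), (3, 4), (4, 4), (4, 6), (5, 6)]"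
  unfolding determined_by_def
proof (rule ballI, rule conjI)
  fix k assume "k \<in> bipoly 3"
  then obtain a b c d e f g h i j where k: "\<forall>x y. k x y = a + b * x + c * y + d * x\<^sup>2 + e * (x * y) + f * y\<^sup>2 + g * x ^ 3 + h * (x\<^sup>2 * y) + i * (x * y\<^sup>2) + j * y ^ 3"
    by (rule bipoly_3_cases)
  have rel: "- 15 * k 0 0 + 8 * k 0 1 + 28 * k 1 1 - 4 * k 1 3 - 32 * k 2 3 + 6 * k 2 4 - 24 * k 3 3 + 28 * k 3 4 + 11 * k 4 4 - 2 * k 4 6 - 4 * k 5 6 = 0"
    by (simp add: k)
  have eqs: "a = k 0 0"
    "b + 2 * j = - 1 / 6 * k 0 0 - 5 / 3 * k 0 1 + 2 * k 1 1 + k 1 3 - k 2 3 - 1 / 2 * k 2 4 - 1 / 3 * k 3 3 + 2 / 3 * k 3 4"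
    "c - 2 * j = - 17 / 12 * k 0 0 + 5 / 3 * k 0 1 - k 1 3 + k 2 3 + 1 / 2 * k 2 4 - 1 / 3 * k 3 3 - 2 / 3 * k 3 4 + 1 / 4 * k 4 4"
    "d + 3 * j = - 1 / 4 * k 0 0 + 1 / 2 * k 0 1 + 1 / 2 * k 1 3 - 5 / 2 * k 2 3 + 3 / 2 * k 3 3 + k 3 4 - 3 / 4 * k 4 4"
    "e - 6 * j = 1 / 2 * k 0 0 + 1 / 6 * k 0 1 - 7 / 6 * k 1 1 - 3 / 2 * k 1 3 + 7 / 2 * k 2 3 + 1 / 2 * k 2 4 - k 3 3 - 5 / 3 * k 3 4 + 2 / 3 * k 4 4"
    "f + 3 * j = 5 / 12 * k 0 0 - 2 / 3 * k 0 1 + k 1 3 - k 2 3 - 1 / 2 * k 2 4 + 1 / 3 * k 3 3 + 2 / 3 * k 3 4 - 1 / 4 * k 4 4"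
    "g + j = - 1 / 12 * k 0 0 + 1 / 6 * k 0 1 - 1 / 2 * k 1 3 + 1 / 2 * k 2 3 + 1 / 2 * k 2 4 - 1 / 6 * k 3 3 - 2 / 3 * k 3 4 + 1 / 4 * k 4 4"
    "h - 3 * j = 1 / 4 * k 0 0 - 1 / 2 * k 0 1 + k 1 3 - 1 / 2 * k 2 3 - k 2 4 + k 3 4 - 1 / 4 * k 4 4"
    "i + 3 * j = - 1 / 4 * k 0 0 + 1 / 3 * k 0 1 + 1 / 6 * k 1 1 - 1 / 2 * k 1 3 + 1 / 2 * k 2 4 - 1 / 3 * k 3 4 + 1 / 12 * k 4 4"
    by (simp_all add: k field_simps)
  show "(\<forall>(x, y)\<in>set [(0, 0), (0, 1), (1, 1), (1, 3), (2, 3), (2, 4), (3, 3), (3, 4), (4, 4), (4, 6), (5, 6)]. k x y = 0) \<longrightarrow> (\<exists>c. \<forall>x y. k x y = c * ((y - x) * (y - x - 1) * (y - x - 2)))"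
  proof
    assume "\<forall>(x, y)\<in>set [(0, 0), (0, 1), (1, 1), (1, 3), (2, 3), (2, 4), (3, 3), (3, 4), (4, 4), (4, 6), (5, 6)]. k x y = 0"
    then have "a = 0" "b = - 2 * j" "c = 2 * j" "d = - 3 * j" "e = 6 * j" "f = - 3 * j" "g = - j" "h = 3 * j" "i = - 3 * j"
      using eqs by simp_all
    then show "\<exists>c. \<forall>x y. k x y = c * ((y - x) * (y - x - 1) * (y - x - 2))" by (intro exI[of _ j]) (simp add: k algebra_simps power2_eq_square power3_eq_cube)
  qed
  show "\<forall>p\<in>set [(0, 0), (0, 1), (1, 1), (1, 3), (2, 3), (2, 4), (3, 3), (3, 4), (4, 4), (4, 6), (5, 6)]. (\<forall>q\<in>set [(0, 0), (0, 1), (1, 1), (1, 3), (2, 3), (2, 4), (3, 3), (3, 4), (4, 4), (4, 6), (5, 6)]. q \<noteq> p \<longrightarrow> k (fst q) (snd q) = 0) \<longrightarrow> k (fst p) (snd p) = 0"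
    using rel by simp
qed

text \<open>Here and below the rank is the grid size minus the number of listed points minus 2, in
  this case 4 * 4 - 3 - 2. The second coordinates skip values so that exactly the listed grid points
  lie on the curve.\<close>

lemma extreme_ray_4_11: "has_extreme_ray_of_rank 4 11"
  by (rule extreme_ray_of_lists[OF determined_by_one_line _ bipoly_one_line, where as = "[0, 1, 2, 3]" and bs = "[0, 1, 2, 4]"])
    simp_all

lemma extreme_ray_5_15: "has_extreme_ray_of_rank 5 15"
  by (rule extreme_ray_of_lists[OF determined_by_one_line _ bipoly_one_line, where as = "[0, 1, 2, 3]" and bs = "[0, 1, 2, 4, 5]"])
    simp_all

lemma extreme_ray_6_19: "has_extreme_ray_of_rank 6 19"
  by (rule extreme_ray_of_lists[OF determined_by_one_line _ bipoly_one_line, where as = "[0, 1, 2, 3]" and bs = "[0, 1, 2, 4, 5, 6]"])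
    simp_all

lemma extreme_ray_6_20: "has_extreme_ray_of_rank 6 20"
  by (rule extreme_ray_of_lists[OF determined_by_one_line _ bipoly_one_line, where as = "[0, 1, 2, 3, 4]" and bs = "[0, 1, 2, 5, 6]"])
    simp_all

lemma extreme_ray_5_16: "has_extreme_ray_of_rank 5 16"
  by (rule extreme_ray_of_lists[OF determined_by_two_lines_7 _ bipoly_two_lines, where as = "[0, 1, 2, 3, 4]" and bs = "[0, 1, 2, 3, 7]"])
    simp_all

lemma extreme_ray_5_17: "has_extreme_ray_of_rank 5 17"
  by (rule extreme_ray_of_lists[OF determined_by_two_lines_6 _ bipoly_two_lines, where as = "[0, 1, 2, 3, 4]" and bs = "[0, 1, 2, 5, 7]"])
    simp_all

lemma extreme_ray_6_21: "has_extreme_ray_of_rank 6 21"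
  by (rule extreme_ray_of_lists[OF determined_by_two_lines_7 _ bipoly_two_lines, where as = "[0, 1, 2, 3, 4]" and bs = "[0, 1, 2, 3, 7, 9]"])
    simp_all

lemma extreme_ray_6_22: "has_extreme_ray_of_rank 6 22"
  by (rule extreme_ray_of_lists[OF determined_by_two_lines_6 _ bipoly_two_lines, where as = "[0, 1, 2, 3, 4]" and bs = "[0, 1, 2, 5, 7, 9]"])
    simp_all

lemma extreme_ray_6_23: "has_extreme_ray_of_rank 6 23"
  by (rule extreme_ray_of_lists[OF determined_by_three_lines_11 _ bipoly_three_lines, where as = "[0, 1, 2, 3, 4, 5]" and bs = "[0, 1, 3, 4, 6, 8]"])
    simp_all

lemma extreme_ray_6_24: "has_extreme_ray_of_rank 6 24"
  by (rule extreme_ray_of_lists[OF determined_by_three_lines_10 _ bipoly_three_lines, where as = "[0, 1, 2, 3, 4, 5]" and bs = "[0, 1, 3, 4, 7, 8]"])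
    simp_all

text \<open>Full grids with sizes adding up to d + 3. For d = 6 the admissible sizes are 3 by 6 and
  4 by 5 only, and their ranks jump from 16 to 18.\<close>

lemma extreme_ray_grids:
  "has_extreme_ray_of_rank 4 10" "has_extreme_ray_of_rank 5 13" "has_extreme_ray_of_rank 5 14"
  "has_extreme_ray_of_rank 6 16" "has_extreme_ray_of_rank 6 18"
  using extreme_ray_of_grid[of 3 4 4 10] extreme_ray_of_grid[of 3 5 5 13] extreme_ray_of_grid[of 4 4 5 14]
    extreme_ray_of_grid[of 3 6 6 16] extreme_ray_of_grid[of 4 5 6 18] by simp_all

section \<open>Sextics: no extreme ray of rank 17\<close>

text \<open>Serves twice: it bounds orthonormal systems, and it shows that a pencil of linear forms
  has finitely many exceptional parameters.\<close>

lemma orthonormal_independent: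
  assumes L: "linear L" and E: "\<And>e e'. e \<in> E \<Longrightarrow> e' \<in> E \<Longrightarrow> e \<noteq> e' \<Longrightarrow> L (e * e') = 0"
    "\<And>e. e \<in> E \<Longrightarrow> L (e * e) \<noteq> (0::real)"
  shows "independent (E :: ternary set)"
  unfolding independent_explicit_finite_subsets
proof (intro allI impI ballI)
  fix S u v assume S: "S \<subseteq> E" "finite S" "(\<Sum>w\<in>S. u w *\<^sub>R w) = 0" "v \<in> S"
  have "0 = L ((\<Sum>w\<in>S. u w *\<^sub>R w) * v)" unfolding S(3) by (simp add: linear_0[OF L])
  also have "\<dots> = (\<Sum>w\<in>S. u w * L (w * v))"
    by (simp add: sum_distrib_right linear_sum[OF L] linear_cmul[OF L])
  also have "\<dots> = (\<Sum>w\<in>S. if w = v then u v * L (v * v) else 0)"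
    using E(1) S by (intro sum.cong) auto
  also have "\<dots> = u v * L (v * v)" using S by simp
  finally show "u v = 0" using E(2) S by auto
qed

text \<open>E is an orthonormal system of maximal size. A remainder outside the radical has a square
  of positive value, and normalising it would enlarge E.\<close>

lemma psd_orthonormal_basis:
  assumes L: "psd_on d L"
  obtains E where "finite E" "E \<subseteq> forms d" "\<forall>e\<in>E. \<forall>e'\<in>E. L (e * e') = (if e = e' then 1 else 0)"
    "\<forall>f\<in>forms d. f - (\<Sum>e\<in>E. L (f * e) *\<^sub>R e) \<in> rad d L"
proof -
  have lin: "linear L" using L by (simp add: psd_on_def)
  define P where "P = (\<lambda>E. E \<subseteq> forms d \<and> (\<forall>e\<in>E. \<forall>e'\<in>E. L (e * e') = (if e = e' then 1 else 0)))"
  have bound: "finite E \<and> card E \<le> dim (forms d)" if "P E" for E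
  proof -
    have "independent E" using that lin unfolding P_def by (intro orthonormal_independent[of L]) auto
    then show ?thesis using that independent_card_le[OF fin_dim_forms] unfolding P_def by blast
  qed
  have "P {}" by (simp add: P_def)
  then obtain E where E: "P E" "\<And>E'. P E' \<Longrightarrow> card E' \<le> card E"
    using ex_has_greatest_nat[of P "{}" card "dim (forms d) + 1"] bound by (metis le_imp_less_Suc Suc_eq_plus1)
  have fin: "finite E" using bound E by blast
  have "f - (\<Sum>e\<in>E. L (f * e) *\<^sub>R e) \<in> rad d L" if f: "f \<in> forms d" for f
  proof (rule ccontr)
    define g where "g = f - (\<Sum>e\<in>E. L (f * e) *\<^sub>R e)"
    assume "f - (\<Sum>e\<in>E. L (f * e) *\<^sub>R e) \<notin> rad d L"
    then have nr: "g \<notin> rad d L" by (simp add: g_def)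
    have g: "g \<in> forms d" using f E(1) unfolding g_def P_def
      by (intro subspace_diff subspace_sum subspace_scale subspace_forms) auto
    have ge: "L (g * e') = 0" if e': "e' \<in> E" for e'
    proof -
      have "(\<Sum>e\<in>E. L (f * e) * L (e * e')) = (\<Sum>e\<in>E. if e = e' then L (f * e') else 0)"
        using E(1) e' unfolding P_def by (intro sum.cong) auto
      also have "\<dots> = L (f * e')" using fin e' by simp
      finally show ?thesis
        by (simp add: g_def left_diff_distrib sum_distrib_right linear_diff[OF lin] linear_sum[OF lin] linear_cmul[OF lin])
    qed
    have pos: "0 < L (g * g)" using nr g L rad_eq_psd[OF L] by (auto simp: psd_on_def less_le)
    define h where "h = (1 / sqrt (L (g * g))) *\<^sub>R g"
    have "L (h * h) = 1" using pos by (simp add: h_def linear_cmul[OF lin])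
    moreover have "L (h * e) = 0" "L (e * h) = 0" if "e \<in> E" for e
      using ge[OF that] by (simp_all add: h_def linear_cmul[OF lin] mult.commute[of e])
    moreover have "h \<notin> E" using calculation by force
    moreover have "h \<in> forms d" using g by (simp add: h_def subspace_scale subspace_forms)
    ultimately have "P (insert h E)" using E(1) unfolding P_def by auto
    then have "card (insert h E) \<le> card E" by (rule E(2))
    then show False using \<open>h \<notin> E\<close> fin by simp
  qed
  then show ?thesis using that[of E] fin E(1) unfolding P_def by blast
qed

text \<open>The quadratic form of m descends to the quotient by the radical, which is
  finite-dimensional and on which L is positive definite. The bound permits small perturbations of L
  by m.\<close>

lemma functional_bounded_by_psd:
  assumes L: "psd_on d L" and m: "linear m" "\<And>f g. f \<in> rad d L \<Longrightarrow> g \<in> forms d \<Longrightarrow> m (f * g) = 0"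
  obtains C where "0 \<le> C" "\<forall>f\<in>forms d. \<bar>m (f * f)\<bar> \<le> C * L (f * f)"
proof -
  have lin: "linear L" using L by (simp add: psd_on_def)
  obtain E where E: "finite E" "E \<subseteq> forms d" "\<forall>e\<in>E. \<forall>e'\<in>E. L (e * e') = (if e = e' then 1 else 0)"
    "\<forall>f\<in>forms d. f - (\<Sum>e\<in>E. L (f * e) *\<^sub>R e) \<in> rad d L" by (rule psd_orthonormal_basis[OF L])
  \<comment> \<open>A functional killing the products with the radical sees only the orthonormal
    coordinates \<open>L (f * e)\<close>.\<close>
  have expand: "k (f * f) = (\<Sum>e\<in>E. \<Sum>e'\<in>E. L (f * e) * L (f * e') * k (e * e'))"
    if k: "linear k" "\<And>f g. f \<in> rad d L \<Longrightarrow> g \<in> forms d \<Longrightarrow> k (f * g) = (0::real)" and f: "f \<in> forms d" for k f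
  proof -
    define s where "s = (\<Sum>e\<in>E. L (f * e) *\<^sub>R e)"
    have s: "s \<in> forms d" unfolding s_def using E(2)
      by (intro subspace_sum subspace_scale subspace_forms) auto
    have fs: "f - s \<in> rad d L" using E(4) f by (simp add: s_def)
    have "k (f * f) = k ((f - s) * f) + k ((f - s) * s) + k (s * s)"
      by (simp add: linear_add[OF k(1), symmetric] algebra_simps)
    also have "\<dots> = k (s * s)" using k(2) fs f s by simp
    also have "s * s = (\<Sum>e\<in>E. \<Sum>e'\<in>E. (L (f * e) * L (f * e')) *\<^sub>R (e * e'))"
      by (simp add: s_def sum_product mult.commute)
    finally show ?thesis by (simp add: linear_sum[OF k(1)] linear_cmul[OF k(1)])
  qed
  define C where "C = (\<Sum>e\<in>E. \<Sum>e'\<in>E. \<bar>m (e * e')\<bar>)"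
  have "\<bar>m (f * f)\<bar> \<le> C * L (f * f)" if f: "f \<in> forms d" for f
  proof -
    have "L (f * f) = (\<Sum>e\<in>E. \<Sum>e'\<in>E. L (f * e) * L (f * e') * L (e * e'))"
      by (rule expand[OF lin _ f]) (simp add: rad_def)
    also have "\<dots> = (\<Sum>e\<in>E. \<Sum>e'\<in>E. if e' = e then (L (f * e))\<^sup>2 else 0)"
      using E(3) by (intro sum.cong) (auto simp: power2_eq_square)
    finally have Lff: "L (f * f) = (\<Sum>e\<in>E. (L (f * e))\<^sup>2)" using E(1) by simp
    have le: "\<bar>L (f * e)\<bar> \<le> sqrt (L (f * f))" if "e \<in> E" for e
      unfolding Lff using member_le_sum[OF that, of "\<lambda>e. (L (f * e))\<^sup>2"] E(1) by (intro real_le_rsqrt) simp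
    have "\<bar>m (f * f)\<bar> = \<bar>\<Sum>e\<in>E. \<Sum>e'\<in>E. L (f * e) * L (f * e') * m (e * e')\<bar>"
      using expand[OF m f] by simp
    also have "\<dots> \<le> (\<Sum>e\<in>E. \<Sum>e'\<in>E. \<bar>L (f * e) * L (f * e') * m (e * e')\<bar>)"
      by (rule order_trans[OF sum_abs]) (intro sum_mono sum_abs)
    also have "\<dots> \<le> (\<Sum>e\<in>E. \<Sum>e'\<in>E. L (f * f) * \<bar>m (e * e')\<bar>)"
    proof (intro sum_mono)
      fix e e' assume e: "e \<in> E" "e' \<in> E"
      have "0 \<le> L (f * f)" using L f by (auto simp: psd_on_def)
      then have "\<bar>L (f * e)\<bar> * \<bar>L (f * e')\<bar> \<le> L (f * f)"
        using mult_mono[OF le[OF e(1)] le[OF e(2)]] by simp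
      then show "\<bar>L (f * e) * L (f * e') * m (e * e')\<bar> \<le> L (f * f) * \<bar>m (e * e')\<bar>"
        unfolding abs_mult by (intro mult_right_mono) auto
    qed
    finally show ?thesis by (simp add: C_def sum_distrib_left sum_distrib_right mult.commute)
  qed
  moreover have "0 \<le> C" by (simp add: C_def sum_nonneg)
  ultimately show ?thesis using that by blast
qed

text \<open>Converse of \<open>has_extreme_rayI\<close>: for small \<epsilon> both perturbations of
  L by \<epsilon> m stay in the cone, and L is their midpoint, so the face property puts them on the
  ray.\<close>

lemma extreme_ray_unique:
  assumes face: "ray (restrict_to (forms (2 * d)) L) face_of sos_dual d" and L: "psd_on d L"
    and m: "linear m" "\<And>f g. f \<in> rad d L \<Longrightarrow> g \<in> forms d \<Longrightarrow> m (f * g) = 0"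
  shows "\<exists>c. \<forall>h\<in>forms (2 * d). m h = c * L h"
proof -
  have lin: "linear L" using L by (simp add: psd_on_def)
  let ?l = "restrict_to (forms (2 * d)) L"
  obtain C where C: "0 \<le> C" "\<forall>f\<in>forms d. \<bar>m (f * f)\<bar> \<le> C * L (f * f)"
    using functional_bounded_by_psd[OF L m] by blast
  define \<epsilon> where "\<epsilon> = 1 / (C + 1)"
  have \<epsilon>: "0 < \<epsilon>" "\<epsilon> * C \<le> 1" using C(1) by (simp_all add: \<epsilon>_def field_simps)
  have psd': "psd_on d (\<lambda>h. L h + s * m h)" if s: "\<bar>s\<bar> = \<epsilon>" for s
    unfolding psd_on_def
  proof (intro conjI ballI)
    show "linear (\<lambda>h. L h + s * m h)"
      by (rule linearI) (simp_all add: linear_add[OF lin] linear_add[OF m(1)] linear_cmul[OF lin] linear_cmul[OF m(1)] algebra_simps)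
    fix f assume f: "f \<in> forms d"
    have "0 \<le> L (f * f)" using L f by (auto simp: psd_on_def)
    have "\<bar>s * m (f * f)\<bar> \<le> \<epsilon> * (C * L (f * f))"
      unfolding abs_mult s using C(2) f \<epsilon> by (intro mult_left_mono) auto
    also have "\<dots> \<le> 1 * L (f * f)"
      unfolding mult.assoc[symmetric] using \<epsilon> \<open>0 \<le> L (f * f)\<close> by (intro mult_right_mono) auto
    finally show "0 \<le> L (f * f) + s * m (f * f)" by linarith
  qed
  have psd: "psd_on d (\<lambda>h. L h + \<epsilon> * m h)" "psd_on d (\<lambda>h. L h + (- \<epsilon>) * m h)"
    using psd'[of \<epsilon>] psd'[of "- \<epsilon>"] \<epsilon> by simp_all
  define a where "a = restrict_to (forms (2 * d)) (\<lambda>h. L h + \<epsilon> * m h)"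
  define b where "b = restrict_to (forms (2 * d)) (\<lambda>h. L h + (- \<epsilon>) * m h)"
  have ab: "a \<in> sos_dual d" "b \<in> sos_dual d"
    unfolding a_def b_def using psd restrict_to_in_sos_dual_iff by (auto simp: psd_on_def)
  have mid: "?l = (1 - 1 / 2) *\<^sub>R a + (1 / 2) *\<^sub>R b"
    by (auto simp: a_def b_def restrict_to_def scaleR_fun_def fun_eq_iff field_simps)
  show ?thesis
  proof (cases "a = b")
    case True
    have "m h = 0 * L h" if "h \<in> forms (2 * d)" for h
    proof -
      have "a h = b h" using True by simp
      then show ?thesis using that \<epsilon> by (simp add: a_def b_def restrict_to_def)
    qed
    then show ?thesis by blast
  next
    case False
    then have "?l \<in> open_segment a b" using mid by (auto simp: in_segment intro!: exI[of _ "1/2"])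
    moreover have "?l \<in> ray ?l" by (auto simp: ray_def intro!: exI[of _ 1])
    ultimately have "a \<in> ray ?l" using face ab unfolding face_of_def by blast
    then obtain c where c: "a = c *\<^sub>R ?l" by (auto simp: ray_def)
    have "m h = ((c - 1) / \<epsilon>) * L h" if "h \<in> forms (2 * d)" for h
    proof -
      have "a h = (c *\<^sub>R ?l) h" using c by simp
      then have "L h + \<epsilon> * m h = c * L h" using that by (simp add: a_def restrict_to_def scaleR_fun_def)
      then show ?thesis using \<epsilon> by (simp add: field_simps)
    qed
    then show ?thesis by blast
  qed
qed

section \<open>Codimension one and pairs of linear forms\<close>

lemma dim_span_insert_le: "fin_dim V \<Longrightarrow> dim (span (insert h V)) \<le> dim V + 1"
proof -
  assume "fin_dim V"
  then obtain B where B: "B \<subseteq> V" "finite B" "independent B" "V \<subseteq> span B" "card B = dim V" by (rule fin_dim_basis)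
  have "insert h V \<subseteq> span (insert h B)"
    using B(4) span_mono[of B "insert h B"] span_base[of h "insert h B"] by blast
  then have "dim (span (insert h V)) \<le> card (insert h B)"
    using B(2) by (simp add: dim_le_card)
  also have "\<dots> \<le> dim V + 1" using B by (metis Suc_eq_plus1 card_insert_le_m1 card_insert_if le_SucI order_refl)
  finally show ?thesis .
qed

lemma codim_le_1:
  assumes J: "subspace J" "J \<subseteq> forms n" and h: "h \<in> forms n"
    and sep: "\<And>m :: ternary \<Rightarrow> real. linear m \<Longrightarrow> (\<And>f. f \<in> J \<Longrightarrow> m f = 0) \<Longrightarrow> m h = 0 \<Longrightarrow> (\<And>f. f \<in> forms n \<Longrightarrow> m f = 0)"
  shows "dim (forms n) \<le> dim J + 1"
proof -
  have "forms n \<subseteq> span (insert h J)"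
  proof (rule ccontr)
    assume "\<not> ?thesis"
    then obtain g where g: "g \<in> forms n" "g \<notin> span (insert h J)" by blast
    obtain m where "linear m" "m g = 1" "\<forall>v\<in>span (insert h J). m v = (0::real)"
      by (rule functional_separating[OF subspace_span g(2)])
    then have "m g = 0" using sep[OF _ _ _ g(1), of m] by (simp add: span_base)
    then show False using \<open>m g = 1\<close> by simp
  qed
  moreover have "fin_dim (span (insert h J))"
    by (rule fin_dim_subset[OF fin_dim_forms[of n] span_minimal[OF _ subspace_forms]]) (use J h in auto)
  ultimately have "dim (forms n) \<le> dim (span (insert h J))" by (rule dim_mono_fin_dim[rotated])
  also have "\<dots> \<le> dim J + 1" by (rule dim_span_insert_le[OF fin_dim_subset[OF fin_dim_forms J(2)]])
  finally show ?thesis .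
qed

lemma dim_forms_double: "2 * dim (forms k) = (k + 1) * (k + 2)"
  by (simp add: dim_forms)

text \<open>Takes the place of unique factorisation. By
  \<open>functional_killed_by_two_linear_forms\<close> the map sending (f, g) to u f - v g has an
  image of codimension at most 1, so its kernel has at most the dimension of \<open>forms k\<close>;
  the Koszul syzygies (v c, u c) fill it.\<close>

lemma linear_forms_ratio:
  assumes u: "u \<in> forms 1" and v: "v \<in> forms 1"
    and indep: "\<And>s t. s *\<^sub>R u + t *\<^sub>R v = 0 \<Longrightarrow> s = 0 \<and> t = 0"
    and f: "f \<in> forms (Suc k)" and g: "g \<in> forms (Suc k)" and eq: "u * f = v * g"
  obtains c where "c \<in> forms k" "f = v * c" "g = u * c"
proof -
  obtain q where q: "q \<noteq> (\<lambda>_. 0)" "ev q u = 0" "ev q v = 0"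
    "\<forall>m k. linear m \<longrightarrow> (\<forall>f\<in>forms k. m (u * f) = 0 \<and> m (v * f) = 0)
      \<longrightarrow> (\<exists>c. \<forall>f\<in>forms (Suc k). m f = c * ev q f)"
    by (rule functional_killed_by_two_linear_forms[OF u v indep]) assumption+
  define \<Psi> where "\<Psi> = (\<lambda>(f, g). u * f - v * g)"
  have lin: "linear \<Psi>" unfolding \<Psi>_def
    by (rule linearI) (auto simp: algebra_simps)
  let ?V = "forms (Suc k) \<times> forms (Suc k)"
  have V: "subspace ?V" "fin_dim ?V" "dim ?V = 2 * dim (forms (Suc k))"
    by (simp_all add: subspace_Times_real subspace_forms fin_dim_Times dim_Times_fin_dim)
  obtain i where i: "q i \<noteq> 0" using q(1) by auto
  have mem: "u * f \<in> forms (Suc (Suc k))" "v * f \<in> forms (Suc (Suc k))" if "f \<in> forms (Suc k)" for f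
    using forms_mult[OF u that] forms_mult[OF v that] by simp_all
  have "dim (forms (Suc (Suc k))) \<le> dim (\<Psi> ` ?V) + 1"
  proof (rule codim_le_1)
    show "subspace (\<Psi> ` ?V)" using lin V(1) by (rule linear_subspace_image)
    show "\<Psi> ` ?V \<subseteq> forms (Suc (Suc k))"
      using mem by (auto simp: \<Psi>_def intro!: subspace_diff[OF subspace_forms])
    show h: "Var i ^ Suc (Suc k) \<in> forms (Suc (Suc k))" by (rule Var_power_in_forms)
    fix m :: "ternary \<Rightarrow> real" and f
    assume m: "linear m" "\<And>f. f \<in> \<Psi> ` ?V \<Longrightarrow> m f = 0" "m (Var i ^ Suc (Suc k)) = 0" and f: "f \<in> forms (Suc (Suc k))"
    have "m (u * f) = 0 \<and> m (v * f) = 0" if "f \<in> forms (Suc k)" for f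
    proof -
      have 0: "(0::ternary) \<in> forms (Suc k)" by (simp add: subspace_0 subspace_forms)
      have "u * f = \<Psi> (f, 0)" "v * f = \<Psi> (0, - f)" "- f \<in> forms (Suc k)"
        using that by (simp_all add: \<Psi>_def subspace_neg subspace_forms)
      then show ?thesis using m(2) that 0 by blast
    qed
    then obtain c where c: "\<forall>f\<in>forms (Suc (Suc k)). m f = c * ev q f" using q(4) m(1) by blast
    then have "c * q i ^ Suc (Suc k) = 0" using bspec[OF c h] m(3) by (simp del: power_Suc)
    then have "c = 0" using i by simp
    then show "m f = 0" using c f by simp
  qed
  then have "dim {x \<in> ?V. \<Psi> x = 0} \<le> dim (forms k)"
    using rank_nullity[OF lin V(1,2)] V(3) dim_forms_double[of k] dim_forms_double[of "Suc k"]
      dim_forms_double[of "Suc (Suc k)"] by (simp add: algebra_simps)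
  moreover define \<Theta> where "\<Theta> = (\<lambda>c. (v * c, u * c))"
  have lin': "linear \<Theta>" unfolding \<Theta>_def by (rule linearI) (auto simp: algebra_simps)
  have "v \<noteq> 0" using indep[of 0 1] by auto
  then have "dim (\<Theta> ` forms k) = dim (forms k)"
    by (intro dim_image_inj[OF lin' subspace_forms fin_dim_forms]) (auto simp: \<Theta>_def zero_prod_def)
  moreover have "\<Theta> ` forms k \<subseteq> {x \<in> ?V. \<Psi> x = 0}"
    using forms_mult[OF u] forms_mult[OF v] by (auto simp: \<Theta>_def \<Psi>_def mult.left_commute)
  ultimately have "\<Theta> ` forms k = {x \<in> ?V. \<Psi> x = 0}"
    using lin' by (intro subspace_eq_of_dim_le[OF fin_dim_subset[OF V(2)] linear_subspace_image[OF lin' subspace_forms]]) auto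
  moreover have "(f, g) \<in> {x \<in> ?V. \<Psi> x = 0}" using f g eq by (simp add: \<Psi>_def)
  ultimately show ?thesis using that by (auto simp: \<Theta>_def)
qed

lemma codim_1_decompose:
  assumes N: "subspace N" "N \<subseteq> V" and V: "subspace V" "fin_dim V" "dim V \<le> dim N + 1"
  obtains g where "g \<in> V" "\<forall>v\<in>V. \<exists>n\<in>N. \<exists>t. v = n + t *\<^sub>R g"
proof (cases "V \<subseteq> N")
  case True
  then show ?thesis using that[of 0] V subspace_0 by (auto intro!: exI[of _ 0])
next
  case False
  then obtain g where g: "g \<in> V" "g \<notin> N" by blast
  obtain B where B: "B \<subseteq> N" "finite B" "independent B" "N \<subseteq> span B" "card B = dim N"
    by (rule fin_dim_basis[OF fin_dim_subset[OF V(2) N(2)]])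
  have spanB: "span B = N" using B N(1) by (metis span_minimal subset_antisym)
  then have ind: "independent (insert g B)" "g \<notin> B" using g B independent_insertI by auto
  have "dim (span (insert g B)) = dim N + 1"
    using ind B by (simp add: dim_span_eq_card_independent dim_eq_card_independent)
  moreover have "span (insert g B) \<subseteq> V" by (rule span_minimal[OF _ V(1)]) (use g B N in auto)
  ultimately have "span (insert g B) = V"
    using V by (intro subspace_eq_of_dim_le[OF V(2) subspace_span]) auto
  then have "\<forall>v\<in>V. \<exists>n\<in>N. \<exists>t. v = n + t *\<^sub>R g"
    using spanB by (auto simp: span_breakdown_eq) (metis diff_add_cancel)
  then show ?thesis using that g by blast
qed

section \<open>The apolar ideal of an extreme functional of rank 17\<close>

locale extreme_sextic =
  fixes L :: "ternary \<Rightarrow> real"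
  assumes psd: "psd_on 6 L"
    and unique: "\<And>m. linear m \<Longrightarrow> (\<And>f g. f \<in> rad 6 L \<Longrightarrow> g \<in> forms 6 \<Longrightarrow> m (f * g) = 0) \<Longrightarrow> \<exists>c. \<forall>h\<in>forms 12. m h = c * L h"
    and dim_rad: "dim (rad 6 L) = 11"
begin

lemma lin: "linear L" using psd by (simp add: psd_on_def)

text \<open>Graded pieces of the apolar ideal. Subtraction is truncated, so only the degrees k \<le>
  12 carry this meaning.\<close>

definition I :: "nat \<Rightarrow> ternary set"
  where "I k = {p \<in> forms k. \<forall>q\<in>forms (12 - k). L (p * q) = 0}"

lemma I_6: "I 6 = rad 6 L"
  by (simp add: I_def rad_def)

lemma I_subset: "I k \<subseteq> forms k"
  by (auto simp: I_def)

lemma subspace_I: "subspace (I k)"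
  unfolding I_def using subspace_forms[of k]
  by (auto simp: subspace_def distrib_right linear_add[OF lin] linear_cmul[OF lin] linear_0[OF lin])

lemma fin_dim_I: "fin_dim (I k)"
  by (rule fin_dim_subset[OF fin_dim_forms I_subset])

lemma I_mult:
  assumes "p \<in> I k" "q \<in> forms j" "k + j \<le> 12" shows "p * q \<in> I (k + j)" "q * p \<in> I (k + j)"
proof -
  have "L (p * q * r) = 0" if "r \<in> forms (12 - (k + j))" for r
  proof -
    have "q * r \<in> forms (12 - k)" using forms_mult[OF assms(2) that] assms(3) by simp
    then show ?thesis using assms(1) by (simp add: I_def mult.assoc)
  qed
  then show "p * q \<in> I (k + j)" using assms forms_mult by (auto simp: I_def)
  then show "q * p \<in> I (k + j)" by (simp add: mult.commute)
qed

text \<open>The quotient by an apolar ideal is Gorenstein: below degree 12 nothing nonzero is killed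
  by all variables, because every form of positive degree is a combination of multiples of the
  variables.\<close>

lemma I_Var_imp:
  assumes p: "p \<in> forms k" "k < 12" "\<And>i. Var i * p \<in> I (Suc k)" shows "p \<in> I k"
proof -
  have "L (p * q) = 0" if q: "q \<in> forms (12 - k)" for q
  proof -
    have "q \<in> forms (Suc (12 - Suc k))" using q p(2) by (metis Suc_diff_Suc)
    from forms_Suc[OF this] obtain g where g: "\<And>i. g i \<in> forms (12 - Suc k)" "q = (\<Sum>i\<in>UNIV. Var i * g i)" by blast
    have "L (Var i * p * g i) = 0" for i using p(3)[of i] g(1) by (simp add: I_def)
    then have "L (\<Sum>i\<in>UNIV. Var i * p * g i) = 0" by (simp add: linear_sum[OF lin])
    moreover have "p * q = (\<Sum>i\<in>UNIV. Var i * p * g i)" by (simp add: g(2) sum_distrib_left mult.left_commute mult.commute)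
    ultimately show ?thesis by simp
  qed
  then show ?thesis using p by (simp add: I_def)
qed

lemma I_mult_imp:
  assumes p: "p \<in> forms k" "k + n \<le> 12" and "\<And>q. q \<in> forms n \<Longrightarrow> p * q \<in> I (k + n)" shows "p \<in> I k"
proof -
  have "L (p * r) = 0" if r: "r \<in> forms (12 - k)" for r
  proof -
    have "r \<in> forms (n + (12 - (k + n)))" using r p(2) by simp
    then show ?thesis
    proof (induction rule: forms_add_induct)
      case (mult f g)
      then show ?case using assms(3)[of f] by (simp add: I_def mult.assoc)
    qed (simp_all add: distrib_left linear_add[OF lin] linear_cmul[OF lin] linear_0[OF lin])
  qed
  then show ?thesis using p by (simp add: I_def)
qed

lemma L_nonzero: obtains h0 where "h0 \<in> forms 12" "L h0 \<noteq> 0"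
proof (rule ccontr)
  assume "\<not> thesis"
  then have "\<And>h. h \<in> forms 12 \<Longrightarrow> L h = 0" using that by blast
  then have "rad 6 L = forms 6" using forms_mult_double[of _ 6] by (auto simp: rad_def)
  then show False using dim_rad by (simp add: dim_forms)
qed

text \<open>Extremality read dually: a functional vanishing on J is a multiple of L, so J has
  codimension at most 1 in the 91 dimensions of degree 12. Allowing any J that contains the products
  lets it be the image of a convenient parametrisation.\<close>

lemma dim_ideal_ge:
  assumes J: "subspace J" "J \<subseteq> forms 12" and WJ: "\<And>f g. f \<in> rad 6 L \<Longrightarrow> g \<in> forms 6 \<Longrightarrow> f * g \<in> J"
  shows "90 \<le> dim J"
proof -
  obtain h0 where h0: "h0 \<in> forms 12" "L h0 \<noteq> 0" by (rule L_nonzero)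
  have "dim (forms 12) \<le> dim J + 1"
  proof (rule codim_le_1[OF J h0(1)])
    fix m :: "ternary \<Rightarrow> real" and f
    assume m: "linear m" "\<And>f. f \<in> J \<Longrightarrow> m f = 0" "m h0 = 0" and f: "f \<in> forms 12"
    obtain c where c: "\<forall>h\<in>forms 12. m h = c * L h" using unique[OF m(1)] m(2) WJ by blast
    then have "c = 0" using h0 m(3) by auto
    then show "m f = 0" using c f by simp
  qed
  then show ?thesis by (simp add: dim_forms)
qed

text \<open>Evaluation at a base point kills all products of W with sextics and is thus a nonzero
  multiple of L. Then the radical contains all sextics vanishing there, at least 27 dimensions
  instead of 11.\<close>

lemma no_base_point:
  assumes q: "q \<noteq> (\<lambda>_. 0)" and W: "\<And>w. w \<in> rad 6 L \<Longrightarrow> ev q w = 0"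
  shows False
proof -
  obtain i where i: "q i \<noteq> 0" using q by auto
  obtain c where c: "\<forall>h\<in>forms 12. ev q h = c * L h" using unique[OF linear_ev, of q] W by auto
  have "ev q (Var i ^ 12) \<noteq> 0" using i by simp
  then have c0: "c \<noteq> 0" using c Var_power_in_forms[of i 12] by force
  let ?K = "{f \<in> forms 6. ev q f = 0}"
  have "?K \<subseteq> rad 6 L"
  proof
    fix f assume f: "f \<in> ?K"
    have "L (f * g) = 0" if "g \<in> forms 6" for g
    proof -
      have "f * g \<in> forms 12" using forms_mult_double[of f 6 g] f that by simp
      then have "c * L (f * g) = 0" using c f by force
      then show ?thesis using c0 by simp
    qed
    then show "f \<in> rad 6 L" using f by (simp add: rad_def)
  qed
  then have "dim ?K \<le> 11" using dim_mono_fin_dim[OF fin_dim_subset[OF fin_dim_forms rad_subset]] dim_rad by metis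
  moreover have "dim (ev q ` forms 6) \<le> dim (UNIV :: real set)"
    by (rule dim_mono_fin_dim) (auto simp: fin_dim_def intro!: exI[of _ "{1}"] simp: span_singleton image_iff)
  ultimately show False using rank_nullity[OF linear_ev[of q] subspace_forms fin_dim_forms, of 6] by (simp add: dim_forms)
qed

text \<open>The functional sending f to \<open>L (c * f)\<close> kills a and b times everything, so
  it is a multiple of evaluation at their common zero q. If c is not in \<open>I k\<close> the
  multiple is nonzero, and pairing with W makes q a base point.\<close>

lemma no_linear_pencil:
  assumes ab: "a \<in> forms 1" "b \<in> forms 1" and indep: "\<And>s t. s *\<^sub>R a + t *\<^sub>R b = 0 \<Longrightarrow> s = 0 \<and> t = 0"
    and c: "c \<in> forms k" "k \<le> 6" "a * c \<in> I (Suc k)" "b * c \<in> I (Suc k)"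
  shows "c \<in> I k"
proof (rule ccontr)
  assume nc: "c \<notin> I k"
  obtain q where q: "q \<noteq> (\<lambda>_. 0)" "ev q a = 0" "ev q b = 0"
    "\<forall>m k. linear m \<longrightarrow> (\<forall>f\<in>forms k. m (a * f) = 0 \<and> m (b * f) = 0)
      \<longrightarrow> (\<exists>c. \<forall>f\<in>forms (Suc k). m f = c * ev q f)"
    by (rule functional_killed_by_two_linear_forms[OF ab indep]) assumption+
  obtain i where i: "q i \<noteq> 0" using q(1) by auto
  define m where "m = (\<lambda>f. L (c * f))"
  have m: "linear m" unfolding m_def using linear_compose[OF linear_mult_left lin] by (simp add: o_def)
  have "m (a * f) = 0 \<and> m (b * f) = 0" if "f \<in> forms (11 - k)" for f
    using c(3,4) that by (auto simp: I_def m_def mult.assoc mult.left_commute)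
  then obtain \<kappa> where \<kappa>: "\<forall>f\<in>forms (Suc (11 - k)). m f = \<kappa> * ev q f" using q(4) m by blast
  have k12: "Suc (11 - k) = 12 - k" using c(2) by simp
  have \<kappa>0: "\<kappa> \<noteq> 0" using nc c(1) \<kappa> unfolding k12 by (auto simp: I_def m_def)
  show False
  proof (rule no_base_point[OF q(1)])
    fix w assume w: "w \<in> rad 6 L"
    have v: "Var i ^ (6 - k) \<in> forms (6 - k)" by (rule Var_power_in_forms)
    have "w * Var i ^ (6 - k) \<in> forms (12 - k)"
      using forms_mult[OF _ v, of w 6] w c(2) by (auto simp: rad_def)
    then have "L (c * (w * Var i ^ (6 - k))) = \<kappa> * (ev q w * q i ^ (6 - k))"
      using \<kappa> unfolding k12 by (auto simp: m_def)
    moreover have "c * Var i ^ (6 - k) \<in> forms 6" using forms_mult[OF c(1) v] c(2) by simp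
    then have "L (w * (c * Var i ^ (6 - k))) = 0" using w by (simp add: rad_def)
    then have "L (c * (w * Var i ^ (6 - k))) = 0" by (simp add: mult.left_commute)
    ultimately show "ev q w = 0" using \<kappa>0 i by simp
  qed
qed

text \<open>A nonzero cubic F in the ideal contributes 10 of the 11 dimensions of W, so W consists
  of multiples of F and one more sextic g. With their Koszul syzygies these generate at most 55 + 28
  - 10 = 73 dimensions in degree 12.\<close>

lemma I_3: "I 3 = {0}"
proof (rule ccontr)
  assume "I 3 \<noteq> {0}"
  then obtain F where F: "F \<in> I 3" "F \<noteq> 0" using subspace_0[OF subspace_I] by blast
  have F3: "F \<in> forms 3" using F I_subset by blast
  let ?N = "(\<lambda>g. F * g) ` forms 3"
  have N: "subspace ?N" "dim ?N = 10"
    using F(2) linear_subspace_image[OF linear_mult_left subspace_forms]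
    by (simp_all add: dim_mult_image subspace_forms dim_forms)
  have sub: "?N \<subseteq> rad 6 L" using I_mult(1)[OF F(1), of _ 3] by (auto simp: I_6)
  obtain g where g: "g \<in> rad 6 L" "\<forall>v\<in>rad 6 L. \<exists>n\<in>?N. \<exists>t. v = n + t *\<^sub>R g"
    by (rule codim_1_decompose[OF N(1) sub subspace_rad[OF lin] fin_dim_subset[OF fin_dim_forms rad_subset]])
      (use N(2) dim_rad in auto)
  have g6: "g \<in> forms 6" using g(1) rad_subset by blast
  define \<Psi> where "\<Psi> = (\<lambda>(a, b). F * a + g * b)"
  have \<Psi>: "linear \<Psi>" unfolding \<Psi>_def by (rule linearI) (auto simp: algebra_simps)
  let ?D = "forms 9 \<times> forms 6"
  have D: "subspace ?D" "fin_dim ?D" "dim ?D = 83"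
    by (simp_all add: subspace_Times_real subspace_forms fin_dim_Times dim_Times_fin_dim dim_forms)
  define \<Theta> where "\<Theta> = (\<lambda>c. (g * c, - (F * c)))"
  have \<Theta>: "linear \<Theta>" unfolding \<Theta>_def by (rule linearI) (auto simp: algebra_simps)
  have "dim (\<Theta> ` forms 3) = 10"
    using F(2) by (subst dim_image_inj[OF \<Theta> subspace_forms fin_dim_forms]) (auto simp: \<Theta>_def zero_prod_def dim_forms)
  moreover have "dim (\<Psi> ` ?D) + dim (\<Theta> ` forms 3) \<le> dim ?D"
    by (rule dim_image_le_kernel[OF \<Psi> D(1,2)])
      (use forms_mult[OF g6, of _ 3] forms_mult[OF F3, of _ 3] in \<open>auto simp: \<Theta>_def \<Psi>_def mult.left_commute subspace_neg subspace_forms\<close>)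
  moreover have "90 \<le> dim (\<Psi> ` ?D)"
  proof (rule dim_ideal_ge)
    show "subspace (\<Psi> ` ?D)" by (rule linear_subspace_image[OF \<Psi> D(1)])
    show "\<Psi> ` ?D \<subseteq> forms 12"
      using forms_mult[OF F3, of _ 9] forms_mult[OF g6, of _ 6] by (auto simp: \<Psi>_def subspace_add subspace_forms)
    fix f h assume f: "f \<in> rad 6 L" and h: "h \<in> forms 6"
    obtain n t where n: "n \<in> ?N" "f = n + t *\<^sub>R g" using g(2) f by blast
    then obtain p where p: "p \<in> forms 3" "n = F * p" by blast
    have "f * h = \<Psi> (p * h, t *\<^sub>R h)" by (simp add: n p \<Psi>_def algebra_simps)
    moreover have "(p * h, t *\<^sub>R h) \<in> ?D" using forms_mult[OF p(1) h] h by (simp add: subspace_scale subspace_forms)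
    ultimately show "f * h \<in> \<Psi> ` ?D" by blast
  qed
  ultimately show False using D(3) by simp
qed

text \<open>For the \<open>t\<close> violating the claim there are \<open>p\<^sub>t\<close> with \<open>M p\<^sub>t \<notin> W\<close>, and these \<open>M p\<^sub>t\<close> are pairwise orthogonal
  for \<open>(f, g) \<mapsto> L (f * g)\<close>; so there are only finitely many such \<open>t\<close>.\<close>

lemma pencil_generic:
  assumes a: "a \<in> forms 1" and M: "M \<in> forms 1"
  obtains t where "\<forall>p\<in>forms 5. (a + t *\<^sub>R M) * p \<in> rad 6 L \<longrightarrow> a * p \<in> rad 6 L \<and> M * p \<in> rad 6 L"
proof -
  define T where "T = {t. \<exists>p\<in>forms 5. (a + t *\<^sub>R M) * p \<in> rad 6 L \<and> M * p \<notin> rad 6 L}"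
  have "\<forall>t\<in>T. \<exists>p. p \<in> forms 5 \<and> (a + t *\<^sub>R M) * p \<in> rad 6 L \<and> M * p \<notin> rad 6 L"
    unfolding T_def by blast
  then obtain p where p: "\<And>t. t \<in> T \<Longrightarrow> p t \<in> forms 5" "\<And>t. t \<in> T \<Longrightarrow> (a + t *\<^sub>R M) * p t \<in> rad 6 L"
    "\<And>t. t \<in> T \<Longrightarrow> M * p t \<notin> rad 6 L" by metis
  define e where "e = (\<lambda>t. M * p t)"
  have e6: "e t \<in> forms 6" if "t \<in> T" for t using forms_mult[OF M p(1)[OF that]] by (simp add: e_def)
  have orth: "L (e t * e s) = 0" if ts: "t \<in> T" "s \<in> T" "t \<noteq> s" for t s
  proof -
    have "L ((a + t *\<^sub>R M) * p t * e s) = 0" "L ((a + s *\<^sub>R M) * p s * e t) = 0"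
      using p(2)[OF ts(1)] p(2)[OF ts(2)] e6 ts by (auto simp: rad_def)
    then have "L (a * p t * e s) + t * L (e t * e s) = 0" "L (a * p s * e t) + s * L (e s * e t) = 0"
      by (simp_all add: e_def distrib_right linear_add[OF lin] linear_cmul[OF lin])
    moreover have "a * p s * e t = a * p t * e s" "e s * e t = e t * e s" by (simp_all add: e_def mult_ac)
    ultimately have "L (a * p t * e s) + t * L (e t * e s) = 0" "L (a * p t * e s) + s * L (e t * e s) = 0" by simp_all
    then have "t * L (e t * e s) = s * L (e t * e s)" by linarith
    then show ?thesis using ts(3) by simp
  qed
  \<comment> \<open>Positivity enters here: a form whose square is sent to 0 would lie in the
    radical.\<close>
  have nz: "L (e t * e t) \<noteq> 0" if "t \<in> T" for t
    using p(3)[OF that] e6[OF that] rad_eq_psd[OF psd] by (auto simp: e_def)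
  have inj: "inj_on e T"
    using orth nz by (intro inj_onI) (metis)
  have "independent (e ` T)"
    by (rule orthonormal_independent[OF lin]) (use orth nz in auto)
  then have "finite (e ` T)" using independent_card_le(1)[OF fin_dim_forms[of 6], of "e ` T"] e6 by blast
  then have "finite T" using inj finite_imageD by blast
  then obtain t where t: "t \<notin> T" using infinite_UNIV_char_0[where 'a = real] ex_new_if_finite by blast
  have "a * r \<in> rad 6 L \<and> M * r \<in> rad 6 L" if r: "r \<in> forms 5" "(a + t *\<^sub>R M) * r \<in> rad 6 L" for r
  proof -
    have Mr: "M * r \<in> rad 6 L" using t r unfolding T_def by blast
    have "a * r = (a + t *\<^sub>R M) * r - t *\<^sub>R (M * r)" by (simp add: algebra_simps)
    then have "a * r \<in> rad 6 L"
      using r(2) Mr subspace_diff[OF subspace_rad[OF lin]] subspace_scale[OF subspace_rad[OF lin]] by metis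
    then show ?thesis using Mr by blast
  qed
  then show ?thesis using that by blast
qed

text \<open>Two pencils in succession: what the final form multiplies into W, each of the three
  variables multiplies into W, and then it lies in \<open>I 5\<close>. The coefficient 1 of the
  first variable lets the line be parametrised by the other two.\<close>

lemma exists_generic_linear_form:
  obtains s t where "\<forall>p\<in>forms 5. (Var 1 + s *\<^sub>R Var 2 + t *\<^sub>R Var 3) * p \<in> rad 6 L \<longrightarrow> p \<in> I 5"
proof -
  obtain s where s: "\<forall>p\<in>forms 5. (Var 1 + s *\<^sub>R Var 2) * p \<in> rad 6 L \<longrightarrow> Var 1 * p \<in> rad 6 L \<and> Var 2 * p \<in> rad 6 L"
    by (rule pencil_generic[OF Var_in_forms Var_in_forms])
  have "Var 1 + s *\<^sub>R Var 2 \<in> forms 1" by (intro subspace_add subspace_scale subspace_forms Var_in_forms)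
  then obtain t where t: "\<forall>p\<in>forms 5. (Var 1 + s *\<^sub>R Var 2 + t *\<^sub>R Var 3) * p \<in> rad 6 L \<longrightarrow>
      (Var 1 + s *\<^sub>R Var 2) * p \<in> rad 6 L \<and> Var 3 * p \<in> rad 6 L"
    by (rule pencil_generic[OF _ Var_in_forms])
  have "p \<in> I 5" if p: "p \<in> forms 5" "(Var 1 + s *\<^sub>R Var 2 + t *\<^sub>R Var 3) * p \<in> rad 6 L" for p
  proof (rule I_Var_imp[OF p(1)])
    fix i :: 3
    show "Var i * p \<in> I (Suc 5)" using s t p exhaust_3[of i] by (auto simp: I_6)
  qed simp
  then show ?thesis using that by blast
qed

end

text \<open>If U were no larger than V, then V would be stable under multiplication by the
  coordinate T and contain polynomials of arbitrarily large degree.\<close>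

lemma shift_growth:
  fixes V U :: "(real \<Rightarrow> real) set"
  assumes V: "subspace V" "V \<noteq> {0}" "\<And>v. v \<in> V \<Longrightarrow> \<exists>p. degree p \<le> n \<and> v = poly p"
    and U: "subspace U" "fin_dim U" "V \<subseteq> U" "\<And>v. v \<in> V \<Longrightarrow> (\<lambda>T. T * v T) \<in> U"
  shows "dim V + 1 \<le> dim U"
proof (rule ccontr)
  assume "\<not> ?thesis"
  then have VU: "V = U" using subspace_eq_of_dim_le[OF U(2) V(1) U(3)] by simp
  obtain v where v: "v \<in> V" "v \<noteq> 0" using V(1,2) subspace_0 by blast
  obtain p where p: "v = poly p" using V(3) v by blast
  have p0: "p \<noteq> 0" using v p by auto
  have "poly (monom 1 j * p) \<in> V" for j
  proof (induction j)
    case 0 then show ?case using v p by (simp add: monom_0)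
  next
    case (Suc j)
    have "(\<lambda>T. T * poly (monom 1 j * p) T) \<in> V" using U(4)[OF Suc] VU by simp
    moreover have "(\<lambda>T. T * poly (monom 1 j * p) T) = poly (monom 1 (Suc j) * p)"
      by (auto simp: poly_monom)
    ultimately show ?case by (simp only:)
  qed
  then obtain q where q: "degree q \<le> n" "poly (monom 1 (Suc n) * p) = poly q" using V(3) by metis
  then have "monom 1 (Suc n) * p = q" by (simp add: poly_eq_poly_eq_iff)
  moreover have "degree (monom 1 (Suc n) * p) = Suc n + degree p"
    using p0 by (subst degree_mult_eq) (auto simp: degree_monom_eq)
  ultimately show False using q(1) by simp
qed

section \<open>A general line and the operators of division by its equation\<close>

locale extreme_sextic_line = extreme_sextic +
  fixes a :: ternary and s t :: real
  assumes a_eq: "a = Var 1 + s *\<^sub>R Var 2 + t *\<^sub>R Var 3"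
    and generic: "\<And>p. p \<in> forms 5 \<Longrightarrow> a * p \<in> rad 6 L \<Longrightarrow> p \<in> I 5"
begin

lemma a_form: "a \<in> forms 1"
  unfolding a_eq by (intro subspace_add subspace_scale subspace_forms Var_in_forms)

lemma a_ne_0: "a \<noteq> 0"
proof
  assume "a = 0"
  then have "ev (\<lambda>i. if i = 1 then 1 else 0) a = 0" by simp
  then show False by (simp add: a_eq)
qed

lemma a_mult_mem: "f \<in> forms k \<Longrightarrow> a * f \<in> forms (Suc k)"
  using forms_mult[OF a_form] by simp

lemma apow: "a ^ n \<in> forms n"
proof (induction n)
  case (Suc n) then show ?case using a_mult_mem by simp
qed simp

text \<open>Injectivity is given in degree 5 and passes to lower degrees: multiply p by all forms of
  the missing degree and apply \<open>I_mult_imp\<close>.\<close>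

lemma a_injective:
  assumes p: "p \<in> forms k" "k \<le> 5" "a * p \<in> I (Suc k)" shows "p \<in> I k"
proof (rule I_mult_imp[OF p(1), of "5 - k"])
  show "k + (5 - k) \<le> 12" using p by simp
  fix q assume q: "q \<in> forms (5 - k)"
  have "a * p * q \<in> I (Suc k + (5 - k))" by (rule I_mult(1)[OF p(3) q]) (use p in simp)
  then have "a * (p * q) \<in> rad 6 L" using p(2) by (simp add: I_6 mult.assoc)
  moreover have "p * q \<in> forms 5" using forms_mult[OF p(1) q] p(2) by simp
  ultimately have "p * q \<in> I 5" by (rule generic[rotated])
  then show "p * q \<in> I (k + (5 - k))" using p(2) by simp
qed

text \<open>If the dimension were 4, then \<open>a\<close> would map degree 5 isomorphically onto degree 6 modulo \<open>I\<close>. Then \<open>X i\<close> is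
  multiplication by \<open>Var i / a\<close>, and \<open>\<Phi> f\<close> is \<open>f a\<^sup>5\<close> divided by \<open>a\<close> to the degree of \<open>f\<close>, both modulo \<open>I 5\<close>.\<close>

lemma dim_I5_ne_4: "dim (I 5) \<noteq> 4"
proof
  assume dim4: "dim (I 5) = 4"
  \<comment> \<open>The domain has dimension 21 + 11 = 32 and the kernel at most 4, which leaves 28:
    every sextic is a multiple of a modulo W.\<close>
  define \<Psi> where "\<Psi> = (\<lambda>(p, w). a * p + w)"
  have \<Psi>: "linear \<Psi>" unfolding \<Psi>_def by (rule linearI) (auto simp: algebra_simps)
  let ?D = "forms 5 \<times> rad 6 L"
  have fdr: "fin_dim (rad 6 L)" by (rule fin_dim_subset[OF fin_dim_forms rad_subset])
  have D: "subspace ?D" "fin_dim ?D" "dim ?D = 32"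
    using fdr subspace_rad[OF lin]
    by (simp_all add: subspace_Times_real subspace_forms fin_dim_Times dim_Times_fin_dim dim_forms dim_rad)
  define \<Theta> where "\<Theta> = (\<lambda>p. (p, - (a * p)))"
  have \<Theta>: "linear \<Theta>" unfolding \<Theta>_def by (rule linearI) (auto simp: algebra_simps)
  have ker: "{x \<in> ?D. \<Psi> x = 0} \<subseteq> \<Theta> ` I 5"
  proof
    fix x assume x: "x \<in> {x \<in> ?D. \<Psi> x = 0}"
    obtain p w where pw: "x = (p, w)" "p \<in> forms 5" "w \<in> rad 6 L" "a * p + w = 0" using x by (auto simp: \<Psi>_def)
    then have w: "w = - (a * p)" by (simp add: eq_neg_iff_add_eq_0 add.commute)
    have "- w \<in> rad 6 L" by (rule subspace_neg[OF subspace_rad[OF lin] pw(3)])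
    moreover have "- w = a * p" using w by simp
    ultimately have "p \<in> I 5" using generic pw(2) by simp
    then show "x \<in> \<Theta> ` I 5" using pw w by (auto simp: \<Theta>_def)
  qed
  have "dim (\<Theta> ` I 5) = 4"
    using dim4 by (subst dim_image_inj[OF \<Theta> subspace_I fin_dim_I]) (auto simp: \<Theta>_def zero_prod_def)
  then have "dim {x \<in> ?D. \<Psi> x = 0} \<le> 4"
    using dim_mono_fin_dim[OF fin_dim_image[OF \<Theta> fin_dim_I] ker] by simp
  then have "dim (forms 6) \<le> dim (\<Psi> ` ?D)"
    using rank_nullity[OF \<Psi> D(1,2)] D(3) by (simp add: dim_forms)
  moreover have "\<Psi> ` ?D \<subseteq> forms 6"
    using a_mult_mem[of _ 5] rad_subset[of 6 L] by (auto simp: \<Psi>_def intro!: subspace_add[OF subspace_forms])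
  ultimately have img: "\<Psi> ` ?D = forms 6"
    by (intro subspace_eq_of_dim_le[OF fin_dim_forms linear_subspace_image[OF \<Psi> D(1)]])
  \<comment> \<open>A linear section of \<Psi>. Its first component \<pi> is division by a modulo W,
    with a result unique modulo \<open>I 5\<close>.\<close>
  obtain g where g: "range g \<subseteq> ?D" "linear g" "\<forall>v\<in>\<Psi> ` ?D. \<Psi> (g v) = v"
    using linear_exists_right_inverse_on[OF \<Psi> D(1)] by blast
  define \<pi> where "\<pi> = (\<lambda>f. fst (g f))"
  have \<pi>: "linear \<pi>" unfolding \<pi>_def by (rule linearI) (simp_all add: linear_add[OF g(2)] linear_cmul[OF g(2)])
  have \<pi>5: "\<pi> f \<in> forms 5" for f using g(1) unfolding \<pi>_def by (metis mem_Times_iff range_subsetD)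
  have \<pi>W: "a * \<pi> f - f \<in> rad 6 L" if "f \<in> forms 6" for f
  proof -
    have "\<Psi> (g f) = f" using g(3) img that by simp
    then have "a * \<pi> f + snd (g f) = f" by (simp add: \<Psi>_def \<pi>_def case_prod_beta)
    then have "a * \<pi> f - f = - snd (g f)" by (simp add: algebra_simps)
    moreover have "snd (g f) \<in> rad 6 L" using g(1) by (metis mem_Times_iff range_subsetD)
    ultimately show ?thesis using subspace_neg[OF subspace_rad[OF lin]] by simp
  qed
  define X where "X = (\<lambda>i p. \<pi> (Var i * p))"
  have linX: "linear (X i)" for i
    unfolding X_def using linear_compose[OF linear_mult_left \<pi>] by (simp add: o_def)
  have X5: "X i p \<in> forms 5" for i p by (simp add: X_def \<pi>5)
  have Var6: "Var i * p \<in> forms 6" if "p \<in> forms 5" for i p using forms_mult[OF Var_in_forms that, of i] by simp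
  have XW: "a * X i p - Var i * p \<in> rad 6 L" if "p \<in> forms 5" for i p
    unfolding X_def by (rule \<pi>W[OF Var6[OF that]])
  have XI: "X i p \<in> I 5" if p: "p \<in> I 5" for i p
  proof -
    have p5: "p \<in> forms 5" using p I_subset by blast
    have "Var i * p \<in> rad 6 L" using I_mult(2)[OF p Var_in_forms, of i] by (simp add: I_6)
    then have "a * X i p \<in> rad 6 L" using XW[OF p5, of i] subspace_add[OF subspace_rad[OF lin]] by fastforce
    then show ?thesis by (rule generic[OF X5])
  qed
  define R where "R = (\<lambda>p p'. p - p' \<in> I 5)"
  have R_refl: "R p p" for p by (simp add: R_def subspace_0 subspace_I)
  have R_sym: "R p' p" if "R p p'" for p p' using that subspace_neg[OF subspace_I, of "p - p'" 5] by (simp add: R_def)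
  have R_trans: "R p p''" if "R p p'" "R p' p''" for p p' p''
    using that subspace_add[OF subspace_I, of "p - p'" 5 "p' - p''"] by (simp add: R_def)
  have RX: "R (X i p) (X i p')" if "R p p'" for i p p'
    using XI[of "p - p'" i] that by (simp add: R_def linear_diff[OF linX])
  have comm: "R (X i (X j p)) (X j (X i p))" if p: "p \<in> forms 5" for i j p
  proof -
    define r where "r = X i (X j p) - X j (X i p)"
    have r5: "r \<in> forms 5" by (simp add: r_def X5 subspace_diff subspace_forms)
    have kill: "L (u * (v * r)) = 0" if "u \<in> rad 6 L" "v \<in> forms 1" for u v
      using that forms_mult[OF that(2) r5] by (simp add: rad_def)
    \<comment> \<open>The commutator r, multiplied twice by a, becomes a combination of elements of
      W; paired with r it gives 0, and positivity puts \<open>a * r\<close> into W.\<close>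
    have 1: "a * (a * r) = a * (a * X i (X j p) - Var i * X j p) - a * (a * X j (X i p) - Var j * X i p)
      + Var i * (a * X j p - Var j * p) - Var j * (a * X i p - Var i * p)"
      by (simp add: r_def algebra_simps)
    have "L (a * (a * r) * r) = L ((a * X i (X j p) - Var i * X j p) * (a * r)) - L ((a * X j (X i p) - Var j * X i p) * (a * r))
      + L ((a * X j p - Var j * p) * (Var i * r)) - L ((a * X i p - Var i * p) * (Var j * r))"
      unfolding 1 by (simp add: linear_add[OF lin, symmetric] linear_diff[OF lin, symmetric] algebra_simps)
    also have "\<dots> = 0"
      using kill[OF XW[OF X5, of i j p] a_form] kill[OF XW[OF X5, of j i p] a_form]
        kill[OF XW[OF p, of j] Var_in_forms, of i] kill[OF XW[OF p, of i] Var_in_forms, of j] by simp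
    finally have "L ((a * r) * (a * r)) = 0" by (simp add: mult_ac)
    then have "a * r \<in> rad 6 L" using a_mult_mem[OF r5] by (simp add: rad_eq_psd[OF psd])
    then show ?thesis using generic[OF r5] by (simp add: R_def r_def)
  qed
  have funpow5: "(X j ^^ n) p \<in> forms 5" if "p \<in> forms 5" for j n p
    using that by (induction n) (simp_all add: X5)
  have RXn: "R ((X j ^^ n) p) ((X j ^^ n) p')" if "R p p'" for j n p p'
    using that by (induction n) (simp_all add: RX)
  have comm_n: "R (X i ((X j ^^ n) p)) ((X j ^^ n) (X i p))" if p: "p \<in> forms 5" for i j n p
  proof (induction n)
    case 0 show ?case by (simp add: R_refl)
  next
    case (Suc n)
    have "R (X i (X j ((X j ^^ n) p))) (X j (X i ((X j ^^ n) p)))" by (rule comm[OF funpow5[OF p]])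
    moreover have "R (X j (X i ((X j ^^ n) p))) (X j ((X j ^^ n) (X i p)))" by (rule RX[OF Suc])
    ultimately show ?case using R_trans by simp
  qed
  define p0 where "p0 = \<pi> (a ^ 6)"
  \<comment> \<open>The operators commute only modulo \<open>I 5\<close>, so a fixed order is
    chosen; \<open>\<phi>X\<close> shows that it does not matter modulo \<open>I 5\<close>.\<close>
  define \<phi> where "\<phi> = (\<lambda>\<alpha> :: 3 \<Rightarrow>\<^sub>0 nat. (X 1 ^^ Poly_Mapping.lookup \<alpha> 1) ((X 2 ^^ Poly_Mapping.lookup \<alpha> 2) ((X 3 ^^ Poly_Mapping.lookup \<alpha> 3) p0)))"
  define \<Phi> where "\<Phi> = lin \<phi>"
  have p05: "p0 \<in> forms 5" by (simp add: p0_def \<pi>5)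
  have lin\<Phi>: "linear \<Phi>" unfolding \<Phi>_def by (rule linear_lin)
  have \<phi>5: "\<phi> \<alpha> \<in> forms 5" for \<alpha> unfolding \<phi>_def by (intro funpow5 p05)
  have \<Phi>5: "\<Phi> f \<in> forms 5" for f
    unfolding \<Phi>_def lin_def by (intro subspace_sum subspace_scale subspace_forms \<phi>5)
  have \<phi>X: "R (\<phi> (Poly_Mapping.single i 1 + \<alpha>)) (X i (\<phi> \<alpha>))" for i \<alpha>
  proof -
    have l: "Poly_Mapping.lookup (Poly_Mapping.single i 1 + \<alpha>) j = (if j = i then Suc (Poly_Mapping.lookup \<alpha> j) else Poly_Mapping.lookup \<alpha> j)" for j
      by (simp add: lookup_add lookup_single when_def)
    consider "i = 1" | "i = 2" | "i = 3" using exhaust_3 by blast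
    then show ?thesis
    proof cases
      case 1 then show ?thesis unfolding \<phi>_def l by (simp add: R_refl)
    next
      case 2
      then show ?thesis unfolding \<phi>_def l
        by simp (rule R_sym[OF comm_n[OF funpow5[OF funpow5[OF p05]]]])
    next
      case 3
      have "R ((X 2 ^^ Poly_Mapping.lookup \<alpha> 2) (X 3 ((X 3 ^^ Poly_Mapping.lookup \<alpha> 3) p0)))
          (X 3 ((X 2 ^^ Poly_Mapping.lookup \<alpha> 2) ((X 3 ^^ Poly_Mapping.lookup \<alpha> 3) p0)))"
        by (rule R_sym[OF comm_n[OF funpow5[OF p05]]])
      from R_trans[OF RXn[OF this] R_sym[OF comm_n[OF funpow5[OF funpow5[OF p05]]]]]
      show ?thesis using 3 unfolding \<phi>_def l by simp
    qed
  qed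
  have \<Phi>X: "R (\<Phi> (Var i * f)) (X i (\<Phi> f))" for i f
  proof -
    define S where "S = {f. R (\<Phi> (Var i * f)) (X i (\<Phi> f))}"
    have "subspace S"
      unfolding subspace_def
    proof (intro conjI ballI allI)
      show "0 \<in> S" by (simp add: S_def linear_0[OF lin\<Phi>] linear_0[OF linX] R_refl)
      fix f g c
      assume f: "f \<in> S"
      have "\<Phi> (Var i * (c *\<^sub>R f)) - X i (\<Phi> (c *\<^sub>R f)) = c *\<^sub>R (\<Phi> (Var i * f) - X i (\<Phi> f))"
        by (simp add: linear_cmul[OF lin\<Phi>] linear_cmul[OF linX] scaleR_diff_right)
      then show "c *\<^sub>R f \<in> S" using f by (simp add: S_def R_def subspace_scale[OF subspace_I])
      assume g: "g \<in> S"
      have "\<Phi> (Var i * (f + g)) - X i (\<Phi> (f + g)) = (\<Phi> (Var i * f) - X i (\<Phi> f)) + (\<Phi> (Var i * g) - X i (\<Phi> g))"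
        by (simp add: distrib_left linear_add[OF lin\<Phi>] linear_add[OF linX])
      then show "f + g \<in> S" using f g by (simp only: S_def R_def mem_Collect_eq subspace_add[OF subspace_I])
    qed
    moreover have "mon \<alpha> \<in> S" for \<alpha>
      using \<phi>X[of i \<alpha>] by (simp add: S_def \<Phi>_def mon_Var[symmetric])
    ultimately have "(\<Sum>\<alpha>\<in>Poly_Mapping.keys f. Poly_Mapping.lookup f \<alpha> *\<^sub>R mon \<alpha>) \<in> S"
      by (intro subspace_sum subspace_scale)
    then show ?thesis using ternary_expand[of f] by (simp add: S_def)
  qed
  \<comment> \<open>For k = 6 the power of a disappears, and \<Phi> is seen to map W into
    \<open>I 5\<close>.\<close>
  have \<Phi>W: "a * \<Phi> p - p * a ^ (6 - k) \<in> rad 6 L" if "p \<in> forms k" "k \<le> 6" for p k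
    using that
  proof (induction k arbitrary: p)
    case 0
    then obtain c where c: "p = c *\<^sub>R 1" using forms_0 by blast
    have "\<Phi> 1 = p0" using lin_mon[of \<phi> 0] by (simp add: \<Phi>_def \<phi>_def)
    moreover have "a * p0 - a ^ 6 \<in> rad 6 L" unfolding p0_def by (rule \<pi>W[OF apow])
    then have "c *\<^sub>R (a * p0 - a ^ 6) \<in> rad 6 L" by (rule subspace_scale[OF subspace_rad[OF lin]])
    ultimately show ?case by (simp add: c linear_cmul[OF lin\<Phi>] scaleR_diff_right)
  next
    case (Suc k)
    obtain h where h: "\<And>i. h i \<in> forms k" "p = (\<Sum>i\<in>UNIV. Var i * h i)" using forms_Suc[OF Suc.prems(1)] by blast
    have one: "a * \<Phi> (Var i * h i) - Var i * h i * a ^ (6 - Suc k) \<in> rad 6 L" for i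
    proof -
      define e where "e = h i * a ^ (5 - k)"
      have ae: "h i * a ^ (6 - k) = a * e" using Suc.prems(2) by (simp add: e_def mult_ac Suc_diff_le numeral_eq_Suc flip: power_Suc)
      have e5: "e \<in> forms 5" using forms_mult[OF h(1)[of i] apow[of "5 - k"]] Suc.prems(2) by (simp add: e_def)
      have "a * (\<Phi> (h i) - e) \<in> rad 6 L" using Suc.IH[OF h(1)[of i]] Suc.prems(2) ae by (simp add: right_diff_distrib)
      then have "\<Phi> (h i) - e \<in> I 5" by (intro generic) (simp_all add: \<Phi>5 e5 subspace_diff subspace_forms)
      then have "R (X i (\<Phi> (h i))) (X i e)" by (intro RX) (simp add: R_def)
      then have "\<Phi> (Var i * h i) - X i e \<in> I 5" using R_trans[OF \<Phi>X] by (simp add: R_def)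
      then have "a * (\<Phi> (Var i * h i) - X i e) \<in> rad 6 L" using I_mult(2)[OF _ a_form, of _ 5] by (simp add: I_6)
      from subspace_add[OF subspace_rad[OF lin] this XW[OF e5, of i]]
      show ?thesis by (simp add: right_diff_distrib e_def mult.assoc)
    qed
    have "(\<Sum>i\<in>UNIV. a * \<Phi> (Var i * h i) - Var i * h i * a ^ (6 - Suc k)) \<in> rad 6 L"
      by (rule subspace_sum[OF subspace_rad[OF lin]]) (rule one)
    then show ?case by (simp add: h(2) linear_sum[OF lin\<Phi>] sum_subtractf sum_distrib_left sum_distrib_right)
  qed
  have \<Phi>rad: "\<Phi> w \<in> I 5" if w: "w \<in> rad 6 L" for w
  proof -
    have "w \<in> forms 6" using w rad_subset by blast
    from subspace_add[OF subspace_rad[OF lin] \<Phi>W[OF this] w] have "a * \<Phi> w \<in> rad 6 L" by simp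
    then show ?thesis by (rule generic[OF \<Phi>5])
  qed
  have \<Phi>ideal: "\<Phi> (w * q) \<in> I 5" if w: "w \<in> rad 6 L" and q: "q \<in> forms k" for w q k
    using q
  proof (induction k arbitrary: q)
    case 0
    then obtain c where c: "q = c *\<^sub>R 1" using forms_0 by blast
    show ?case using \<Phi>rad[OF w] by (simp add: c linear_cmul[OF lin\<Phi>] subspace_scale subspace_I)
  next
    case (Suc k)
    obtain h where h: "\<And>i. h i \<in> forms k" "q = (\<Sum>i\<in>UNIV. Var i * h i)" using forms_Suc[OF Suc.prems] by blast
    have "\<Phi> (Var i * (w * h i)) \<in> I 5" for i
    proof -
      have "X i (\<Phi> (w * h i)) \<in> I 5" by (rule XI[OF Suc.IH[OF h(1)]])
      with \<Phi>X[of i "w * h i"] subspace_add[OF subspace_I] show ?thesis unfolding R_def by fastforce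
    qed
    then have "(\<Sum>i\<in>UNIV. \<Phi> (Var i * (w * h i))) \<in> I 5" by (rule subspace_sum[OF subspace_I])
    then show ?case by (simp add: h(2) sum_distrib_left linear_sum[OF lin\<Phi>] mult.left_commute)
  qed
  \<comment> \<open>The same combination of the \<open>X i\<close> that makes up a is division of a
    by a, the identity modulo \<open>I 5\<close>.\<close>
  have \<Phi>a: "R (\<Phi> (a * f)) (\<Phi> f)" for f
  proof -
    define z where "z = X 1 (\<Phi> f) + s *\<^sub>R X 2 (\<Phi> f) + t *\<^sub>R X 3 (\<Phi> f)"
    have "z = \<pi> (a * \<Phi> f)"
      by (simp add: z_def X_def a_eq distrib_right linear_add[OF \<pi>] linear_cmul[OF \<pi>])
    then have "a * z - a * \<Phi> f \<in> rad 6 L" using \<pi>W[of "a * \<Phi> f"] a_mult_mem[OF \<Phi>5] by simp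
    then have "a * (z - \<Phi> f) \<in> rad 6 L" by (simp add: right_diff_distrib)
    then have zf: "z - \<Phi> f \<in> I 5"
      by (intro generic) (simp_all add: z_def X5 \<Phi>5 subspace_diff subspace_add subspace_scale subspace_forms)
    have "\<Phi> (a * f) - z = (\<Phi> (Var 1 * f) - X 1 (\<Phi> f)) + s *\<^sub>R (\<Phi> (Var 2 * f) - X 2 (\<Phi> f)) + t *\<^sub>R (\<Phi> (Var 3 * f) - X 3 (\<Phi> f))"
      by (simp add: z_def a_eq distrib_right linear_add[OF lin\<Phi>] linear_cmul[OF lin\<Phi>] algebra_simps)
    then have "\<Phi> (a * f) - z \<in> I 5" using \<Phi>X[of _ f] unfolding R_def
      by (simp only: subspace_add[OF subspace_I] subspace_scale[OF subspace_I])
    then show ?thesis using zf R_trans unfolding R_def by blast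
  qed
  have \<Phi>apow: "R (\<Phi> (a ^ n * p)) p" if p: "p \<in> forms 5" for n p
  proof (induction n)
    case 0
    have "a * (\<Phi> p - p) \<in> rad 6 L" using \<Phi>W[OF p] by (simp add: right_diff_distrib mult.commute)
    then have "\<Phi> p - p \<in> I 5" by (intro generic) (simp_all add: \<Phi>5 p subspace_diff subspace_forms)
    then show ?case by (simp add: R_def)
  next
    case (Suc n)
    then show ?case using R_trans[OF \<Phi>a] by (simp add: mult.assoc)
  qed
  \<comment> \<open>Its vanishing costs at most one of the 21 dimensions of \<open>forms 5\<close>,
    so it can be met outside the 4-dimensional \<open>I 5\<close>.\<close>
  define \<mu> where "\<mu> = (\<lambda>p. L (a ^ 7 * p))"
  have \<mu>: "linear \<mu>" unfolding \<mu>_def using linear_compose[OF linear_mult_left lin] by (simp add: o_def)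
  let ?K = "{p \<in> forms 5. \<mu> p = 0}"
  have "dim (\<mu> ` forms 5) \<le> dim (UNIV :: real set)"
    by (rule dim_mono_fin_dim) (auto simp: fin_dim_def intro!: exI[of _ "{1}"] simp: span_singleton image_iff)
  then have "20 \<le> dim ?K" using rank_nullity[OF \<mu> subspace_forms fin_dim_forms, of 5] by (simp add: dim_forms)
  then have "\<not> ?K \<subseteq> I 5" using dim_mono_fin_dim[OF fin_dim_I, of ?K 5] dim4 by linarith
  then obtain p where p: "p \<in> forms 5" "\<mu> p = 0" "p \<notin> I 5" by blast
  \<comment> \<open>The composition of \<xi> with \<Phi> kills the products of W with sextics, so it
    is a multiple of L and vanishes at \<open>a ^ 7 * p\<close>. But \<Phi> returns p there modulo
    \<open>I 5\<close>, and \<open>\<xi> p = 1\<close>.\<close>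
  obtain \<xi> :: "ternary \<Rightarrow> real" where \<xi>: "linear \<xi>" "\<xi> p = 1" "\<forall>v\<in>I 5. \<xi> v = 0"
    by (rule functional_separating[OF subspace_I p(3)])
  have "linear (\<lambda>f. \<xi> (\<Phi> f))" using linear_compose[OF lin\<Phi> \<xi>(1)] by (simp add: o_def)
  then obtain c where c: "\<forall>h\<in>forms 12. \<xi> (\<Phi> h) = c * L h"
    using unique[of "\<lambda>f. \<xi> (\<Phi> f)"] \<Phi>ideal \<xi>(3) by blast
  from forms_mult[OF apow[of 7] p(1)] have "\<xi> (\<Phi> (a ^ 7 * p)) = 0" using c p(2) by (simp add: \<mu>_def)
  moreover have "\<xi> (\<Phi> (a ^ 7 * p) - p) = 0" using \<Phi>apow[OF p(1), of 7] \<xi>(3) by (simp add: R_def)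
  ultimately show False using \<xi>(2) by (simp add: linear_diff[OF \<xi>(1)])
qed

end

section \<open>Restriction to the line and the possible Hilbert functions\<close>

context extreme_sextic_line
begin

text \<open>\<open>\<rho>\<close> restricts a form to the line \<open>a = 0\<close>, in the affine coordinate \<open>T = z / y\<close>.\<close>

definition line_pt :: "real \<Rightarrow> 3 \<Rightarrow> real"
  where "line_pt T = (\<lambda>i. if i = 1 then - s - t * T else if i = 2 then 1 else T)"

definition \<rho> :: "ternary \<Rightarrow> real \<Rightarrow> real"
  where "\<rho> f = (\<lambda>T. ev (line_pt T) f)"

lemma linear_\<rho>: "linear \<rho>"
  by (rule linearI) (auto simp: \<rho>_def scaleR_fun_def)

lemma \<rho>_Var2: "\<rho> (Var 2 * f) = \<rho> f" and \<rho>_Var3: "\<rho> (Var 3 * f) = (\<lambda>T. T * \<rho> f T)" and \<rho>_a: "\<rho> (a * f) = 0"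
  by (auto simp: \<rho>_def line_pt_def a_eq fun_eq_iff)

lemma \<rho>_poly: "f \<in> forms k \<Longrightarrow> \<exists>p. degree p \<le> k \<and> \<rho> f = poly p"
proof (induction k arbitrary: f)
  case 0
  then obtain c where "f = c *\<^sub>R 1" using forms_0 by blast
  then have "\<rho> f = poly [:c:]" by (auto simp: \<rho>_def)
  then show ?case by (intro exI[of _ "[:c:]"]) simp
next
  case (Suc k)
  obtain g where g: "\<And>i. g i \<in> forms k" "f = (\<Sum>i\<in>UNIV. Var i * g i)" using forms_Suc[OF Suc.prems] by blast
  obtain p where p: "\<And>i. degree (p i) \<le> k" "\<And>i. \<rho> (g i) = poly (p i)" using Suc.IH[OF g(1)] by metis
  have "\<rho> f = poly ([:- s, - t:] * p 1 + p 2 + [:0, 1:] * p 3)"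
  proof
    fix T
    have "\<rho> f T = (- s - t * T) * \<rho> (g 1) T + \<rho> (g 2) T + T * \<rho> (g 3) T"
      by (simp add: \<rho>_def g(2) sum_3 line_pt_def)
    then show "\<rho> f T = poly ([:- s, - t:] * p 1 + p 2 + [:0, 1:] * p 3) T"
      by (simp add: p(2) algebra_simps)
  qed
  moreover have "degree ([:- s, - t:] * p 1 + p 2 + [:0, 1:] * p 3) \<le> Suc k"
  proof (intro degree_add_le)
    have "degree [:- s, - t:] \<le> 1" "degree [:0, 1::real:] \<le> 1" by auto
    then show "degree ([:- s, - t:] * p 1) \<le> Suc k" "degree ([:0, 1:] * p 3) \<le> Suc k"
      using p(1)[of 1] p(1)[of 3] degree_mult_le[of "[:- s, - t:]" "p 1"] degree_mult_le[of "[:0, 1:]" "p 3"] by linarith+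
    show "degree (p 2) \<le> Suc k" using p(1)[of 2] by simp
  qed
  ultimately show ?case by blast
qed

text \<open>On the line the second and third variables restrict to 1 and T, so that
  \<open>shift_growth\<close> applies to the restrictions.\<close>

lemma \<rho>_growth:
  assumes V: "subspace V" "V \<subseteq> forms k" "\<rho> ` V \<noteq> {0}"
    and U: "subspace U" "fin_dim U" "\<And>v. v \<in> V \<Longrightarrow> Var 2 * v \<in> U" "\<And>v. v \<in> V \<Longrightarrow> Var 3 * v \<in> U"
  shows "dim (\<rho> ` V) + 1 \<le> dim (\<rho> ` U)"
proof (rule shift_growth[of _ k])
  show "subspace (\<rho> ` V)" "subspace (\<rho> ` U)" by (intro linear_subspace_image linear_\<rho> V U)+
  show "fin_dim (\<rho> ` U)" by (intro fin_dim_image linear_\<rho> U)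
  show "\<exists>p. degree p \<le> k \<and> v = poly p" if "v \<in> \<rho> ` V" for v using that V(2) \<rho>_poly by blast
  show "\<rho> ` V \<subseteq> \<rho> ` U"
  proof
    fix v assume "v \<in> \<rho> ` V"
    then obtain f where f: "f \<in> V" "v = \<rho> f" by blast
    have "v = \<rho> (Var 2 * f)" unfolding f(2) by (rule \<rho>_Var2[symmetric])
    then show "v \<in> \<rho> ` U" using U(3)[OF f(1)] by blast
  qed
  fix v assume "v \<in> \<rho> ` V"
  then show "(\<lambda>T. T * v T) \<in> \<rho> ` U"
  proof -
    assume "v \<in> \<rho> ` V"
    then obtain f where f: "f \<in> V" "v = \<rho> f" by blast
    have "(\<lambda>T. T * v T) = \<rho> (Var 3 * f)" unfolding f(2) by (rule \<rho>_Var3[symmetric])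
    then show ?thesis using U(4)[OF f(1)] by blast
  qed
qed (rule V)

lemma dim_\<rho>_forms_ge: "k + 1 \<le> dim (\<rho> ` forms k)"
proof (induction k)
  have nz: "\<rho> ` forms k \<noteq> {0}" for k
  proof -
    have "\<rho> (Var 2 ^ k) 0 = 1" by (simp add: \<rho>_def line_pt_def)
    then have "\<rho> (Var 2 ^ k) \<noteq> 0" by (metis zero_fun_apply zero_neq_one)
    then show ?thesis using Var_power_in_forms[of 2 k] by blast
  qed
  {
    case 0
    have "dim (\<rho> ` forms 0) \<noteq> 0"
    proof
      assume "dim (\<rho> ` forms 0) = 0"
      then obtain B where "independent B" "\<rho> ` forms 0 \<subseteq> span B" "card B = 0" "finite B"
        using fin_dim_basis[OF fin_dim_image[OF linear_\<rho> fin_dim_forms[of 0]]] by metis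
      then have "\<rho> ` forms 0 \<subseteq> {0}" by simp
      then show False using nz[of 0] subspace_0[OF linear_subspace_image[OF linear_\<rho> subspace_forms]] by blast
    qed
    then show ?case by simp
  next
    case (Suc k)
    have "dim (\<rho> ` forms k) + 1 \<le> dim (\<rho> ` forms (Suc k))"
      using forms_mult[OF Var_in_forms] nz[of k]
      by (intro \<rho>_growth[where k = k]) (auto simp: subspace_forms)
    then show ?case using Suc by simp
  }
qed

text \<open>Division by a through dimensions: the restrictions from degree \<open>Suc k\<close> fill
  at least k + 2 dimensions, which leaves room in the kernel only for a times
  \<open>forms k\<close>.\<close>

lemma \<rho>_kernel:
  assumes "f \<in> forms (Suc k)" "\<rho> f = 0" obtains g where "g \<in> forms k" "f = a * g"
proof -
  let ?K = "{f \<in> forms (Suc k). \<rho> f = 0}"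
  have "dim ?K \<le> dim (forms k)"
    using rank_nullity[OF linear_\<rho> subspace_forms fin_dim_forms, of "Suc k"] dim_\<rho>_forms_ge[of "Suc k"]
      dim_forms_double[of k] dim_forms_double[of "Suc k"] by simp
  moreover have "(\<lambda>g. a * g) ` forms k \<subseteq> ?K" using a_mult_mem \<rho>_a by auto
  moreover have "dim ((\<lambda>g. a * g) ` forms k) = dim (forms k)"
    by (rule dim_mult_image[OF a_ne_0 subspace_forms fin_dim_forms])
  ultimately have "(\<lambda>g. a * g) ` forms k = ?K"
    by (intro subspace_eq_of_dim_le[OF fin_dim_subset[OF fin_dim_forms[of "Suc k"]]])
      (simp_all add: linear_subspace_image linear_mult_left subspace_forms)
  then have "f \<in> (\<lambda>g. a * g) ` forms k" using assms by simp
  then show ?thesis using that by blast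
qed

lemma dim_\<rho>_le: "dim (\<rho> ` forms k) \<le> k + 1"
proof (cases k)
  case 0
  have "dim (\<rho> ` forms 0) \<le> dim (forms 0)"
    using rank_nullity[OF linear_\<rho> subspace_forms fin_dim_forms, of 0] by simp
  then show ?thesis by (simp add: 0 dim_forms)
next
  case (Suc n)
  let ?K = "{f \<in> forms (Suc n). \<rho> f = 0}"
  have sub: "(\<lambda>g. a * g) ` forms n \<subseteq> ?K" using a_mult_mem \<rho>_a by auto
  have fdK: "fin_dim ?K" by (rule fin_dim_subset[OF fin_dim_forms[of "Suc n"]]) auto
  have "dim (forms n) = dim ((\<lambda>g. a * g) ` forms n)"
    by (rule dim_mult_image[OF a_ne_0 subspace_forms fin_dim_forms, symmetric])
  also have "\<dots> \<le> dim ?K" by (rule dim_mono_fin_dim[OF fdK sub])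
  finally show ?thesis
    using rank_nullity[OF linear_\<rho> subspace_forms fin_dim_forms, of "Suc n"] dim_forms_double[of n] dim_forms_double[of "Suc n"]
    by (simp add: Suc)
qed

text \<open>Up to degree 6, \<open>k + 1 - w k\<close> is the first difference of the Hilbert
  function of the quotient by the apolar ideal.\<close>

definition w :: "nat \<Rightarrow> nat"
  where "w k = dim (\<rho> ` I k)"

lemma w_le: "w k \<le> k + 1"
  unfolding w_def
  using dim_mono_fin_dim[OF fin_dim_image[OF linear_\<rho> fin_dim_forms] image_mono[OF I_subset]] dim_\<rho>_le order_trans by blast

text \<open>Elements of the ideal vanishing on the line are divisible by a, and by injectivity the
  quotient is again in the ideal.\<close>

lemma dim_I_Suc: assumes "k \<le> 5" shows "dim (I (Suc k)) = w (Suc k) + dim (I k)"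
proof -
  have "{f \<in> I (Suc k). \<rho> f = 0} = (\<lambda>g. a * g) ` I k"
  proof (intro set_eqI iffI)
    fix f assume f: "f \<in> {f \<in> I (Suc k). \<rho> f = 0}"
    then obtain g where g: "g \<in> forms k" "f = a * g" using \<rho>_kernel[of f k] I_subset by blast
    then have "g \<in> I k" using a_injective[OF g(1) assms] f by simp
    then show "f \<in> (\<lambda>g. a * g) ` I k" using g by blast
  next
    fix f assume "f \<in> (\<lambda>g. a * g) ` I k"
    then obtain g where g: "g \<in> I k" "f = a * g" by blast
    then show "f \<in> {f \<in> I (Suc k). \<rho> f = 0}" using I_mult(2)[OF g(1) a_form] assms \<rho>_a by simp
  qed
  then show ?thesis
    using rank_nullity[OF linear_\<rho> subspace_I fin_dim_I, of "Suc k"] dim_mult_image[OF a_ne_0 subspace_I fin_dim_I]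
    by (simp add: w_def)
qed

lemma w_growth: assumes "k \<le> 5" "0 < w k" shows "w k + 1 \<le> w (Suc k)"
  unfolding w_def
proof (rule \<rho>_growth[of _ k])
  show "\<rho> ` I k \<noteq> {0}"
  proof
    assume "\<rho> ` I k = {0}"
    then have "w k = dim ({0} :: (real \<Rightarrow> real) set)" by (simp add: w_def)
    also have "\<dots> = 0" using dim_unique[of "{}" "{0}" 0] by (simp add: independent_empty)
    finally show False using assms by simp
  qed
  show "Var 2 * v \<in> I (Suc k)" "Var 3 * v \<in> I (Suc k)" if "v \<in> I k" for v
    using I_mult(2)[OF that Var_in_forms] assms by simp_all
qed (simp_all add: subspace_I fin_dim_I I_subset)

text \<open>Since \<open>I 3\<close> is zero, \<open>w 4 + w 5 + w 6 = 11\<close>; nonzero values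
  increase strictly, and \<open>w 6\<close> is at most 7. The value 7 means
  \<open>dim (I 5) = 4\<close>, the bijective case already excluded.\<close>

lemma dims:
  obtains "dim (I 4) = 0" "dim (I 5) = 5" "w 5 = 5" "w 6 = 6"
  | "dim (I 4) = 1" "dim (I 5) = 5" "w 5 = 4" "w 6 = 6"
  | "dim (I 4) = 2" "w 5 = 3 \<or> w 5 = 4" "dim (I 5) = 2 + w 5" "w 6 = 9 - w 5"
proof -
  have "dim (I 3) = 0" using I_3 dim_unique[of "{}" "{0::ternary}" 0] by (simp add: independent_empty)
  then have e: "dim (I 4) = w 4" "dim (I 5) = w 5 + w 4" "11 = w 6 + (w 5 + w 4)"
    using dim_I_Suc[of 3] dim_I_Suc[of 4] dim_I_Suc[of 5] dim_rad I_6 by simp_all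
  have g: "0 < w 4 \<Longrightarrow> w 4 + 1 \<le> w 5" "0 < w 5 \<Longrightarrow> w 5 + 1 \<le> w 6" "w 6 \<le> 7"
    using w_growth[of 4] w_growth[of 5] w_le[of 6] by simp_all
  have "w 5 + w 4 \<noteq> 4" using dim_I5_ne_4 e by simp
  then have "(w 4 = 0 \<and> w 5 = 5 \<and> w 6 = 6) \<or> (w 4 = 1 \<and> w 5 = 4 \<and> w 6 = 6) \<or> (w 4 = 2 \<and> (w 5 = 3 \<or> w 5 = 4) \<and> w 6 = 9 - w 5)"
    using e g by presburger
  then show ?thesis using that e by auto
qed

lemma W_image_le: "N \<subseteq> rad 6 L \<Longrightarrow> dim N \<le> 11"
  using dim_mono_fin_dim[OF fin_dim_subset[OF fin_dim_forms rad_subset]] dim_rad by metis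

text \<open>On the line the ideal has codimension 1 in degrees 5 and 6. A functional m killing it in
  degree 6 also kills b times every quintic for a suitable linear form b; so m is a multiple of
  evaluation at the point a = b = 0, which is then a base point of W.\<close>

lemma case_I4_dim_0:
  assumes "dim (I 5) = 5" "w 5 = 5" "w 6 = 6" shows False
proof -
  have fdp: "fin_dim (\<rho> ` forms k)" for k by (rule fin_dim_image[OF linear_\<rho> fin_dim_forms])
  have sub: "subspace (\<rho> ` I k)" "subspace (\<rho> ` forms k)" for k
    by (simp_all add: linear_subspace_image linear_\<rho> subspace_I subspace_forms)
  have "\<rho> ` I 6 \<noteq> \<rho> ` forms 6" using assms(3) dim_\<rho>_forms_ge[of 6] by (auto simp: w_def)
  then obtain g6 where g6: "g6 \<in> forms 6" "\<rho> g6 \<notin> \<rho> ` I 6" using I_subset by blast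
  obtain \<mu> :: "(real \<Rightarrow> real) \<Rightarrow> real" where \<mu>: "linear \<mu>" "\<mu> (\<rho> g6) = 1" "\<forall>v\<in>\<rho> ` I 6. \<mu> v = 0"
    by (rule functional_separating[OF sub(1) g6(2)])
  define m where "m = (\<lambda>f. \<mu> (\<rho> f))"
  have m: "linear m" unfolding m_def using linear_compose[OF linear_\<rho> \<mu>(1)] by (simp add: o_def)
  obtain h where h: "h \<in> \<rho> ` forms 5" "\<forall>v\<in>\<rho> ` forms 5. \<exists>n\<in>\<rho> ` I 5. \<exists>r. v = n + r *\<^sub>R h"
    by (rule codim_1_decompose[OF sub(1) image_mono[OF I_subset] sub(2) fdp])
      (use dim_\<rho>_le[of 5] assms(2) in \<open>auto simp: w_def\<close>)
  then obtain g5 where g5: "g5 \<in> forms 5" "h = \<rho> g5" by blast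
  \<comment> \<open>A nontrivial solution of one linear equation in two unknowns; if both
    coefficients vanish, (1, 0) is taken.\<close>
  define \<alpha> where "\<alpha> = (if m (Var 2 * g5) = 0 \<and> m (Var 3 * g5) = 0 then 1 else m (Var 3 * g5))"
  define \<beta> where "\<beta> = (if m (Var 2 * g5) = 0 \<and> m (Var 3 * g5) = 0 then 0 else - m (Var 2 * g5))"
  have \<alpha>\<beta>: "\<alpha> \<noteq> 0 \<or> \<beta> \<noteq> 0" "\<alpha> * m (Var 2 * g5) + \<beta> * m (Var 3 * g5) = 0"
    by (auto simp: \<alpha>_def \<beta>_def)
  define b where "b = \<alpha> *\<^sub>R Var 2 + \<beta> *\<^sub>R Var 3"
  have b1: "b \<in> forms 1" unfolding b_def by (intro subspace_add subspace_scale subspace_forms Var_in_forms)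
  have \<rho>b: "\<rho> (b * f) = \<rho> (b * f')" if "\<rho> f = \<rho> f'" for f f'
    using that by (auto simp: \<rho>_def fun_eq_iff)
  have m_I: "m (b * f) = 0" if "f \<in> I 5" for f
    using I_mult(2)[OF that b1] \<mu>(3) by (simp add: m_def)
  have m_g5: "m (b * g5) = 0"
    using \<alpha>\<beta>(2) by (simp add: b_def distrib_right linear_add[OF m] linear_cmul[OF m])
  have kill: "m (a * f) = 0 \<and> m (b * f) = 0" if f: "f \<in> forms 5" for f
  proof
    show "m (a * f) = 0" using linear_0[OF \<mu>(1)] by (simp add: m_def \<rho>_a)
    obtain n r where n: "n \<in> I 5" "\<rho> f = \<rho> n + r *\<^sub>R \<rho> g5" using h(2) f g5 by blast
    then have "\<rho> f = \<rho> (n + r *\<^sub>R g5)" by (simp add: linear_add[OF linear_\<rho>] linear_cmul[OF linear_\<rho>])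
    then have "m (b * f) = m (b * (n + r *\<^sub>R g5))" unfolding m_def using \<rho>b by metis
    then show "m (b * f) = 0" using m_I[OF n(1)] m_g5 by (simp add: distrib_left linear_add[OF m] linear_cmul[OF m])
  qed
  have indep: "x = 0 \<and> y = 0" if "x *\<^sub>R a + y *\<^sub>R b = 0" for x y
  proof -
    have "ev (\<lambda>i. if i = 1 then 1 else 0) (x *\<^sub>R a + y *\<^sub>R b) = 0" unfolding that by simp
    then have "x = 0" by (simp add: a_eq b_def)
    have "ev (\<lambda>i. if i = 2 then 1 else 0) (x *\<^sub>R a + y *\<^sub>R b) = 0"
      "ev (\<lambda>i. if i = 3 then 1 else 0) (x *\<^sub>R a + y *\<^sub>R b) = 0" unfolding that by simp_all
    then show ?thesis using \<open>x = 0\<close> \<alpha>\<beta>(1) by (auto simp: b_def)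
  qed
  obtain q where q: "q \<noteq> (\<lambda>_. 0)" "ev q a = 0" "ev q b = 0"
    "\<forall>m k. linear m \<longrightarrow> (\<forall>f\<in>forms k. m (a * f) = 0 \<and> m (b * f) = 0)
      \<longrightarrow> (\<exists>c. \<forall>f\<in>forms (Suc k). m f = c * ev q f)"
    by (rule functional_killed_by_two_linear_forms[OF a_form b1 indep]) assumption+
  then obtain c where c: "\<forall>f\<in>forms (Suc 5). m f = c * ev q f" using m kill by blast
  have "c \<noteq> 0" using c g6(1) \<mu>(2) by (auto simp: m_def)
  have "ev q f = 0" if "f \<in> rad 6 L" for f
  proof -
    have "m f = 0" using that \<mu>(3) by (simp add: m_def I_6)
    then show ?thesis using c that \<open>c \<noteq> 0\<close> rad_subset[of 6 L] by auto
  qed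
  then show False by (rule no_base_point[OF q(1)])
qed

end

section \<open>Counting syzygies of quartics and quintics in the ideal\<close>

lemma independent_pairD:
  assumes ind: "independent {b1, b2}" "b1 \<noteq> b2" and zero: "x *\<^sub>R b1 + y *\<^sub>R b2 = 0"
  shows "x = 0 \<and> y = 0"
proof -
  define u where "u = (\<lambda>v. if v = b1 then x else y)"
  have "(\<Sum>v\<in>{b1, b2}. u v *\<^sub>R v) = 0" using zero ind(2) by (simp add: u_def)
  then have "u b1 = 0" "u b2 = 0"
    using ind(1)[unfolded independent_explicit_finite_subsets, rule_format, of "{b1, b2}" u] by simp_all
  then show ?thesis using ind(2) by (simp add: u_def)
qed

context extreme_sextic_line
begin

text \<open>N is split into its restriction to the line, which has grown by at least one dimension,
  and its multiples of a, which include \<open>a * p\<close> for all p in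
  \<open>I 5\<close>.\<close>

lemma dim_ge_of_growth:
  assumes N: "subspace N" "N \<subseteq> rad 6 L" and "0 < w 5"
    and mult: "\<And>b p. b \<in> forms 1 \<Longrightarrow> p \<in> I 5 \<Longrightarrow> b * p \<in> N"
  shows "w 5 + 1 + dim (I 5) \<le> dim N"
proof -
  have fdN: "fin_dim N" using N(2) rad_subset fin_dim_subset[OF fin_dim_forms] by blast
  have "\<rho> ` I 5 \<noteq> {0}"
  proof
    assume "\<rho> ` I 5 = {0}"
    then have "w 5 = dim ({0} :: (real \<Rightarrow> real) set)" by (simp add: w_def)
    also have "\<dots> = 0" by (rule dim_zero_space)
    finally show False using assms(3) by simp
  qed
  then have "w 5 + 1 \<le> dim (\<rho> ` N)" unfolding w_def
    by (intro \<rho>_growth[of _ 5]) (simp_all add: subspace_I I_subset N fdN mult)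
  moreover have sub: "(\<lambda>p. a * p) ` I 5 \<subseteq> {f \<in> N. \<rho> f = 0}" using mult[OF a_form] \<rho>_a by auto
  have fdK: "fin_dim {f \<in> N. \<rho> f = 0}" by (rule fin_dim_subset[OF fdN]) auto
  have "dim (I 5) \<le> dim {f \<in> N. \<rho> f = 0}"
    using dim_mono_fin_dim[OF fdK sub] dim_mult_image[OF a_ne_0 subspace_I fin_dim_I, of 5] by simp
  ultimately show ?thesis using rank_nullity[OF linear_\<rho> N(1) fdN] by simp
qed

text \<open>A linear syzygy with independent coefficients would give the two quartics a common cubic
  factor, which \<open>no_linear_pencil\<close> puts into \<open>I 3 = {0}\<close>. So they generate
  6 dimensions of \<open>I 5\<close> and then all of W, but two quartics generate too little in
  degree 12.\<close>

lemma case_I4_dim_2: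
  assumes I4: "dim (I 4) = 2" and w5: "w 5 = 3 \<or> w 5 = 4" "dim (I 5) = 2 + w 5" shows False
proof -
  obtain B where B: "B \<subseteq> I 4" "finite B" "independent B" "I 4 \<subseteq> span B" "card B = dim (I 4)"
    by (rule fin_dim_basis[OF fin_dim_I])
  obtain f1 f2 where f: "B = {f1, f2}" "f1 \<noteq> f2" using B(5) I4 by (auto simp: card_2_iff)
  have fI: "f1 \<in> I 4" "f2 \<in> I 4" using B f by auto
  have f4: "f1 \<in> forms 4" "f2 \<in> forms 4" using fI I_subset by blast+
  have ind: "x = 0 \<and> y = 0" if "x *\<^sub>R f1 + y *\<^sub>R f2 = 0" for x y
    by (rule independent_pairD[OF _ f(2) that]) (use B(3) f(1) in simp)
  have nz: "f1 \<noteq> 0" "f2 \<noteq> 0" using ind[of 1 0] ind[of 0 1] by auto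
  define \<Psi> where "\<Psi> = (\<lambda>(u, v). u * f1 + v * f2)"
  have \<Psi>: "linear \<Psi>" unfolding \<Psi>_def by (rule linearI) (auto simp: algebra_simps)
  have \<Psi>_mult: "b * \<Psi> (u, v) = \<Psi> (b * u, b * v)" for b u v by (simp add: \<Psi>_def algebra_simps)
  have inj: "u = 0 \<and> v = 0" if uv: "u \<in> forms 1" "v \<in> forms 1" "\<Psi> (u, v) = 0" for u v
  proof (cases "\<forall>x y. x *\<^sub>R u + y *\<^sub>R v = 0 \<longrightarrow> x = 0 \<and> y = 0")
    case True
    have eq: "u * f1 = v * (- f2)" using uv(3) by (simp add: \<Psi>_def eq_neg_iff_add_eq_0)
    have "f1 \<in> forms (Suc 3)" "- f2 \<in> forms (Suc 3)" using f4 by (simp_all add: subspace_neg subspace_forms)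
    then obtain c where c: "c \<in> forms 3" "f1 = v * c" "- f2 = u * c"
      using linear_forms_ratio[OF uv(1,2) _ _ _ eq, of 3] True by blast
    have "u * c \<in> I (Suc 3)" "v * c \<in> I (Suc 3)"
      using fI subspace_neg[OF subspace_I fI(2)] c by simp_all
    then have "c \<in> I 3" using True by (intro no_linear_pencil[OF uv(1,2) _ c(1)]) auto
    then show ?thesis using I_3 c nz by simp
  next
    case False
    then obtain x y where xy: "x *\<^sub>R u + y *\<^sub>R v = 0" "x \<noteq> 0 \<or> y \<noteq> 0" by blast
    \<comment> \<open>Eliminating one of the dependent u, v leaves a linear form times a nonzero
      combination of the quartics.\<close>
    have "x *\<^sub>R \<Psi> (u, v) = v * (x *\<^sub>R f2 - y *\<^sub>R f1) + (x *\<^sub>R u + y *\<^sub>R v) * f1"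
      "y *\<^sub>R \<Psi> (u, v) = u * (y *\<^sub>R f1 - x *\<^sub>R f2) + (x *\<^sub>R u + y *\<^sub>R v) * f2"
      by (simp_all add: \<Psi>_def algebra_simps)
    then have "v * (x *\<^sub>R f2 - y *\<^sub>R f1) = 0" "u * (y *\<^sub>R f1 - x *\<^sub>R f2) = 0" using uv(3) xy(1) by simp_all
    moreover have "x *\<^sub>R f2 - y *\<^sub>R f1 \<noteq> 0" "y *\<^sub>R f1 - x *\<^sub>R f2 \<noteq> 0"
      using ind[of "- y" x] ind[of y "- x"] xy(2) by auto
    ultimately show ?thesis by simp
  qed
  have D: "subspace (forms k \<times> forms k)" "fin_dim (forms k \<times> forms k)" "dim (forms k \<times> forms k) = 2 * dim (forms k)" for k
    by (simp_all add: subspace_Times_real subspace_forms fin_dim_Times dim_Times_fin_dim)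
  have "dim (\<Psi> ` (forms 1 \<times> forms 1)) = 6"
    using inj by (subst dim_image_inj[OF \<Psi> D(1,2)]) (auto simp: D(3) zero_prod_def dim_forms)
  moreover have sub5: "\<Psi> ` (forms 1 \<times> forms 1) \<subseteq> I 5"
    using I_mult(2)[OF fI(1), of _ 1] I_mult(2)[OF fI(2), of _ 1] by (auto simp: \<Psi>_def intro!: subspace_add[OF subspace_I])
  ultimately have "6 \<le> dim (I 5)" using dim_mono_fin_dim[OF fin_dim_I sub5] by simp
  then have w54: "w 5 = 4" "dim (I 5) = 6" using w5 by auto
  have I5: "\<Psi> ` (forms 1 \<times> forms 1) = I 5"
    using \<open>dim (\<Psi> ` (forms 1 \<times> forms 1)) = 6\<close> w54 sub5
    by (intro subspace_eq_of_dim_le[OF fin_dim_I linear_subspace_image[OF \<Psi> D(1)]]) auto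
  define N where "N = \<Psi> ` (forms 2 \<times> forms 2)"
  have N: "subspace N" unfolding N_def by (rule linear_subspace_image[OF \<Psi> D(1)])
  have Nsub: "N \<subseteq> rad 6 L"
    using I_mult(2)[OF fI(1), of _ 2] I_mult(2)[OF fI(2), of _ 2]
    by (auto simp: N_def \<Psi>_def I_6 intro!: subspace_add[OF subspace_rad[OF lin]])
  have "b * p \<in> N" if b: "b \<in> forms 1" and p: "p \<in> I 5" for b p
  proof -
    obtain u v where "u \<in> forms 1" "v \<in> forms 1" "p = \<Psi> (u, v)" using p I5 by blast
    then show ?thesis using forms_mult[OF b, of _ 1] by (auto simp: N_def \<Psi>_mult numeral_2_eq_2)
  qed
  \<comment> \<open>4 + 1 + 6 = 11 is already the dimension of W.\<close>
  then have "11 \<le> dim N" using dim_ge_of_growth[OF N Nsub] w54 by simp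
  then have Nrad: "N = rad 6 L"
    using dim_rad Nsub by (intro subspace_eq_of_dim_le[OF fin_dim_subset[OF fin_dim_forms rad_subset] N]) auto
  \<comment> \<open>Koszul syzygies: they leave at most 2 * 45 - 15 = 75 dimensions in degree
    12.\<close>
  define \<Theta> where "\<Theta> = (\<lambda>c. (f2 * c, - (f1 * c)))"
  have \<Theta>: "linear \<Theta>" unfolding \<Theta>_def by (rule linearI) (auto simp: algebra_simps)
  have "dim (\<Theta> ` forms 4) = 15"
    using nz by (subst dim_image_inj[OF \<Theta> subspace_forms fin_dim_forms]) (auto simp: \<Theta>_def zero_prod_def dim_forms)
  moreover have "dim (\<Psi> ` (forms 8 \<times> forms 8)) + dim (\<Theta> ` forms 4) \<le> dim (forms 8 \<times> forms 8)"
    by (rule dim_image_le_kernel[OF \<Psi> D(1,2)])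
      (use forms_mult[OF f4(1), of _ 4] forms_mult[OF f4(2), of _ 4] in \<open>auto simp: \<Theta>_def \<Psi>_def mult_ac subspace_neg subspace_forms\<close>)
  moreover have "90 \<le> dim (\<Psi> ` (forms 8 \<times> forms 8))"
  proof (rule dim_ideal_ge)
    show "subspace (\<Psi> ` (forms 8 \<times> forms 8))" by (rule linear_subspace_image[OF \<Psi> D(1)])
    show "\<Psi> ` (forms 8 \<times> forms 8) \<subseteq> forms 12"
      using forms_mult[OF _ f4(1), of _ 8] forms_mult[OF _ f4(2), of _ 8] by (auto simp: \<Psi>_def subspace_add subspace_forms)
    fix p h assume p: "p \<in> rad 6 L" and h: "h \<in> forms 6"
    then obtain u v where uv: "u \<in> forms 2" "v \<in> forms 2" "p = \<Psi> (u, v)" using Nrad N_def by blast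
    have "p * h = \<Psi> (h * u, h * v)" unfolding uv(3) \<Psi>_mult[symmetric] by (rule mult.commute)
    then show "p * h \<in> \<Psi> ` (forms 8 \<times> forms 8)" using forms_mult[OF h uv(1)] forms_mult[OF h uv(2)] by simp
  qed
  ultimately show False by (simp add: D(3) dim_forms)
qed

text \<open>The ideal has one quartic f and, beyond its multiples, two quintics g1, g2. Their
  multiples fill 10 or 11 dimensions of W; accordingly they have two syzygies or one in degree 6,
  and W needs one more generator or none. Either way degree 12 receives at most 89
  dimensions.\<close>

lemma case_I4_dim_1:
  assumes I4: "dim (I 4) = 1" and I5: "dim (I 5) = 5" "w 5 = 4" shows False
proof -
  have "I 4 \<noteq> {0}"
  proof
    assume eq: "I 4 = {0}"
    show False using I4 unfolding eq dim_zero_space by simp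
  qed
  then obtain f where f: "f \<in> I 4" "f \<noteq> 0" using subspace_0[OF subspace_I] by blast
  have f4: "f \<in> forms 4" using f I_subset by blast
  define N0 where "N0 = (\<lambda>u. f * u) ` forms 1"
  have N0: "subspace N0" "dim N0 = 3" unfolding N0_def
    using f(2) by (simp_all add: linear_subspace_image linear_mult_left subspace_forms dim_mult_image dim_forms)
  have N0sub: "N0 \<subseteq> I 5" using I_mult(1)[OF f(1), of _ 1] by (auto simp: N0_def)
  have "N0 \<noteq> I 5"
  proof
    assume eq: "N0 = I 5"
    show False using N0(2) unfolding eq I5(1) by simp
  qed
  then obtain g1 where g1: "g1 \<in> I 5" "g1 \<notin> N0" using N0sub by blast
  define N1 where "N1 = span (insert g1 N0)"
  have "N1 \<subseteq> I 5" unfolding N1_def by (rule span_minimal[OF _ subspace_I]) (use g1(1) N0sub in auto)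
  moreover have "subspace N1" unfolding N1_def by (rule subspace_span)
  moreover have "insert g1 N0 \<subseteq> N1" unfolding N1_def by (rule span_superset)
  ultimately have N1: "subspace N1" "N1 \<subseteq> I 5" "N0 \<subseteq> N1" "g1 \<in> N1" by simp_all
  have fdN1: "fin_dim N1" by (rule fin_dim_subset[OF fin_dim_I N1(2)])
  have "dim N1 \<noteq> 3 \<and> \<not> dim N1 < 3"
  proof -
    have "\<not> dim N1 \<le> dim N0" using subspace_eq_of_dim_le[OF fdN1 N0(1) N1(3)] g1(2) N1(4) by blast
    then show ?thesis using N0(2) by auto
  qed
  moreover have "dim N1 \<le> 4"
    using dim_span_insert_le[OF fin_dim_subset[OF fin_dim_I N0sub], of g1] N0(2) by (simp add: N1_def)
  ultimately have dN1: "dim N1 = 4" by linarith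
  obtain g2 where g2: "g2 \<in> I 5" "\<forall>v\<in>I 5. \<exists>n\<in>N1. \<exists>x. v = n + x *\<^sub>R g2"
    by (rule codim_1_decompose[OF N1(1,2) subspace_I fin_dim_I]) (use dN1 I5 in auto)
  have g2n: "g2 \<notin> N1"
  proof
    assume "g2 \<in> N1"
    then have "I 5 \<subseteq> N1" using g2(2) subspace_add[OF N1(1)] subspace_scale[OF N1(1)] by (metis subsetI)
    from dim_mono_fin_dim[OF fdN1 this] show False unfolding dN1 I5(1) by simp
  qed
  have g5: "g1 \<in> forms 5" "g2 \<in> forms 5" using g1(1) g2(1) I_subset by blast+
  have gen: "\<exists>u\<in>forms 1. \<exists>x y. p = f * u + x *\<^sub>R g1 + y *\<^sub>R g2" if p: "p \<in> I 5" for p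
  proof -
    obtain n y where n: "n \<in> N1" "p = n + y *\<^sub>R g2" using g2(2) p by blast
    then obtain x where "n - x *\<^sub>R g1 \<in> span N0" unfolding N1_def by (auto simp: span_breakdown_eq)
    moreover have "span N0 = N0" using N0(1) by (metis span_eq_iff)
    ultimately have "n - x *\<^sub>R g1 \<in> N0" by simp
    then obtain u where u: "u \<in> forms 1" "n - x *\<^sub>R g1 = f * u" by (auto simp: N0_def)
    then have "p = f * u + x *\<^sub>R g1 + y *\<^sub>R g2" using n(2) by (simp add: algebra_simps)
    then show ?thesis using u by blast
  qed
  have ind: "x = 0 \<and> y = 0" if u: "u \<in> forms 1" "f * u + x *\<^sub>R g1 + y *\<^sub>R g2 = 0" for u x y
  proof -
    have fu: "f * u \<in> N0" unfolding N0_def using u(1) by (rule imageI)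
    have "y = 0"
    proof (rule ccontr)
      assume y: "y \<noteq> 0"
      have "y *\<^sub>R g2 + (f * u + x *\<^sub>R g1) = 0" using u(2) by (metis add.commute)
      then have "y *\<^sub>R g2 = - (f * u + x *\<^sub>R g1)" by (rule eq_neg_iff_add_eq_0[THEN iffD2])
      then have "(1 / y) *\<^sub>R (y *\<^sub>R g2) = (1 / y) *\<^sub>R (- (f * u + x *\<^sub>R g1))" by simp
      then have "g2 = (1 / y) *\<^sub>R (- (f * u + x *\<^sub>R g1))" using y by simp
      moreover have "f * u + x *\<^sub>R g1 \<in> N1" using fu N1 by (auto intro: subspace_add subspace_scale)
      ultimately have "g2 \<in> N1" using N1(1) by (metis subspace_neg subspace_scale)
      then show False using g2n by simp
    qed
    moreover have "x = 0"
    proof (rule ccontr)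
      assume x: "x \<noteq> 0"
      have "x *\<^sub>R g1 + f * u = 0" using u(2) \<open>y = 0\<close> by (simp add: add.commute)
      then have "x *\<^sub>R g1 = - (f * u)" by (rule eq_neg_iff_add_eq_0[THEN iffD2])
      then have "(1 / x) *\<^sub>R (x *\<^sub>R g1) = (1 / x) *\<^sub>R (- (f * u))" by simp
      then have "g1 = (1 / x) *\<^sub>R (- (f * u))" using x by simp
      then have "g1 \<in> N0" using fu N0(1) by (metis subspace_neg subspace_scale)
      then show False using g1 by simp
    qed
    ultimately show ?thesis by simp
  qed
  define \<Psi> where "\<Psi> = (\<lambda>(A, u, v). f * A + g1 * u + g2 * v)"
  have \<Psi>: "linear \<Psi>" unfolding \<Psi>_def by (rule linearI) (auto simp: algebra_simps)
  \<comment> \<open>The action of the ring on coefficient triples, over which \<Psi> is linear; it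
    multiplies syzygies by forms.\<close>
  define sc where "sc = (\<lambda>(c::ternary) (A, u, v). (c * A, c * u, c * (v::ternary)))"
  have sc: "sc c (A, u, v) = (c * A, c * u, c * v)" for c A u v by (simp add: sc_def)
  have \<Psi>_sc: "\<Psi> (sc c z) = c * \<Psi> z" for c z by (cases z) (simp add: sc \<Psi>_def algebra_simps)
  have lin_sc: "linear (\<lambda>c. sc c z)" for z
    by (rule linearI) (auto simp: sc_def case_prod_beta algebra_simps prod_eq_iff)
  define D where "D k = forms (Suc k) \<times> forms k \<times> forms k" for k
  have D: "subspace (D k)" "fin_dim (D k)" "dim (D k) = dim (forms (Suc k)) + 2 * dim (forms k)" for k
    by (simp_all add: D_def subspace_Times_real subspace_forms fin_dim_Times dim_Times_fin_dim)
  have sc_D: "sc c z \<in> D (j + k)" if "c \<in> forms j" "z \<in> D k" for c z j k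
    using that forms_mult[OF that(1), of _ "Suc k"] forms_mult[OF that(1), of _ k] by (auto simp: D_def sc)
  define N where "N = \<Psi> ` D 1"
  have N: "subspace N" unfolding N_def by (rule linear_subspace_image[OF \<Psi> D(1)])
  have Nsub: "N \<subseteq> rad 6 L"
  proof
    fix p assume "p \<in> N"
    then obtain A u v where z: "A \<in> forms 2" "u \<in> forms 1" "v \<in> forms 1" "p = f * A + g1 * u + g2 * v"
      by (auto simp: N_def D_def \<Psi>_def numeral_2_eq_2)
    have "f * A \<in> I 6" "g1 * u \<in> I 6" "g2 * v \<in> I 6"
      using I_mult(1)[OF f(1) z(1)] I_mult(1)[OF g1(1) z(2)] I_mult(1)[OF g2(1) z(3)] by simp_all
    then show "p \<in> rad 6 L" unfolding z(4) I_6 by (intro subspace_add subspace_rad lin)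
  qed
  have mult: "b * p \<in> N" if b: "b \<in> forms 1" and p: "p \<in> I 5" for b p
  proof -
    obtain u x y where u: "u \<in> forms 1" "p = f * u + x *\<^sub>R g1 + y *\<^sub>R g2" using gen[OF p] by blast
    have "b * p = \<Psi> (b * u, x *\<^sub>R b, y *\<^sub>R b)" by (simp add: u(2) \<Psi>_def algebra_simps)
    moreover have "(b * u, x *\<^sub>R b, y *\<^sub>R b) \<in> D 1"
      using forms_mult[OF b u(1)] b by (simp add: D_def subspace_scale subspace_forms numeral_2_eq_2)
    ultimately show ?thesis by (auto simp: N_def)
  qed
  have dN: "10 \<le> dim N" "dim N \<le> 11" using dim_ge_of_growth[OF N Nsub _ mult] I5 W_image_le[OF Nsub] by simp_all
  \<comment> \<open>Syzygies with a quadratic coefficient of f and linear ones of g1 and g2; the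
    coefficient space has dimension 6 + 3 + 3 = 12.\<close>
  define Z where "Z = {z \<in> D 1. \<Psi> z = 0}"
  have Z: "subspace Z" "fin_dim Z" "dim Z = 12 - dim N"
    using subspace_kernel_on[OF \<Psi> D(1)] fin_dim_subset[OF D(2), of Z 1] rank_nullity[OF \<Psi> D(1,2), of 1]
    by (auto simp: Z_def N_def D(3) dim_forms)
  have sub12: "\<Psi> ` D 7 \<subseteq> forms 12"
    using forms_mult[OF f4, of _ 8] forms_mult[OF g5(1), of _ 7] forms_mult[OF g5(2), of _ 7]
    by (auto simp: \<Psi>_def D_def intro!: subspace_add[OF subspace_forms])
  have NJ: "p * h \<in> \<Psi> ` D 7" if p: "p \<in> N" and h: "h \<in> forms 6" for p h
  proof -
    obtain z where z: "z \<in> D 1" "p = \<Psi> z" using p by (auto simp: N_def)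
    have "p * h = \<Psi> (sc h z)" by (simp add: z(2) \<Psi>_sc mult.commute)
    then show ?thesis using sc_D[OF h z(1)] by simp
  qed
  have Zcomp: "A = 0" if "(A, 0, 0) \<in> Z" for A
    using that f(2) by (simp add: Z_def \<Psi>_def)
  show False
  proof (cases "dim N = 11")
    case True
    then have Nrad: "N = rad 6 L"
      using dim_rad Nsub by (intro subspace_eq_of_dim_le[OF fin_dim_subset[OF fin_dim_forms rad_subset] N]) auto
    have "Z \<noteq> {0}"
    proof
      assume eq: "Z = {0}"
      show False using Z(3) unfolding eq dim_zero_space True by simp
    qed
    then obtain z where z: "z \<in> Z" "z \<noteq> 0" using subspace_0[OF Z(1)] by blast
    have inj: "c = 0" if "sc c z = 0" for c using that z(2) by (cases z) (auto simp: sc zero_prod_def)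
    \<comment> \<open>Sextic multiples of one syzygy: of the 117 dimensions of \<open>D 7\<close> at
      most 117 - 28 = 89 survive, one short.\<close>
    have "dim ((\<lambda>c. sc c z) ` forms 6) = 28"
      using inj by (subst dim_image_inj[OF lin_sc subspace_forms fin_dim_forms]) (auto simp: dim_forms)
    moreover have "dim (\<Psi> ` D 7) + dim ((\<lambda>c. sc c z) ` forms 6) \<le> dim (D 7)"
      by (rule dim_image_le_kernel[OF \<Psi> D(1,2)])
        (use z(1) sc_D[of _ 6 z 1] in \<open>auto simp: Z_def \<Psi>_sc\<close>)
    moreover have "90 \<le> dim (\<Psi> ` D 7)"
      by (rule dim_ideal_ge[OF linear_subspace_image[OF \<Psi> D(1)] sub12]) (use NJ Nrad in blast)
    ultimately show False by (simp add: D(3) dim_forms)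
  next
    case False
    then have N10: "dim N = 10" "dim Z = 2" using dN Z(3) by auto
    obtain B where B: "B \<subseteq> Z" "finite B" "independent B" "Z \<subseteq> span B" "card B = dim Z"
      by (rule fin_dim_basis[OF Z(2)])
    obtain \<sigma>1 \<sigma>2 where \<sigma>: "B = {\<sigma>1, \<sigma>2}" "\<sigma>1 \<noteq> \<sigma>2" using B(5) N10 by (auto simp: card_2_iff)
    have \<sigma>ind: "x = 0 \<and> y = 0" if "x *\<^sub>R \<sigma>1 + y *\<^sub>R \<sigma>2 = 0" for x y
      by (rule independent_pairD[OF _ \<sigma>(2) that]) (use B(3) \<sigma>(1) in simp)
    obtain A u v A' u' v' where \<sigma>12: "\<sigma>1 = (A, u, v)" "\<sigma>2 = (A', u', v')" by (metis prod_cases3)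
    have \<sigma>Z: "(A, u, v) \<in> Z" "(A', u', v') \<in> Z" using B(1) \<sigma> \<sigma>12 by auto
    then have mem: "A \<in> forms (Suc 1)" "u \<in> forms 1" "v \<in> forms 1" "A' \<in> forms (Suc 1)" "u' \<in> forms 1" "v' \<in> forms 1"
      and syz: "f * A + g1 * u + g2 * v = 0" by (auto simp: Z_def D_def \<Psi>_def)
    have zcomb: "x = 0 \<and> y = 0" if "x *\<^sub>R u + y *\<^sub>R u' = 0" "x *\<^sub>R v + y *\<^sub>R v' = 0" for x y
    proof -
      have "x *\<^sub>R (A, u, v) + y *\<^sub>R (A', u', v') \<in> Z" using \<sigma>Z Z(1) by (intro subspace_add subspace_scale)
      then have "(x *\<^sub>R A + y *\<^sub>R A', 0, 0) \<in> Z" using that by simp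
      then have "x *\<^sub>R \<sigma>1 + y *\<^sub>R \<sigma>2 = 0" using Zcomp that by (simp add: \<sigma>12 zero_prod_def)
      then show ?thesis by (rule \<sigma>ind)
    qed
    \<comment> \<open>Vanishing minors make the two syzygies proportional over the fraction field.
      Dividing one of them by a linear form then leaves a relation among f, g1, g2 with a nonzero
      constant coefficient, against \<open>ind\<close>.\<close>
    have not_prop: False if minors: "u * v' = v * u'" "u * A' = A * u'" "v * A' = A * v'"
    proof (cases "\<forall>x y. x *\<^sub>R v + y *\<^sub>R v' = 0 \<longrightarrow> x = 0 \<and> y = 0")
      case True
      have "v \<noteq> 0" using True[rule_format, of 1 0] by auto
      have 1: "v * u' = v' * u" "v * A' = v' * A" using minors by (simp_all add: mult.commute)
      have mem0: "u' \<in> forms (Suc 0)" "u \<in> forms (Suc 0)" using mem by simp_all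
      obtain c where c: "c \<in> forms 0" "u = v * c"
        using linear_forms_ratio[OF mem(3,6) _ mem0 1(1)] True by blast
      obtain e where e: "e \<in> forms 1" "A = v * e"
        using linear_forms_ratio[OF mem(3,6) _ mem(4,1) 1(2)] True by blast
      obtain \<kappa> where \<kappa>: "c = \<kappa> *\<^sub>R 1" using c(1) forms_0 by blast
      have "v * (f * e + \<kappa> *\<^sub>R g1 + 1 *\<^sub>R g2) = 0" using syz by (simp add: c(2) e(2) \<kappa> algebra_simps)
      then have "f * e + \<kappa> *\<^sub>R g1 + 1 *\<^sub>R g2 = 0" using \<open>v \<noteq> 0\<close> by simp
      then show False using ind[OF e(1)] by fastforce
    next
      case False
      then obtain x y where xy: "x *\<^sub>R v + y *\<^sub>R v' = 0" "x \<noteq> 0 \<or> y \<noteq> 0" by blast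
      define u0 where "u0 = x *\<^sub>R u + y *\<^sub>R u'"
      have u0: "u0 \<noteq> 0" using zcomb[of x y] xy by (auto simp: u0_def)
      have "u0 * v = y *\<^sub>R (v * u' - u * v') + u * (x *\<^sub>R v + y *\<^sub>R v')"
        "u0 * v' = x *\<^sub>R (u * v' - v * u') + u' * (x *\<^sub>R v + y *\<^sub>R v')"
        by (simp_all add: u0_def algebra_simps)
      then have "u0 * v = 0" "u0 * v' = 0" using minors(1) xy(1) by simp_all
      then have v0: "v = 0" "v' = 0" using u0 by simp_all
      have uind: "\<And>x y. x *\<^sub>R u + y *\<^sub>R u' = 0 \<Longrightarrow> x = 0 \<and> y = 0" using zcomb v0 by simp
      have "u \<noteq> 0" using uind[of 1 0] by auto
      have 2: "u * A' = u' * A" using minors(2) by (simp add: mult.commute)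
      obtain e where e: "e \<in> forms 1" "A = u * e"
        using linear_forms_ratio[OF mem(2,5) _ mem(4,1) 2] uind by blast
      have "u * (f * e + 1 *\<^sub>R g1 + 0 *\<^sub>R g2) = 0" using syz by (simp add: v0 e(2) algebra_simps)
      then have "f * e + 1 *\<^sub>R g1 + 0 *\<^sub>R g2 = 0" using \<open>u \<noteq> 0\<close> by (metis mult_eq_0_iff)
      then show False using ind[OF e(1)] by fastforce
    qed
    define \<Theta> where "\<Theta> = (\<lambda>(c, c'). (sc c \<sigma>1 + sc c' \<sigma>2, 0 :: ternary))"
    have \<Theta>: "linear \<Theta>" unfolding \<Theta>_def
      by (rule linearI) (auto simp: linear_add[OF lin_sc] linear_cmul[OF lin_sc] algebra_simps)
    have inj: "c = 0 \<and> c' = 0" if "\<Theta> (c, c') = 0" for c c'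
    proof -
      have eqs: "c * A + c' * A' = 0" "c * u + c' * u' = 0" "c * v + c' * v' = 0"
        using that by (simp_all add: \<Theta>_def \<sigma>12 sc zero_prod_def)
      \<comment> \<open>Cramer's rule: a relation between the syzygies has coefficients annihilated
        by every minor, so a nontrivial one forces all minors to vanish.\<close>
      have minor: "c * (p * r' - r * p') = 0 \<and> c' * (p * r' - r * p') = 0"
        if "c * p + c' * p' = 0" "c * r + c' * r' = 0" for p p' r r'
      proof -
        have "c * (p * r' - r * p') = (c * p + c' * p') * r' - (c * r + c' * r') * p'"
          "c' * (p * r' - r * p') = p * (c * r + c' * r') - r * (c * p + c' * p')"
          by (simp_all add: algebra_simps)
        then show ?thesis using that by simp
      qed
      show ?thesis
      proof (rule ccontr)
        assume "\<not> ?thesis"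
        then have "u * v' - v * u' = 0" "u * A' - A * u' = 0" "v * A' - A * v' = 0"
          using minor[OF eqs(2,3)] minor[OF eqs(2,1)] minor[OF eqs(3,1)] by auto
        then show False by (intro not_prop) simp_all
      qed
    qed
    obtain g where g: "g \<in> rad 6 L" "\<forall>p\<in>rad 6 L. \<exists>n\<in>N. \<exists>x. p = n + x *\<^sub>R g"
      by (rule codim_1_decompose[OF N Nsub subspace_rad[OF lin] fin_dim_subset[OF fin_dim_forms rad_subset]])
        (use N10 dim_rad in auto)
    have g6: "g \<in> forms 6" using g(1) rad_subset by blast
    define \<Psi>' where "\<Psi>' = (\<lambda>(z, b). \<Psi> z + g * b)"
    have \<Psi>': "linear \<Psi>'" unfolding \<Psi>'_def
      by (rule linearI) (simp_all add: case_prod_beta linear_add[OF \<Psi>] linear_cmul[OF \<Psi>] algebra_simps)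
    let ?D = "D 7 \<times> forms 6"
    have D': "subspace ?D" "fin_dim ?D" "dim ?D = 145"
      by (simp_all add: subspace_Times_real subspace_forms fin_dim_Times dim_Times_fin_dim D dim_forms)
    have F: "subspace (forms 6 \<times> forms 6)" "fin_dim (forms 6 \<times> forms 6)" "dim (forms 6 \<times> forms 6) = 56"
      by (simp_all add: subspace_Times_real subspace_forms fin_dim_Times dim_Times_fin_dim dim_forms)
    \<comment> \<open>The two syzygies remove 2 * 28 dimensions and the additional generator g adds
      28: again 117 + 28 - 56 = 89.\<close>
    have "dim (\<Theta> ` (forms 6 \<times> forms 6)) = 56"
      using inj F(3) by (subst dim_image_inj[OF \<Theta> F(1,2)]) (auto simp: zero_prod_def)
    moreover have "dim (\<Psi>' ` ?D) + dim (\<Theta> ` (forms 6 \<times> forms 6)) \<le> dim ?D"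
    proof (rule dim_image_le_kernel[OF \<Psi>' D'(1,2)])
      have \<sigma>D: "\<sigma>1 \<in> D 1" "\<sigma>2 \<in> D 1" "\<Psi> \<sigma>1 = 0" "\<Psi> \<sigma>2 = 0" using \<sigma>Z unfolding Z_def \<sigma>12 by simp_all
      have "sc c \<sigma>1 + sc c' \<sigma>2 \<in> D 7" if "c \<in> forms 6" "c' \<in> forms 6" for c c'
        using sc_D[OF that(1) \<sigma>D(1)] sc_D[OF that(2) \<sigma>D(2)] by (simp add: subspace_add[OF D(1)])
      then show "\<Theta> ` (forms 6 \<times> forms 6) \<subseteq> ?D" by (auto simp: \<Theta>_def subspace_0 subspace_forms)
      show "\<Psi>' v = 0" if "v \<in> \<Theta> ` (forms 6 \<times> forms 6)" for v
        using that \<sigma>D by (auto simp: \<Theta>_def \<Psi>'_def linear_add[OF \<Psi>] \<Psi>_sc)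
    qed
    moreover have "90 \<le> dim (\<Psi>' ` ?D)"
    proof (rule dim_ideal_ge)
      show "subspace (\<Psi>' ` ?D)" by (rule linear_subspace_image[OF \<Psi>' D'(1)])
      show "\<Psi>' ` ?D \<subseteq> forms 12"
        using sub12 forms_mult[OF g6, of _ 6] by (auto simp: \<Psi>'_def intro!: subspace_add[OF subspace_forms])
      fix p h assume p: "p \<in> rad 6 L" and h: "h \<in> forms 6"
      obtain n x where n: "n \<in> N" "p = n + x *\<^sub>R g" using g(2) p by blast
      obtain z where z: "z \<in> D 7" "n * h = \<Psi> z" using NJ[OF n(1) h] by blast
      have "p * h = \<Psi>' (z, x *\<^sub>R h)" using z(2) by (simp add: n(2) \<Psi>'_def distrib_right)
      then show "p * h \<in> \<Psi>' ` ?D" using z(1) h by (simp add: subspace_scale subspace_forms)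
    qed
    ultimately show False using D'(3) by simp
  qed
qed

lemma contradiction: False
  using dims case_I4_dim_0 case_I4_dim_1 case_I4_dim_2 by metis

end

theorem no_extreme_ray_6_17: "\<not> has_extreme_ray_of_rank 6 17"
proof
  assume "has_extreme_ray_of_rank 6 17"
  then obtain l where l: "ray l face_of sos_dual 6" "bilinear_rank (forms 6) (B_form l) = 17"
    by (auto simp: has_extreme_ray_of_rank_def extreme_ray_of_def)
  have "1 *\<^sub>R l \<in> ray l" unfolding ray_def by (intro CollectI exI[of _ 1]) simp
  then have "l \<in> sos_dual 6" using face_of_imp_subset[OF l(1)] by auto
  then obtain L where L: "linear L" "l = restrict_to (forms (2 * 6)) L"
    using dual_space_linear_extension unfolding sos_dual_def by blast
  have psd: "psd_on 6 L" using \<open>l \<in> sos_dual 6\<close> unfolding L(2) restrict_to_in_sos_dual_iff[OF L(1)] .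
  interpret extreme_sextic L
  proof
    show "psd_on 6 L" by (rule psd)
    show "dim (rad 6 L) = 11" using bilinear_rank_restrict_to[OF L(1), of 6] l(2) L(2) by (simp add: dim_forms)
    show "\<exists>c. \<forall>h\<in>forms 12. m h = c * L h"
      if "linear m" "\<And>f g. f \<in> rad 6 L \<Longrightarrow> g \<in> forms 6 \<Longrightarrow> m (f * g) = 0" for m
      using extreme_ray_unique[OF _ psd that] l(1) L(2) by simp
  qed
  obtain s t where st: "\<forall>p\<in>forms 5. (Var 1 + s *\<^sub>R Var 2 + t *\<^sub>R Var 3) * p \<in> rad 6 L \<longrightarrow> p \<in> I 5"
    by (rule exists_generic_linear_form)
  interpret extreme_sextic_line L "Var 1 + s *\<^sub>R Var 2 + t *\<^sub>R Var 3" s t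
    by unfold_locales (use st in auto)
  show False by (rule contradiction)
qed

theorem mainTheorem5:
  shows "(\<forall>d \<in> {4, 5}. has_extreme_ray_of_rank d 1 \<and>
            (\<forall>r. 3 * d - 2 \<le> r \<and> r \<le> ((d + 2) choose 2) - 4 \<longrightarrow> has_extreme_ray_of_rank d r))
         \<and> \<not> has_extreme_ray_of_rank 6 17
         \<and> (\<forall>r. 16 \<le> r \<and> r \<le> 24 \<and> r \<noteq> 17 \<longrightarrow> has_extreme_ray_of_rank 6 r)"
proof (intro conjI)
  \<comment> \<open>The ranges evaluate to 10, 11 for d = 4 and to 13, ..., 17 for d = 5.\<close>
  have "has_extreme_ray_of_rank 4 r" if "10 \<le> r" "r \<le> 11" for r
  proof -
    have "r = 10 \<or> r = 11" using that by presburger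
    then show ?thesis using extreme_ray_grids extreme_ray_4_11 by blast
  qed
  moreover have "has_extreme_ray_of_rank 5 r" if "13 \<le> r" "r \<le> 17" for r
  proof -
    have "r = 13 \<or> r = 14 \<or> r = 15 \<or> r = 16 \<or> r = 17" using that by presburger
    then show ?thesis using extreme_ray_grids extreme_ray_5_15 extreme_ray_5_16 extreme_ray_5_17 by blast
  qed
  ultimately show "\<forall>d \<in> {4, 5}. has_extreme_ray_of_rank d 1 \<and>
      (\<forall>r. 3 * d - 2 \<le> r \<and> r \<le> ((d + 2) choose 2) - 4 \<longrightarrow> has_extreme_ray_of_rank d r)"
    using has_extreme_ray_of_rank_1 by (simp add: choose_two)
  show "\<not> has_extreme_ray_of_rank 6 17" by (rule no_extreme_ray_6_17)
  show "\<forall>r. 16 \<le> r \<and> r \<le> 24 \<and> r \<noteq> 17 \<longrightarrow> has_extreme_ray_of_rank 6 r"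
  proof (intro allI impI)
    fix r :: nat assume "16 \<le> r \<and> r \<le> 24 \<and> r \<noteq> 17"
    then have "r = 16 \<or> r = 18 \<or> r = 19 \<or> r = 20 \<or> r = 21 \<or> r = 22 \<or> r = 23 \<or> r = 24" by presburger
    then show "has_extreme_ray_of_rank 6 r"
      using extreme_ray_grids extreme_ray_6_19 extreme_ray_6_20 extreme_ray_6_21 extreme_ray_6_22
        extreme_ray_6_23 extreme_ray_6_24 by blast
  qed
qed

end
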